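(* Let $(E,q,M)$ be a vector bundle over a manifold $M$, let $\mathfrak g$ be a Lie algebra, and let $X\mapsto X_M$, $\mathfrak g\to\Gamma TM$, be an infinitesimal action of $\mathfrak g$ on $M$. Then there is a one-to-one correspondence between derivative representations of $\mathfrak g$ on $E$ associated to the given infinitesimal action, and representations of the action Lie algebroid $\mathfrak g\ltimes M$ on $E$.
   Context: All manifolds are smooth and second countable, and all maps are smooth. $\Gamma E$ denotes the $C^\infty(M)$-module of smooth sections of a vector bundle $E\to M$, where $C^\infty(M)$ is the algebra of smooth $\mathbb R$-valued functions. Lie algebroid: a Lie algebroid on $M$ is a vector bundle $A\to M$ with a vector bundle map $a\colon A\to TM$ over $M$ (the anchor) and an $\mathbb R$-bilinear alternating bracket on $\Gamma A$ satisfying the Jacobi identity, with $a([X,Y])=[a(X),a(Y)]$ and $[X,fY]=f[X,Y]+a(X)(f)Y$ for all $X,Y\in\Gamma A$, $f\in C^\infty(M)$. A morphism of Lie algebroids $A\to A'$ on the same base $M$ is a vector bundle morphism $\varphi\colon A\to A'$ over $M$ with $a'\circ\varphi=a$ and $\varphi([X,Y])=[\varphi(X),\varphi(Y)]$ for all $X,Y\in\Gamma A$. Derivative endomorphisms and $\mathfrak D(E)$: a derivative endomorphism of $\Gamma E$ is an $\mathbb R$-linear endomorphism $D$ of $\Gamma E$ for which there is an $\mathbb R$-linear endomorphism $D_M$ of $C^\infty(M)$ such that $D(f\psi)=fD(\psi)+D_M(f)\psi$ for all $f\in C^\infty(M)$, $\psi\in\Gamma E$. Then $D$ is a first-order differential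 operator with scalar symbol, and $D_M$ is a vector field on $M$. $\mathfrak D(E)$ denotes the Lie algebroid on $M$ whose sections are the derivative endomorphisms of $\Gamma E$, with bracket the commutator and anchor $D\mapsto D_M$; as a vector bundle it is the pullback of the symbol map $\sigma\colon \mathrm{Diff}^1(E)\to TM\otimes \mathrm{End}(E)$ and the injection $TM\to TM\otimes\mathrm{End}(E)$, $X\mapsto X\otimes\mathrm{Id}_E$, where $\mathrm{Diff}^1(E)$ is the vector bundle whose sections are the first-order differential operators $\Gamma E\to \Gamma E$. Infinitesimal action: an infinitesimal action of $\mathfrak g$ on $M$ is an $\mathbb R$-linear map $X\mapsto X_M$, $\mathfrak g\to\Gamma TM$, with $[X,Y]_M=[X_M,Y_M]$ for all $X,Y\in\mathfrak g$. Derivative representation: a derivative representation of $\mathfrak g$ on $E$ is a morphism of Lie algebras $\rho\colon\mathfrak g\to\Gamma\mathfrak D(E)$. It is associated to the infinitesimal action $X\mapsto X_M$ if $(\rho(X))_M=X_M$ for all $X\in\mathfrak g$. Action Lie algebroid: $\mathfrak g\ltimes M$ is the trivial vector bundle $M\times\mathfrak g\to M$ with anchor $a(m,X)=X_M(m)$ and with bracket on sections, regarded as maps $V,W\colon M\to\mathfrak g$, given by $[V,W]=V_M(W)-W_M(V)+[V,W]^\bullet$, where $V_M$ is the vector field $V_M(m)=(V(m)_M)(m)$, $V_M(W)$ is the Lie derivative of the vector-valued function $W$ with respect to $V_M$, and $[V,W]^\bullet$ is the pointwise bracket in $\mathfrak g$. Representation of a Lie algebroid: a representation of a Lie algebroid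 $A$ on base $M$ on the vector bundle $E\to M$ is a morphism of Lie algebroids $A\to\mathfrak D(E)$ over $M$. *)

theory Defs
  imports "HOL-Analysis.Analysis"
begin

section \<open>Smooth maps and manifolds\<close>

text \<open>
  Model spaces (of manifolds, of fibres, and the Lie algebra) are finite-dimensional
  \<^class>\<open>real_normed_vector\<close> types rather than \<^class>\<open>euclidean_space\<close> types, because the
  latter exclude dimension 0. All norms on a finite-dimensional space are equivalent, so
  the choice of norm does not affect smoothness.
\<close>

definition finite_dimensional :: "'a::real_vector itself \<Rightarrow> bool" where
  "finite_dimensional _ \<longleftrightarrow> (\<exists>B :: 'a set. finite B \<and> span B = UNIV)"

text \<open>\<open>Ck_on k S f\<close>: \<open>f\<close> is of class \<open>C^k\<close> on the open subset \<open>S\<close> of a finite-dimensional space;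
  the recursion is through all directional derivatives.\<close>

fun Ck_on :: "nat \<Rightarrow> 'a::real_normed_vector set \<Rightarrow> ('a \<Rightarrow> 'b::real_normed_vector) \<Rightarrow> bool" where
  "Ck_on 0 S f \<longleftrightarrow> continuous_on S f"
| "Ck_on (Suc k) S f \<longleftrightarrow>
     (\<forall>x\<in>S. f differentiable (at x)) \<and> (\<forall>v. Ck_on k S (\<lambda>x. frechet_derivative f (at x) v))"

definition smooth_on :: "'a::real_normed_vector set \<Rightarrow> ('a \<Rightarrow> 'b::real_normed_vector) \<Rightarrow> bool" where
  "smooth_on S f \<longleftrightarrow> (\<forall>k. Ck_on k S f)"

text \<open>A chart is a pair of its domain and its coordinate map; the values of the coordinate map
  outside the domain are irrelevant.\<close>

type_synonym ('m, 'e) chart = "'m set \<times> ('m \<Rightarrow> 'e)"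
type_synonym ('m, 'e) atlas = "('m, 'e) chart set"

definition smooth_map :: "('m, 'a::real_normed_vector) atlas \<Rightarrow> ('n, 'b::real_normed_vector) atlas
    \<Rightarrow> ('m \<Rightarrow> 'n) \<Rightarrow> bool" where
  "smooth_map \<A> \<B> f \<longleftrightarrow> (\<forall>(U, \<phi>) \<in> \<A>. \<forall>(V, \<psi>) \<in> \<B>.
     open (\<phi> ` (U \<inter> f -` V)) \<and> smooth_on (\<phi> ` (U \<inter> f -` V)) (\<psi> \<circ> f \<circ> inv_into U \<phi>))"

text \<open>A manifold is a Hausdorff second countable space, here a whole type, with a smooth atlas.
  The last conjunct says that the coordinate changes are smooth.\<close>

definition smooth_manifold ::
    "('m::{t2_space,second_countable_topology}, 'e::real_normed_vector) atlas \<Rightarrow> bool" where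
  "smooth_manifold \<A> \<longleftrightarrow>
     finite_dimensional TYPE('e) \<and>
     (\<Union>(U, \<phi>) \<in> \<A>. U) = UNIV \<and>
     (\<forall>(U, \<phi>) \<in> \<A>. open U \<and> open (\<phi> ` U) \<and> homeomorphism U (\<phi> ` U) \<phi> (inv_into U \<phi>)) \<and>
     smooth_map \<A> \<A> (\<lambda>m. m)"

definition Cinf :: "('m, 'e::real_normed_vector) atlas \<Rightarrow> ('m \<Rightarrow> real) set" where
  "Cinf \<A> = {f. smooth_map \<A> {(UNIV, \<lambda>t. t)} f}"

section \<open>Vector bundles\<close>

text \<open>
  The smooth structure of a vector bundle is given by a vector bundle atlas. For a local
  trivialisation \<open>(W, \<psi>)\<close>, the map \<open>\<psi>\<close> is the component of \<open>E|\<^sub>W \<rightarrow> W \<times> F\<close> in the typical fibre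
  \<open>F\<close>. Only the values of \<open>vadd\<close> on pairs in a common fibre are relevant.
\<close>

record ('m, 'v, 'f) vbundle =
  total :: "'v set"
  proj :: "'v \<Rightarrow> 'm"
  vadd :: "'v \<Rightarrow> 'v \<Rightarrow> 'v"
  vscale :: "real \<Rightarrow> 'v \<Rightarrow> 'v"
  trivs :: "('m set \<times> ('v \<Rightarrow> 'f)) set"

definition fibre :: "('m, 'v, 'f, 'z) vbundle_scheme \<Rightarrow> 'm \<Rightarrow> 'v set" where
  "fibre E m = {e \<in> total E. proj E e = m}"

text \<open>The atlas of the total space induced by an atlas of the base and the local trivialisations.\<close>

definition total_atlas :: "('m, 'e) atlas \<Rightarrow> ('m, 'v, 'f, 'z) vbundle_scheme
    \<Rightarrow> ('v, 'e \<times> 'f) atlas" where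
  "total_atlas \<A> E =
     {({e \<in> total E. proj E e \<in> U \<inter> W}, \<lambda>e. (\<phi> (proj E e), \<psi> e)) | U \<phi> W \<psi>.
        (U, \<phi>) \<in> \<A> \<and> (W, \<psi>) \<in> trivs E}"

text \<open>The conditions on \<open>\<psi>\<close> make every fibre a real vector space for which \<open>\<psi>\<close> is a linear
  isomorphism onto \<open>'f\<close>. The last conjunct is the smoothness of the transition maps
  \<open>(m, v) \<mapsto> (m, \<psi>' (\<psi>\<^sub>m\<inverse> v))\<close>.\<close>

definition vector_bundle :: "('m::{t2_space,second_countable_topology}, 'e::real_normed_vector) atlas
    \<Rightarrow> ('m, 'v, 'f::real_normed_vector, 'z) vbundle_scheme \<Rightarrow> bool" where
  "vector_bundle \<A> E \<longleftrightarrow>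
     finite_dimensional TYPE('f) \<and>
     (\<Union>(W, \<psi>) \<in> trivs E. W) = UNIV \<and>
     (\<forall>(W, \<psi>) \<in> trivs E. open W \<and> (\<forall>m \<in> W.
        bij_betw \<psi> (fibre E m) UNIV \<and>
        (\<forall>x \<in> fibre E m. \<forall>y \<in> fibre E m.
           vadd E x y \<in> fibre E m \<and> \<psi> (vadd E x y) = \<psi> x + \<psi> y) \<and>
        (\<forall>c. \<forall>x \<in> fibre E m.
           vscale E c x \<in> fibre E m \<and> \<psi> (vscale E c x) = c *\<^sub>R \<psi> x))) \<and>
     smooth_map (total_atlas \<A> E) (total_atlas \<A> E) (\<lambda>e. e)"

definition sections :: "('m, 'e::real_normed_vector) atlas
    \<Rightarrow> ('m, 'v, 'f::real_normed_vector, 'z) vbundle_scheme \<Rightarrow> ('m \<Rightarrow> 'v) set" where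
  "sections \<A> E = {s. (\<forall>m. s m \<in> fibre E m) \<and> smooth_map \<A> (total_atlas \<A> E) s}"

definition sec_add :: "('m, 'v, 'f, 'z) vbundle_scheme \<Rightarrow> ('m \<Rightarrow> 'v) \<Rightarrow> ('m \<Rightarrow> 'v) \<Rightarrow> 'm \<Rightarrow> 'v" where
  "sec_add E s t = (\<lambda>m. vadd E (s m) (t m))"

definition sec_scale :: "('m, 'v, 'f, 'z) vbundle_scheme \<Rightarrow> ('m \<Rightarrow> real) \<Rightarrow> ('m \<Rightarrow> 'v) \<Rightarrow> 'm \<Rightarrow> 'v" where
  "sec_scale E f s = (\<lambda>m. vscale E (f m) (s m))"

definition sec_diff :: "('m, 'v, 'f, 'z) vbundle_scheme \<Rightarrow> ('m \<Rightarrow> 'v) \<Rightarrow> ('m \<Rightarrow> 'v) \<Rightarrow> 'm \<Rightarrow> 'v" where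
  "sec_diff E s t = (\<lambda>m. vadd E (s m) (vscale E (- 1) (t m)))"

text \<open>Vector bundle morphisms over the identity of the base. They are taken extensional
  (\<^const>\<open>undefined\<close> off the total space) so that equal morphisms are equal functions.\<close>

definition bundle_morphism :: "('m, 'e::real_normed_vector) atlas
    \<Rightarrow> ('m, 'v, 'f::real_normed_vector, 'y) vbundle_scheme
    \<Rightarrow> ('m, 'w, 'h::real_normed_vector, 'z) vbundle_scheme \<Rightarrow> ('v \<Rightarrow> 'w) \<Rightarrow> bool" where
  "bundle_morphism \<A> E E' \<Phi> \<longleftrightarrow>
     \<Phi> \<in> extensional (total E) \<and>
     (\<forall>m. \<forall>x \<in> fibre E m. \<Phi> x \<in> fibre E' m) \<and>
     (\<forall>m. \<forall>x \<in> fibre E m. \<forall>y \<in> fibre E m. \<Phi> (vadd E x y) = vadd E' (\<Phi> x) (\<Phi> y)) \<and>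
     (\<forall>c. \<forall>x \<in> total E. \<Phi> (vscale E c x) = vscale E' c (\<Phi> x)) \<and>
     smooth_map (total_atlas \<A> E) (total_atlas \<A> E') \<Phi>"

section \<open>Tangent bundle and vector fields\<close>

text \<open>Derivative at \<open>m\<close> of a (possibly vector-valued) function in the direction of the coordinate
  vector \<open>v\<close> with respect to a chart around \<open>m\<close>.\<close>

definition chart_deriv :: "('m, 'e::real_normed_vector) chart \<Rightarrow> 'm \<Rightarrow> 'e
    \<Rightarrow> ('m \<Rightarrow> 'b::real_normed_vector) \<Rightarrow> 'b" where
  "chart_deriv c m v f =
     frechet_derivative (f \<circ> inv_into (fst c) (snd c)) (at (snd c m)) v"

text \<open>Tangent vectors at \<open>m\<close> are the pairs of \<open>m\<close> and an operator \<open>\<Sum> v\<^sup>i \<partial>/\<partial>x\<^sup>i\<close> on \<open>C\<^sup>\<infinity>(M)\<close>, taken at \<open>m\<close>.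
  The operators are extensional on \<open>C\<^sup>\<infinity>(M)\<close>.\<close>

type_synonym 'm tangent = "'m \<times> (('m \<Rightarrow> real) \<Rightarrow> real)"

definition coord_vector :: "('m, 'e::real_normed_vector) atlas \<Rightarrow> ('m, 'e) chart \<Rightarrow> 'm \<Rightarrow> 'e
    \<Rightarrow> ('m \<Rightarrow> real) \<Rightarrow> real" where
  "coord_vector \<A> c m v = (\<lambda>f \<in> Cinf \<A>. chart_deriv c m v f)"

definition coords :: "('m, 'e::real_normed_vector) atlas \<Rightarrow> ('m, 'e) chart \<Rightarrow> 'm tangent \<Rightarrow> 'e" where
  "coords \<A> c t = (THE v. snd t = coord_vector \<A> c (fst t) v)"

definition tangent_bundle :: "('m, 'e::real_normed_vector) atlas \<Rightarrow> ('m, 'm tangent, 'e) vbundle" where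
  "tangent_bundle \<A> = \<lparr>
     total = {(m, coord_vector \<A> c m v) | m c v. c \<in> \<A> \<and> m \<in> fst c},
     proj = fst,
     vadd = (\<lambda>(m, X) (_, Y). (m, \<lambda>f \<in> Cinf \<A>. X f + Y f)),
     vscale = (\<lambda>r (m, X). (m, \<lambda>f \<in> Cinf \<A>. r * X f)),
     trivs = {(fst c, coords \<A> c) | c. c \<in> \<A>} \<rparr>"

definition vf_app :: "('m \<Rightarrow> 'm tangent) \<Rightarrow> ('m \<Rightarrow> real) \<Rightarrow> 'm \<Rightarrow> real" where
  "vf_app X f = (\<lambda>m. snd (X m) f)"

definition vf_bracket :: "('m, 'e::real_normed_vector) atlas
    \<Rightarrow> ('m \<Rightarrow> 'm tangent) \<Rightarrow> ('m \<Rightarrow> 'm tangent) \<Rightarrow> 'm \<Rightarrow> 'm tangent" where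
  "vf_bracket \<A> X Y =
     (\<lambda>m. (m, \<lambda>f \<in> Cinf \<A>. vf_app X (vf_app Y f) m - vf_app Y (vf_app X f) m))"

text \<open>Lie derivative of a function with values in a finite-dimensional vector space, determined by
  its compositions with linear functionals (equivalently, componentwise in a basis).\<close>

definition lie_deriv :: "('m \<Rightarrow> 'm tangent) \<Rightarrow> ('m \<Rightarrow> 'g::real_vector) \<Rightarrow> 'm \<Rightarrow> 'g" where
  "lie_deriv X W = (\<lambda>m. THE w. \<forall>l :: 'g \<Rightarrow> real. linear l \<longrightarrow> l w = vf_app X (l \<circ> W) m)"

section \<open>Lie algebras and Lie algebroids\<close>

definition lie_algebra :: "('g::real_vector \<Rightarrow> 'g \<Rightarrow> 'g) \<Rightarrow> bool" where
  "lie_algebra br \<longleftrightarrow>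
     finite_dimensional TYPE('g) \<and>
     bilinear br \<and>
     (\<forall>X. br X X = 0) \<and>
     (\<forall>X Y Z. br X (br Y Z) + br Y (br Z X) + br Z (br X Y) = 0)"

record ('m, 'v, 'f) algebroid = "('m, 'v, 'f) vbundle" +
  anchor :: "'v \<Rightarrow> 'm tangent"
  bracket :: "('m \<Rightarrow> 'v) \<Rightarrow> ('m \<Rightarrow> 'v) \<Rightarrow> ('m \<Rightarrow> 'v)"

definition lie_algebroid :: "('m::{t2_space,second_countable_topology}, 'e::real_normed_vector) atlas
    \<Rightarrow> ('m, 'v, 'f::real_normed_vector, 'z) algebroid_scheme \<Rightarrow> bool" where
  "lie_algebroid \<A> A \<longleftrightarrow>
     vector_bundle \<A> A \<and>
     bundle_morphism \<A> A (tangent_bundle \<A>) (restrict (anchor A) (total A)) \<and>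
     (\<forall>X \<in> sections \<A> A. \<forall>Y \<in> sections \<A> A. bracket A X Y \<in> sections \<A> A) \<and>
     (\<forall>X \<in> sections \<A> A. \<forall>Y \<in> sections \<A> A. \<forall>Z \<in> sections \<A> A.
        bracket A (sec_add A X Y) Z = sec_add A (bracket A X Z) (bracket A Y Z) \<and>
        bracket A Z (sec_add A X Y) = sec_add A (bracket A Z X) (bracket A Z Y)) \<and>
     (\<forall>c. \<forall>X \<in> sections \<A> A. \<forall>Y \<in> sections \<A> A.
        bracket A (sec_scale A (\<lambda>_. c) X) Y = sec_scale A (\<lambda>_. c) (bracket A X Y) \<and>
        bracket A X (sec_scale A (\<lambda>_. c) Y) = sec_scale A (\<lambda>_. c) (bracket A X Y)) \<and>
     (\<forall>X \<in> sections \<A> A. bracket A X X = sec_scale A (\<lambda>_. 0) X) \<and>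
     (\<forall>X \<in> sections \<A> A. \<forall>Y \<in> sections \<A> A. \<forall>Z \<in> sections \<A> A.
        sec_add A (bracket A X (bracket A Y Z))
          (sec_add A (bracket A Y (bracket A Z X)) (bracket A Z (bracket A X Y)))
        = sec_scale A (\<lambda>_. 0) X) \<and>
     (\<forall>X \<in> sections \<A> A. \<forall>Y \<in> sections \<A> A.
        anchor A \<circ> bracket A X Y = vf_bracket \<A> (anchor A \<circ> X) (anchor A \<circ> Y)) \<and>
     (\<forall>X \<in> sections \<A> A. \<forall>Y \<in> sections \<A> A. \<forall>f \<in> Cinf \<A>.
        bracket A X (sec_scale A f Y) =
        sec_add A (sec_scale A f (bracket A X Y)) (sec_scale A (vf_app (anchor A \<circ> X) f) Y))"

text \<open>Intended for \<open>A\<close>, \<open>A'\<close> satisfying \<^const>\<open>lie_algebroid\<close>, which is a property of the two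
  structures and not repeated as a condition on the map.\<close>

definition algebroid_morphism :: "('m, 'e::real_normed_vector) atlas
    \<Rightarrow> ('m, 'v, 'f::real_normed_vector, 'y) algebroid_scheme
    \<Rightarrow> ('m, 'w, 'h::real_normed_vector, 'z) algebroid_scheme \<Rightarrow> ('v \<Rightarrow> 'w) \<Rightarrow> bool" where
  "algebroid_morphism \<A> A A' \<Phi> \<longleftrightarrow>
     bundle_morphism \<A> A A' \<Phi> \<and>
     (\<forall>x \<in> total A. anchor A' (\<Phi> x) = anchor A x) \<and>
     (\<forall>X \<in> sections \<A> A. \<forall>Y \<in> sections \<A> A.
        \<Phi> \<circ> bracket A X Y = bracket A' (\<Phi> \<circ> X) (\<Phi> \<circ> Y))"

section \<open>Derivative endomorphisms and the Lie algebroid \<open>\<DD>(E)\<close>\<close>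

text \<open>\<open>D\<close> is a derivative endomorphism of \<open>\<Gamma>E\<close> (extensional on \<open>\<Gamma>E\<close>) and \<open>D\<^sub>M\<close> is an endomorphism of
  \<open>C\<^sup>\<infinity>(M)\<close> as in the Leibniz rule. If \<open>E\<close> has positive rank then \<open>D\<^sub>M\<close> is determined by \<open>D\<close> on \<open>C\<^sup>\<infinity>(M)\<close>.\<close>

definition derivative_endo_over :: "('m, 'e::real_normed_vector) atlas
    \<Rightarrow> ('m, 'v, 'f::real_normed_vector, 'z) vbundle_scheme
    \<Rightarrow> (('m \<Rightarrow> 'v) \<Rightarrow> ('m \<Rightarrow> 'v)) \<Rightarrow> (('m \<Rightarrow> real) \<Rightarrow> ('m \<Rightarrow> real)) \<Rightarrow> bool" where
  "derivative_endo_over \<A> E D D\<^sub>M \<longleftrightarrow>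
     D \<in> sections \<A> E \<rightarrow>\<^sub>E sections \<A> E \<and>
     (\<forall>s \<in> sections \<A> E. \<forall>t \<in> sections \<A> E. D (sec_add E s t) = sec_add E (D s) (D t)) \<and>
     (\<forall>c. \<forall>s \<in> sections \<A> E. D (sec_scale E (\<lambda>_. c) s) = sec_scale E (\<lambda>_. c) (D s)) \<and>
     D\<^sub>M \<in> Cinf \<A> \<rightarrow> Cinf \<A> \<and>
     (\<forall>f \<in> Cinf \<A>. \<forall>g \<in> Cinf \<A>. D\<^sub>M (\<lambda>m. f m + g m) = (\<lambda>m. D\<^sub>M f m + D\<^sub>M g m)) \<and>
     (\<forall>c. \<forall>f \<in> Cinf \<A>. D\<^sub>M (\<lambda>m. c * f m) = (\<lambda>m. c * D\<^sub>M f m)) \<and>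
     (\<forall>f \<in> Cinf \<A>. \<forall>s \<in> sections \<A> E.
        D (sec_scale E f s) = sec_add E (sec_scale E f (D s)) (sec_scale E (D\<^sub>M f) s))"

definition derivative_endo :: "('m, 'e::real_normed_vector) atlas
    \<Rightarrow> ('m, 'v, 'f::real_normed_vector, 'z) vbundle_scheme
    \<Rightarrow> (('m \<Rightarrow> 'v) \<Rightarrow> ('m \<Rightarrow> 'v)) \<Rightarrow> bool" where
  "derivative_endo \<A> E D \<longleftrightarrow> (\<exists>D\<^sub>M. derivative_endo_over \<A> E D D\<^sub>M)"

text \<open>
  The fibre of \<open>\<DD>(E)\<close> at \<open>m\<close>, the pullback of the symbol map \<open>Diff\<^sup>1(E) \<rightarrow> TM \<otimes> End(E)\<close> and of
  \<open>X \<mapsto> X \<otimes> Id\<close>, consists of the pairs of a linear map \<open>d : \<Gamma>E \<rightarrow> E\<^sub>m\<close> (the value at \<open>m\<close> of a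
  differential operator) and a vector \<open>X \<in> T\<^sub>mM\<close>, such that \<open>d\<close> has symbol \<open>X \<otimes> Id\<close>, that is,
  \<open>d(f s) - f(m) d(s) = X(f) s(m)\<close>. (A \<open>d\<close> of this kind is automatically of first order.)
\<close>

type_synonym ('m, 'v) deriv_vec = "'m \<times> (('m \<Rightarrow> 'v) \<Rightarrow> 'v) \<times> (('m \<Rightarrow> real) \<Rightarrow> real)"

definition is_deriv_vec :: "('m, 'e::real_normed_vector) atlas
    \<Rightarrow> ('m, 'v, 'f::real_normed_vector, 'z) vbundle_scheme \<Rightarrow> ('m, 'v) deriv_vec \<Rightarrow> bool" where
  "is_deriv_vec \<A> E = (\<lambda>(m, d, X).
     (m, X) \<in> total (tangent_bundle \<A>) \<and>
     d \<in> sections \<A> E \<rightarrow>\<^sub>E fibre E m \<and>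
     (\<forall>s \<in> sections \<A> E. \<forall>t \<in> sections \<A> E. d (sec_add E s t) = vadd E (d s) (d t)) \<and>
     (\<forall>c. \<forall>s \<in> sections \<A> E. d (sec_scale E (\<lambda>_. c) s) = vscale E c (d s)) \<and>
     (\<forall>f \<in> Cinf \<A>. \<forall>s \<in> sections \<A> E.
        d (sec_scale E f s) = vadd E (vscale E (f m) (d s)) (vscale E (X f) (s m))))"

text \<open>In a chart of \<open>M\<close> and a local trivialisation \<open>\<psi>\<close> of \<open>E\<close>, an element of \<open>\<DD>(E)\<close> has the form
  \<open>\<Sum> v\<^sup>i \<partial>/\<partial>x\<^sup>i + A\<close> with an endomorphism \<open>A\<close> of the typical fibre; its coordinates are \<open>(v, A)\<close>.\<close>

definition deriv_coords :: "('m, 'e::real_normed_vector) atlas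
    \<Rightarrow> ('m, 'v, 'f::real_normed_vector, 'z) vbundle_scheme
    \<Rightarrow> ('m, 'e) chart \<Rightarrow> ('v \<Rightarrow> 'f) \<Rightarrow> ('m, 'v) deriv_vec \<Rightarrow> 'e \<times> ('f \<Rightarrow>\<^sub>L 'f)" where
  "deriv_coords \<A> E c \<psi> = (\<lambda>(m, d, X).
     let v = coords \<A> c (m, X) in
     (v, THE A. \<forall>s \<in> sections \<A> E. \<psi> (d s) = chart_deriv c m v (\<psi> \<circ> s) + blinfun_apply A (\<psi> (s m))))"

definition deriv_app :: "('m \<Rightarrow> ('m, 'v) deriv_vec) \<Rightarrow> ('m \<Rightarrow> 'v) \<Rightarrow> 'm \<Rightarrow> 'v" where
  "deriv_app \<delta> s = (\<lambda>m. fst (snd (\<delta> m)) s)"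

definition deriv_anchor :: "('m, 'v) deriv_vec \<Rightarrow> 'm tangent" where
  "deriv_anchor = (\<lambda>(m, d, X). (m, X))"

definition deriv_algebroid :: "('m, 'e::real_normed_vector) atlas
    \<Rightarrow> ('m, 'v, 'f::real_normed_vector, 'z) vbundle_scheme
    \<Rightarrow> ('m, ('m, 'v) deriv_vec, 'e \<times> ('f \<Rightarrow>\<^sub>L 'f)) algebroid" where
  "deriv_algebroid \<A> E = \<lparr>
     total = {\<delta>. is_deriv_vec \<A> E \<delta>},
     proj = fst,
     vadd = (\<lambda>(m, d, X) (_, d', X').
       (m, \<lambda>s \<in> sections \<A> E. vadd E (d s) (d' s), \<lambda>f \<in> Cinf \<A>. X f + X' f)),
     vscale = (\<lambda>r (m, d, X).
       (m, \<lambda>s \<in> sections \<A> E. vscale E r (d s), \<lambda>f \<in> Cinf \<A>. r * X f)),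
     trivs = {(fst c \<inter> W, deriv_coords \<A> E c \<psi>) | c W \<psi>. c \<in> \<A> \<and> (W, \<psi>) \<in> trivs E},
     anchor = deriv_anchor,
     bracket = (\<lambda>\<delta> \<epsilon> m. (m,
       \<lambda>s \<in> sections \<A> E. sec_diff E (deriv_app \<delta> (deriv_app \<epsilon> s)) (deriv_app \<epsilon> (deriv_app \<delta> s)) m,
       snd (vf_bracket \<A> (deriv_anchor \<circ> \<delta>) (deriv_anchor \<circ> \<epsilon>) m))) \<rparr>"

definition algebroid_rep :: "('m, 'e::real_normed_vector) atlas
    \<Rightarrow> ('m, 'w, 'h::real_normed_vector, 'y) algebroid_scheme
    \<Rightarrow> ('m, 'v, 'f::real_normed_vector, 'z) vbundle_scheme
    \<Rightarrow> ('w \<Rightarrow> ('m, 'v) deriv_vec) \<Rightarrow> bool" where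
  "algebroid_rep \<A> A E \<Phi> \<longleftrightarrow> algebroid_morphism \<A> A (deriv_algebroid \<A> E) \<Phi>"

section \<open>Infinitesimal actions and derivative representations\<close>

definition infinitesimal_action :: "('m, 'e::real_normed_vector) atlas
    \<Rightarrow> ('g::real_vector \<Rightarrow> 'g \<Rightarrow> 'g) \<Rightarrow> ('g \<Rightarrow> 'm \<Rightarrow> 'm tangent) \<Rightarrow> bool" where
  "infinitesimal_action \<A> br act \<longleftrightarrow>
     (\<forall>X. act X \<in> sections \<A> (tangent_bundle \<A>)) \<and>
     (\<forall>X Y. act (X + Y) = sec_add (tangent_bundle \<A>) (act X) (act Y)) \<and>
     (\<forall>c X. act (c *\<^sub>R X) = sec_scale (tangent_bundle \<A>) (\<lambda>_. c) (act X)) \<and>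
     (\<forall>X Y. vf_bracket \<A> (act X) (act Y) = act (br X Y))"

definition action_algebroid :: "('g::real_normed_vector \<Rightarrow> 'g \<Rightarrow> 'g) \<Rightarrow> ('g \<Rightarrow> 'm \<Rightarrow> 'm tangent)
    \<Rightarrow> ('m, 'm \<times> 'g, 'g) algebroid" where
  "action_algebroid br act = \<lparr>
     total = UNIV,
     proj = fst,
     vadd = (\<lambda>(m, X) (_, Y). (m, X + Y)),
     vscale = (\<lambda>r (m, X). (m, r *\<^sub>R X)),
     trivs = {(UNIV, snd)},
     anchor = (\<lambda>(m, X). act X m),
     bracket = (\<lambda>s t m.
       let V = snd \<circ> s; W = snd \<circ> t;
           V\<^sub>M = (\<lambda>m. act (V m) m); W\<^sub>M = (\<lambda>m. act (W m) m)
       in (m, lie_deriv V\<^sub>M W m - lie_deriv W\<^sub>M V m + br (V m) (W m))) \<rparr>"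

definition derivative_rep :: "('m, 'e::real_normed_vector) atlas
    \<Rightarrow> ('m, 'v, 'f::real_normed_vector, 'z) vbundle_scheme
    \<Rightarrow> ('g::real_vector \<Rightarrow> 'g \<Rightarrow> 'g) \<Rightarrow> ('g \<Rightarrow> ('m \<Rightarrow> 'v) \<Rightarrow> ('m \<Rightarrow> 'v)) \<Rightarrow> bool" where
  "derivative_rep \<A> E br \<rho> \<longleftrightarrow>
     (\<forall>X. derivative_endo \<A> E (\<rho> X)) \<and>
     (\<forall>s \<in> sections \<A> E.
        (\<forall>X Y. \<rho> (X + Y) s = sec_add E (\<rho> X s) (\<rho> Y s)) \<and>
        (\<forall>c X. \<rho> (c *\<^sub>R X) s = sec_scale E (\<lambda>_. c) (\<rho> X s)) \<and>
        (\<forall>X Y. \<rho> (br X Y) s = sec_diff E (\<rho> X (\<rho> Y s)) (\<rho> Y (\<rho> X s))))"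

definition associated_to_action :: "('m, 'e::real_normed_vector) atlas
    \<Rightarrow> ('m, 'v, 'f::real_normed_vector, 'z) vbundle_scheme
    \<Rightarrow> ('g \<Rightarrow> 'm \<Rightarrow> 'm tangent) \<Rightarrow> ('g \<Rightarrow> ('m \<Rightarrow> 'v) \<Rightarrow> ('m \<Rightarrow> 'v)) \<Rightarrow> bool" where
  "associated_to_action \<A> E act \<rho> \<longleftrightarrow>
     (\<forall>X. derivative_endo_over \<A> E (\<rho> X) (vf_app (act X)))"

end

theory Submission
  imports Defs "HOL-Computational_Algebra.Polynomial"
begin

text \<open>
  A representation \<open>\<Phi>\<close> is fibrewise linear, hence determined by its values on the constant sections of
  \<open>\<gg> \<ltimes> M\<close>, and these values form \<open>\<rho>\<close>; as the bracket of constant sections is that of \<open>\<gg>\<close>, \<open>\<rho>\<close> is a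
  derivative representation. Conversely, put \<open>\<Phi>(m, X) = (s \<mapsto> \<rho>(X) s m, X\<^sub>M(m))\<close>. For a section
  \<open>W = \<Sum> W\<^sup>b b\<close> the Leibniz rule gives \<open>\<rho>(X)(\<rho>(W) s) = \<rho>(X) \<rho>(W m) s + \<rho>(X\<^sub>M W) s\<close> at \<open>m\<close>, and likewise
  for the action on functions, so that the terms \<open>V\<^sub>M(W) - W\<^sub>M(V)\<close> of the bracket of \<open>\<gg> \<ltimes> M\<close> are the ones
  by which the commutator of \<open>\<Phi> \<circ> V\<close> and \<open>\<Phi> \<circ> W\<close> differs from \<open>\<rho>([V, W]\<^sup>\<bullet>)\<close>.

  The smoothness of \<open>\<rho>(X) s\<close> and of \<open>\<Phi>\<close> is read off the local form \<open>\<Sum> v\<^sup>i \<partial>/\<partial>x\<^sup>i + A\<close> of the elements of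
  \<open>\<DD>(E)\<close>. As these act on global sections only, the local form depends on bump functions.
\<close>

section \<open>Finite-dimensional normed spaces\<close>

text \<open>An element of \<open>DE\<close> is an operator on global sections, so it can be applied
  only to global data: before it acts, every local expansion has to become an identity between
  global sections with coefficients in \<open>Cinf\<close>. Two kinds of expansion occur. In a frame
  of \<open>E\<close> the coefficients are local, which is where cut-off functions enter; in a basis
  of the Lie algebra the coefficients, the coordinates of \<open>W\<close>, are already global.
  \<open>deriv_vec_sum\<close> evaluates an operator on either kind.

  Smoothness of \<open>\<Phi>\<close> is joint in \<open>(m, X)\<close>, whereas a derivative
  representation gives smoothness in \<open>m\<close> for each fixed \<open>X\<close> only. The gap
  is closed by linearity of the local coordinates in \<open>X\<close>, which rests on their
  uniqueness.

  The model spaces carry only a norm and a finite spanning set, so continuity of coordinates and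
  compact neighbourhoods are derived from these. Expansion in a basis also reduces derivatives in a
  moving direction to the fixed directions in which \<open>Ck_on\<close> is phrased.\<close>

lemma independent_coefficient_bound:
  fixes B :: "'a::real_normed_vector set"
  assumes "finite B" "independent B"
  obtains c where "c > 0" "\<And>a b. b \<in> B \<Longrightarrow> c * \<bar>a b\<bar> \<le> norm (\<Sum>b\<in>B. a b *\<^sub>R b)"
proof -
  let ?N = "\<lambda>a :: 'a \<Rightarrow> real. norm (\<Sum>b\<in>B. a b *\<^sub>R b)"
  \<comment> \<open>Coefficients are functions on the whole type, frozen at 0 off \<open>B\<close>.
    The box is then a product of compact sets, hence compact by Tychonoff's theorem.\<close>
  define box :: "('a \<Rightarrow> real) set" where "box = PiE UNIV (\<lambda>b. if b \<in> B then {-1..1} else {0})"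
  have "compactin (product_topology (\<lambda>_. euclideanreal) UNIV) box"
    unfolding box_def compactin_PiE by auto
  then have box: "compact box"
    by (simp add: euclidean_product_topology)
  have cN: "continuous_on S ?N" for S
    by (intro continuous_intros continuous_on_subset[OF continuous_on_product_coordinates]) auto
  \<comment> \<open>The norm attains its minimum on the compact part of the box where
    \<open>a b\<close> is 1 or -1, and the minimum is positive: by independence a combination with a
    nonzero coefficient does not vanish.\<close>
  have ex: "\<exists>c>0. \<forall>a \<in> box. \<bar>a b\<bar> = 1 \<longrightarrow> c \<le> ?N a" if "b \<in> B" for b
  proof -
    define K where "K = {a \<in> box. \<bar>a b\<bar> = 1}"
    have "closed {a :: 'a \<Rightarrow> real. \<bar>a b\<bar> = 1}"
      by (intro closed_Collect_eq continuous_intros continuous_on_product_coordinates)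
    then have K: "compact K"
      unfolding K_def Collect_conj_eq using compact_Int_closed[OF box] by simp
    show ?thesis
    proof (cases "K = {}")
      case True
      then show ?thesis unfolding K_def by (intro exI[of _ 1]) auto
    next
      case False
      obtain a where a: "a \<in> K" "\<And>a'. a' \<in> K \<Longrightarrow> ?N a \<le> ?N a'"
        using continuous_attains_inf[OF K False cN] by auto
      have "?N a \<noteq> 0"
      proof
        assume "?N a = 0"
        then have "a b = 0"
          using \<open>b \<in> B\<close> independentD[OF assms(2) assms(1) subset_refl] by auto
        then show False using a(1) by (simp add: K_def)
      qed
      then show ?thesis
        using a unfolding K_def by (intro exI[of _ "?N a"]) auto
    qed
  qed
  obtain c where c: "\<And>b. b \<in> B \<Longrightarrow> c b > 0"
    "\<And>b a. b \<in> B \<Longrightarrow> a \<in> box \<Longrightarrow> \<bar>a b\<bar> = 1 \<Longrightarrow> c b \<le> ?N a"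
    using ex by metis
  \<comment> \<open>\<open>insert 1\<close> keeps the minimum meaningful and positive for empty
    \<open>B\<close>.\<close>
  define C where "C = Min (insert 1 (c ` B))"
  have C: "C > 0" "\<And>b. b \<in> B \<Longrightarrow> C \<le> c b"
    unfolding C_def using c assms(1) by auto
  have "C * \<bar>a b\<bar> \<le> ?N a" if "b \<in> B" for a b
  proof -
    have "finite ((\<lambda>b. \<bar>a b\<bar>) ` B)" "(\<lambda>b. \<bar>a b\<bar>) ` B \<noteq> {}" using assms(1) that by auto
    from Max_in[OF this] obtain b0 where b0: "b0 \<in> B" "Max ((\<lambda>b. \<bar>a b\<bar>) ` B) = \<bar>a b0\<bar>"
      by auto
    have le: "\<bar>a b'\<bar> \<le> \<bar>a b0\<bar>" if "b' \<in> B" for b'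
      using that assms(1) by (simp flip: b0(2))
    show ?thesis
    proof (cases "a b0 = 0")
      case True
      then show ?thesis using le[OF that] by simp
    next
      case False
      \<comment> \<open>Division by the largest absolute value puts the coefficients into the box
        with absolute value 1 at \<open>b0\<close>, where the bound \<open>c b0\<close>
        applies.\<close>
      define a' where "a' = (\<lambda>b. if b \<in> B then a b / \<bar>a b0\<bar> else 0)"
      have "a' \<in> box"
      proof -
        have "a' b \<in> (if b \<in> B then {-1..1} else {0})" for b
        proof -
          have "\<bar>a b / \<bar>a b0\<bar>\<bar> \<le> 1" if "b \<in> B"
            using le[OF that] False by (simp add: divide_le_eq)
          then show ?thesis unfolding a'_def by (auto simp only: abs_le_iff atLeastAtMost_iff minus_le_iff split: if_splits)
        qed
        then show ?thesis unfolding box_def by (intro PiE_I) auto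
      qed
      moreover have "\<bar>a' b0\<bar> = 1" using b0 False by (simp add: a'_def)
      ultimately have "c b0 \<le> ?N a'" using c(2) b0 by blast
      also have "(\<Sum>b\<in>B. a' b *\<^sub>R b) = (1 / \<bar>a b0\<bar>) *\<^sub>R (\<Sum>b\<in>B. a b *\<^sub>R b)"
        unfolding scaleR_sum_right by (rule sum.cong) (auto simp: a'_def)
      finally have "c b0 * \<bar>a b0\<bar> \<le> ?N a" using False by (simp add: field_simps)
      moreover have "C * \<bar>a b\<bar> \<le> c b0 * \<bar>a b0\<bar>"
        using C(1) C(2)[OF b0(1)] le[OF that] by (intro mult_mono) auto
      ultimately show ?thesis by linarith
    qed
  qed
  with C(1) that show thesis by blast
qed

definition fin_basis :: "'a::real_vector set" where
  "fin_basis = (SOME B. finite B \<and> independent B \<and> span B = UNIV)"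

text \<open>\<open>representation\<close> is 0 at every \<open>b\<close> outside the basis, so in
  finite dimension \<open>coord b\<close> is a linear functional for every vector
  \<open>b\<close>.\<close>

definition coord :: "'a::real_vector \<Rightarrow> 'a \<Rightarrow> real" where
  "coord b x = representation fin_basis x b"

context
  assumes fin: "finite_dimensional TYPE('a::real_vector)"
begin

lemma fin_basis:
  shows finite_fin_basis: "finite (fin_basis :: 'a set)"
    and independent_fin_basis: "independent (fin_basis :: 'a set)"
    and span_fin_basis: "span (fin_basis :: 'a set) = UNIV"
proof -
  obtain S :: "'a set" where S: "finite S" "span S = UNIV"
    using fin unfolding finite_dimensional_def by blast
  obtain B where "B \<subseteq> S" "independent B" "S \<subseteq> span B"
    using maximal_independent_subset by blast
  then have "finite B \<and> independent B \<and> span B = UNIV"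
    using S by (metis finite_subset span_mono span_span top.extremum_uniqueI)
  then have "finite (fin_basis :: 'a set) \<and> independent (fin_basis :: 'a set) \<and> span (fin_basis :: 'a set) = UNIV"
    unfolding fin_basis_def by (rule someI)
  then show "finite (fin_basis :: 'a set)" "independent (fin_basis :: 'a set)"
    "span (fin_basis :: 'a set) = UNIV" by auto
qed

lemma linear_coord: "linear (coord b :: 'a \<Rightarrow> real)"
  unfolding coord_def
  by (rule linearI)
    (simp_all add: representation_add representation_scale independent_fin_basis span_fin_basis)

lemma coord_sum: "(\<Sum>b\<in>fin_basis. coord b x *\<^sub>R b) = (x :: 'a)"
  unfolding coord_def
  by (rule sum_representation_eq)
    (simp_all add: independent_fin_basis span_fin_basis finite_fin_basis)

lemma linear_coord_sum:
  fixes f :: "'a \<Rightarrow> 'b::real_vector"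
  assumes "linear f"
  shows "f x = (\<Sum>b\<in>fin_basis. coord b x *\<^sub>R f b)"
  using linear_sum[OF assms, of "\<lambda>b. coord b x *\<^sub>R b" fin_basis]
  by (simp add: coord_sum linear_cmul[OF assms])

end

lemma bounded_linear_coord:
  assumes fin: "finite_dimensional TYPE('a::real_normed_vector)"
  shows "bounded_linear (coord b :: 'a \<Rightarrow> real)"
proof (cases "b \<in> (fin_basis :: 'a set)")
  case True
  obtain c where c: "c > 0"
    "\<And>a b. b \<in> fin_basis \<Longrightarrow> c * \<bar>a b\<bar> \<le> norm (\<Sum>b\<in>fin_basis. a b *\<^sub>R (b :: 'a))"
    using independent_coefficient_bound[OF finite_fin_basis[OF fin] independent_fin_basis[OF fin]]
    by metis
  show ?thesis
  proof (rule bounded_linear_intro)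
    show "norm (coord b x) \<le> norm x * (1 / c)" for x
      using c(2)[OF True, of "\<lambda>b. coord b x"] c(1) by (simp add: coord_sum[OF fin] field_simps)
  qed (simp_all add: linear_add[OF linear_coord[OF fin]] linear_cmul[OF linear_coord[OF fin]])
next
  case False
  then have "coord b = (\<lambda>x::'a. 0)"
    unfolding coord_def using representation_ne_zero by blast
  then show ?thesis by simp
qed

lemma finite_dimensional_linear_bounded:
  fixes f :: "'a::real_normed_vector \<Rightarrow> 'b::real_normed_vector"
  assumes fin: "finite_dimensional TYPE('a)" and f: "linear f"
  shows "bounded_linear f"
proof -
  have "bounded_linear (\<lambda>x. \<Sum>b\<in>fin_basis. coord b x *\<^sub>R f b)"
    by (intro bounded_linear_sum bounded_linear_scaleR_const bounded_linear_coord fin)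
  then show ?thesis
    by (simp flip: linear_coord_sum[OF fin f])
qed

lemma finite_dimensional_prod:
  assumes "finite_dimensional TYPE('a::real_vector)" "finite_dimensional TYPE('b::real_vector)"
  shows "finite_dimensional TYPE('a \<times> 'b)"
proof -
  obtain A :: "'a set" and B :: "'b set" where "finite A" "span A = UNIV" "finite B" "span B = UNIV"
    using assms unfolding finite_dimensional_def by blast
  note AB = this
  let ?f = "\<lambda>a::'a. (a, 0::'b)" and ?g = "\<lambda>b::'b. (0::'a, b)"
  let ?S = "?f ` A \<union> ?g ` B"
  have "(a, b) \<in> span ?S" for a b
  proof -
    have "linear ?f" "linear ?g" by (auto intro: linearI)
    then have "span (?f ` A) = range ?f" "span (?g ` B) = range ?g"
      using AB by (simp_all add: linear_span_image)
    then have "?f a \<in> span ?S" "?g b \<in> span ?S"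
      using span_mono[of "?f ` A" ?S] span_mono[of "?g ` B" ?S] by blast+
    from span_add[OF this] show ?thesis by simp
  qed
  then show ?thesis
    unfolding finite_dimensional_def using AB by (intro exI[of _ ?S]) auto
qed

text \<open>The neighbourhood is measured by the quadratic form of the coordinates, which is smooth,
  whereas the given norm need not be. \<open>K\<close> is the image of a cube of coefficients, hence
  compact.\<close>

lemma finite_dimensional_compact_neighbourhood:
  fixes x :: "'a::real_normed_vector"
  assumes fin: "finite_dimensional TYPE('a)" and "open S" "x \<in> S"
  obtains r K where "r > 0" "compact K" "K \<subseteq> S"
    "\<And>y. (\<Sum>b\<in>fin_basis. (coord b (y - x))\<^sup>2) \<le> r\<^sup>2 \<Longrightarrow> y \<in> K"
proof -
  \<comment> \<open>The summand 1 makes \<open>n\<close> positive even for an empty basis. With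
    \<open>r = e / (2 * n)\<close>, combinations with coefficients of size at most \<open>r\<close>
    have norm at most \<open>r * (n - 1)\<close>, which is less than \<open>e\<close>.\<close>
  define n where "n = (\<Sum>b\<in>fin_basis. norm (b :: 'a)) + 1"
  have n: "n \<ge> 1" unfolding n_def by (simp add: sum_nonneg)
  obtain e where e: "e > 0" "ball x e \<subseteq> S" using assms open_contains_ball by blast
  define r where "r = e / (2 * n)"
  have r: "r > 0" using e n by (simp add: r_def)
  define box :: "('a \<Rightarrow> real) set" where "box = PiE UNIV (\<lambda>b. {-r..r})"
  have "compactin (product_topology (\<lambda>_. euclideanreal) UNIV) box"
    unfolding box_def compactin_PiE by auto
  then have box: "compact box"
    by (simp add: euclidean_product_topology)
  define F where "F = (\<lambda>a :: 'a \<Rightarrow> real. x + (\<Sum>b\<in>fin_basis. a b *\<^sub>R b))"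
  have "continuous_on box F"
    unfolding F_def
    by (intro continuous_intros continuous_on_subset[OF continuous_on_product_coordinates]) auto
  then have K: "compact (F ` box)" using box by (rule compact_continuous_image)
  have "F ` box \<subseteq> S"
  proof safe
    fix a assume a: "a \<in> box"
    have "norm (\<Sum>b\<in>fin_basis. a b *\<^sub>R (b::'a)) \<le> (\<Sum>b\<in>fin_basis. r * norm (b::'a))"
    proof (rule sum_norm_le)
      fix b :: 'a
      have "\<bar>a b\<bar> \<le> r" using PiE_mem[OF a[unfolded box_def], of b] by (simp add: abs_le_iff minus_le_iff)
      then show "norm (a b *\<^sub>R b) \<le> r * norm b" by (simp add: mult_right_mono)
    qed
    also have "\<dots> = r * (n - 1)" by (simp add: n_def sum_distrib_left)
    also have "\<dots> < e"
    proof -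
      have "0 < e * n" using n e(1) by simp
      then show ?thesis unfolding r_def using n e(1) by (simp add: field_simps add_pos_pos)
    qed
    finally have "F a \<in> ball x e" by (simp add: F_def dist_norm)
    then show "F a \<in> S" using e by blast
  qed
  moreover have "y \<in> F ` box" if y: "(\<Sum>b\<in>fin_basis. (coord b (y - x))\<^sup>2) \<le> r\<^sup>2" for y
  proof
    define a where "a = (\<lambda>b. coord b (y - x))"
    show "y = F (\<lambda>b. coord b (y - x))"
      by (simp add: F_def coord_sum[OF fin])
    have "\<bar>coord b (y - x)\<bar> \<le> r" for b
    proof (cases "b \<in> (fin_basis :: 'a set)")
      case True
      then have "(coord b (y - x))\<^sup>2 \<le> r\<^sup>2"
        using y member_le_sum[OF True, of "\<lambda>b. (coord b (y - x))\<^sup>2"] finite_fin_basis[OF fin]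
        by auto
      then show ?thesis using r by (simp add: power2_le_iff_abs_le)
    next
      case False
      then have "coord b (y - x) = 0" unfolding coord_def using representation_ne_zero by blast
      then show ?thesis using r by simp
    qed
    then show "(\<lambda>b. coord b (y - x)) \<in> box"
      unfolding box_def by (auto simp: abs_le_iff minus_le_iff)
  qed
  ultimately show thesis using that r K by blast
qed

section \<open>Calculus of smooth maps\<close>

lemma Ck_on_cong:
  assumes "open S" "\<And>x. x \<in> S \<Longrightarrow> f x = g x" "Ck_on k S f"
  shows "Ck_on k S g"
  using assms(2,3)
proof (induction k arbitrary: f g)
  case 0
  then show ?case using continuous_on_cong[of S S f g] by simp
next
  case (Suc k)
  have d: "f differentiable (at x)" if "x \<in> S" for x
    using Suc.prems(2) that by simp
  have "g differentiable (at x)" if "x \<in> S" for x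
    using d[OF that] has_derivative_transform_within_open[OF _ \<open>open S\<close> that] Suc.prems(1)
    unfolding differentiable_def by (metis has_derivative_transform_within_open assms(1) that)
  moreover have "Ck_on k S (\<lambda>x. frechet_derivative g (at x) v)" for v
  proof (rule Suc.IH)
    show "Ck_on k S (\<lambda>x. frechet_derivative f (at x) v)" using Suc.prems(2) by simp
    show "frechet_derivative f (at x) v = frechet_derivative g (at x) v" if "x \<in> S" for x
      using frechet_derivative_transform_within_open[OF d[OF that] \<open>open S\<close> that] Suc.prems(1)
      by simp
  qed
  ultimately show ?case by simp
qed

lemma Ck_on_Suc_imp: "Ck_on (Suc k) S f \<Longrightarrow> Ck_on k S f"
proof (induction k arbitrary: f)
  case 0
  then have "continuous (at x) f" if "x \<in> S" for x
    using that by (simp add: differentiable_imp_continuous_within)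
  then show ?case by (simp add: continuous_at_imp_continuous_on)
next
  case (Suc k)
  then show ?case by (metis Ck_on.simps(2))
qed

lemma Ck_on_subset: "Ck_on k S f \<Longrightarrow> T \<subseteq> S \<Longrightarrow> Ck_on k T f"
proof (induction k arbitrary: f)
  case 0
  then show ?case using continuous_on_subset by auto
next
  case (Suc k)
  then show ?case by auto
qed

lemma Ck_on_local:
  assumes "\<And>x. x \<in> S \<Longrightarrow> \<exists>T. open T \<and> x \<in> T \<and> Ck_on k T f"
  shows "Ck_on k S f"
  using assms
proof (induction k arbitrary: f)
  case 0
  have "continuous (at x) f" if x: "x \<in> S" for x
    using 0[OF x] by (auto simp: continuous_on_eq_continuous_at)
  then show ?case by (simp add: continuous_at_imp_continuous_on)
next
  case (Suc k)
  have "f differentiable (at x)" if x: "x \<in> S" for x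
    using Suc.prems[OF x] by auto
  moreover have "Ck_on k S (\<lambda>x. frechet_derivative f (at x) v)" for v
    using Suc.prems by (intro Suc.IH) (metis Ck_on.simps(2))
  ultimately show ?case by simp
qed

text \<open>\<open>Ck_on\<close> speaks of \<open>frechet_derivative\<close>; here an explicit
  derivative may be exhibited instead. This is the induction step of most closure properties that
  follow.\<close>

lemma Ck_on_SucI:
  assumes "open S" "\<And>x. x \<in> S \<Longrightarrow> (f has_derivative f' x) (at x)"
    and "\<And>v. Ck_on k S (\<lambda>x. f' x v)"
  shows "Ck_on (Suc k) S f"
proof -
  have "f differentiable (at x)" if "x \<in> S" for x
    using assms(2)[OF that] unfolding differentiable_def by blast
  moreover have "Ck_on k S (\<lambda>x. frechet_derivative f (at x) v)" for v
    using fun_cong[OF frechet_derivative_at[OF assms(2)]]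
    by (intro Ck_on_cong[OF assms(1) _ assms(3)[of v]]) blast
  ultimately show ?thesis by simp
qed

lemma Ck_on_has_derivative:
  "Ck_on (Suc k) S f \<Longrightarrow> x \<in> S \<Longrightarrow> (f has_derivative frechet_derivative f (at x)) (at x)"
  by (simp flip: frechet_derivative_works)

lemma Ck_on_const: "open S \<Longrightarrow> Ck_on k S (\<lambda>x. c)"
proof (induction k arbitrary: c)
  case (Suc k)
  show ?case
    by (rule Ck_on_SucI[OF Suc.prems, where f' = "\<lambda>_ _. 0"])
      (simp_all add: Suc.IH[OF Suc.prems])
qed simp

lemma Ck_on_id: "open S \<Longrightarrow> Ck_on k S (\<lambda>x. x)"
proof (cases k)
  case (Suc k)
  assume "open S"
  then show ?thesis
    unfolding Suc by (intro Ck_on_SucI[where f' = "\<lambda>_ v. v"]) (simp_all add: Ck_on_const)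
qed simp

lemma Ck_on_bounded_linear:
  assumes L: "bounded_linear L" and "open S"
  shows "Ck_on k S f \<Longrightarrow> Ck_on k S (\<lambda>x. L (f x))"
proof (induction k arbitrary: f)
  case 0
  then show ?case using bounded_linear.continuous_on[OF L] by auto
next
  case (Suc k)
  show ?case
  proof (rule Ck_on_SucI[OF \<open>open S\<close>])
    show "((\<lambda>x. L (f x)) has_derivative (\<lambda>v. L (frechet_derivative f (at x) v))) (at x)"
      if "x \<in> S" for x
      using bounded_linear.has_derivative[OF L Ck_on_has_derivative[OF Suc.prems that]] .
    show "Ck_on k S (\<lambda>x. L (frechet_derivative f (at x) v))" for v
      using Suc by simp
  qed
qed

lemma Ck_on_add:
  assumes "open S"
  shows "Ck_on k S f \<Longrightarrow> Ck_on k S g \<Longrightarrow> Ck_on k S (\<lambda>x. f x + g x)"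
proof (induction k arbitrary: f g)
  case 0
  then show ?case by (auto intro: continuous_intros)
next
  case (Suc k)
  show ?case
  proof (rule Ck_on_SucI[OF \<open>open S\<close>])
    show "((\<lambda>x. f x + g x) has_derivative
        (\<lambda>v. frechet_derivative f (at x) v + frechet_derivative g (at x) v)) (at x)"
      if "x \<in> S" for x
      using Ck_on_has_derivative[OF Suc.prems(1) that] Ck_on_has_derivative[OF Suc.prems(2) that]
      by (rule has_derivative_add)
    show "Ck_on k S (\<lambda>x. frechet_derivative f (at x) v + frechet_derivative g (at x) v)" for v
      using Suc by simp
  qed
qed

lemma Ck_on_sum:
  assumes "open S" "\<And>i. i \<in> I \<Longrightarrow> Ck_on k S (f i)"
  shows "Ck_on k S (\<lambda>x. \<Sum>i\<in>I. f i x)"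
  using assms(2)
  by (induction I rule: infinite_finite_induct)
    (simp_all add: Ck_on_const Ck_on_add assms(1))

text \<open>The Leibniz rule gives two terms of the same bilinear shape, each with one
  differentiated factor. Hence the induction generalises over both factors, and the undifferentiated
  one is lowered to class \<open>k\<close> by \<open>Ck_on_Suc_imp\<close>.\<close>

lemma Ck_on_bilinear:
  assumes p: "bounded_bilinear p" and "open S"
  shows "Ck_on k S f \<Longrightarrow> Ck_on k S g \<Longrightarrow> Ck_on k S (\<lambda>x. p (f x) (g x))"
proof (induction k arbitrary: f g)
  case 0
  then show ?case using bounded_bilinear.continuous_on[OF p] by auto
next
  case (Suc k)
  show ?case
  proof (rule Ck_on_SucI[OF \<open>open S\<close>])
    show "((\<lambda>x. p (f x) (g x)) has_derivative
        (\<lambda>v. p (f x) (frechet_derivative g (at x) v) + p (frechet_derivative f (at x) v) (g x))) (at x)"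
      if "x \<in> S" for x
      using bounded_bilinear.FDERIV[OF p Ck_on_has_derivative[OF Suc.prems(1) that]
          Ck_on_has_derivative[OF Suc.prems(2) that]] .
    show "Ck_on k S (\<lambda>x. p (f x) (frechet_derivative g (at x) v)
        + p (frechet_derivative f (at x) v) (g x))" for v
      using Suc.prems Suc.prems[THEN Ck_on_Suc_imp]
      by (intro Ck_on_add[OF \<open>open S\<close>] Suc.IH) simp_all
  qed
qed

text \<open>The chain rule differentiates \<open>g\<close> in a direction that moves with
  \<open>x\<close>, while \<open>Ck_on\<close> knows fixed directions only. Expanding the direction
  in the basis of the middle space leaves products of coordinates with fixed directional derivatives
  of \<open>g\<close> along \<open>f\<close>, to which the induction hypothesis applies.\<close>

lemma Ck_on_compose:
  fixes f :: "'a::real_normed_vector \<Rightarrow> 'b::real_normed_vector"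
  assumes fin: "finite_dimensional TYPE('b)" and "open S" "open T"
    and sub: "\<And>x. x \<in> S \<Longrightarrow> f x \<in> T"
  shows "Ck_on k T g \<Longrightarrow> Ck_on k S f \<Longrightarrow> Ck_on k S (\<lambda>x. g (f x))"
proof (induction k arbitrary: g)
  case 0
  then show ?case using continuous_on_compose2[of T g S f] sub by auto
next
  case (Suc k)
  let ?G = "\<lambda>x. frechet_derivative g (at (f x))" and ?F = "\<lambda>x. frechet_derivative f (at x)"
  show ?case
  proof (rule Ck_on_SucI[OF \<open>open S\<close>])
    fix x assume "x \<in> S"
    have D: "(g has_derivative ?G x) (at (f x))"
      using Ck_on_has_derivative[OF Suc.prems(1) sub[OF \<open>x \<in> S\<close>]] .
    have "((\<lambda>x. g (f x)) has_derivative ?G x \<circ> ?F x) (at x)"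
      using diff_chain_at[OF Ck_on_has_derivative[OF Suc.prems(2) \<open>x \<in> S\<close>] D]
      by (simp add: comp_def)
    also have "?G x \<circ> ?F x = (\<lambda>v. \<Sum>b\<in>fin_basis. coord b (?F x v) *\<^sub>R ?G x b)"
      unfolding comp_def fun_eq_iff
      using linear_coord_sum[OF fin has_derivative_linear[OF D]] by blast
    finally show "((\<lambda>x. g (f x)) has_derivative
        (\<lambda>v. \<Sum>b\<in>fin_basis. coord b (?F x v) *\<^sub>R ?G x b)) (at x)" .
  next
    fix v
    show "Ck_on k S (\<lambda>x. \<Sum>b\<in>fin_basis. coord b (?F x v) *\<^sub>R ?G x b)"
    proof (intro Ck_on_sum Ck_on_bilinear[OF bounded_bilinear_scaleR] \<open>open S\<close>)
      fix b
      show "Ck_on k S (\<lambda>x. coord b (?F x v))"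
        using Suc.prems by (intro Ck_on_bounded_linear[OF bounded_linear_coord[OF fin] \<open>open S\<close>]) simp
      show "Ck_on k S (\<lambda>x. ?G x b)"
        using Suc.prems(1) Ck_on_Suc_imp[OF Suc.prems(2)]
        by (intro Suc.IH[of "\<lambda>y. frechet_derivative g (at y) b"]) simp_all
    qed
  qed
qed

lemma smooth_onD: "smooth_on S f \<Longrightarrow> Ck_on k S f"
  by (simp add: smooth_on_def)

lemma smooth_on_cong:
  "open S \<Longrightarrow> smooth_on S f \<Longrightarrow> (\<And>x. x \<in> S \<Longrightarrow> f x = g x) \<Longrightarrow> smooth_on S g"
  unfolding smooth_on_def using Ck_on_cong by blast

lemma smooth_on_cong_iff:
  "open S \<Longrightarrow> (\<And>x. x \<in> S \<Longrightarrow> f x = g x) \<Longrightarrow> smooth_on S f \<longleftrightarrow> smooth_on S g"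
  using smooth_on_cong[of S f g] smooth_on_cong[of S g f] by auto

lemma smooth_on_subset: "smooth_on S f \<Longrightarrow> T \<subseteq> S \<Longrightarrow> smooth_on T f"
  unfolding smooth_on_def using Ck_on_subset by blast

lemma smooth_on_local:
  "(\<And>x. x \<in> S \<Longrightarrow> \<exists>T. open T \<and> x \<in> T \<and> smooth_on T f) \<Longrightarrow> smooth_on S f"
  unfolding smooth_on_def by (intro allI Ck_on_local) blast

lemma smooth_on_differentiable: "smooth_on S f \<Longrightarrow> x \<in> S \<Longrightarrow> f differentiable (at x)"
  using smooth_onD[of S f "Suc 0"] by simp

lemma smooth_on_has_derivative:
  "smooth_on S f \<Longrightarrow> x \<in> S \<Longrightarrow> (f has_derivative frechet_derivative f (at x)) (at x)"
  using smooth_on_differentiable frechet_derivative_works by blast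

lemma smooth_on_frechet_derivative:
  "smooth_on S f \<Longrightarrow> smooth_on S (\<lambda>x. frechet_derivative f (at x) v)"
  unfolding smooth_on_def by (metis Ck_on.simps(2))

context
  fixes S :: "'a::real_normed_vector set"
  assumes S: "open S"
begin

lemma smooth_on_const: "smooth_on S (\<lambda>x. c)"
  and smooth_on_id: "smooth_on S (\<lambda>x. x)"
  and smooth_on_add: "smooth_on S f \<Longrightarrow> smooth_on S g \<Longrightarrow> smooth_on S (\<lambda>x. f x + g x)"
  and smooth_on_sum: "(\<And>i. i \<in> I \<Longrightarrow> smooth_on S (h i)) \<Longrightarrow> smooth_on S (\<lambda>x. \<Sum>i\<in>I. h i x)"
  and smooth_on_bounded_linear: "bounded_linear L \<Longrightarrow> smooth_on S f \<Longrightarrow> smooth_on S (\<lambda>x. L (f x))"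
  and smooth_on_bilinear: "bounded_bilinear p \<Longrightarrow> smooth_on S f' \<Longrightarrow> smooth_on S g'
      \<Longrightarrow> smooth_on S (\<lambda>x. p (f' x) (g' x))"
  by (simp_all add: smooth_on_def Ck_on_const Ck_on_id Ck_on_add Ck_on_sum
      Ck_on_bounded_linear Ck_on_bilinear S)

lemmas smooth_on_scaleR = smooth_on_bilinear[OF bounded_bilinear_scaleR]
lemmas smooth_on_mult = smooth_on_bilinear[OF bounded_bilinear_mult]

lemma smooth_on_minus: "smooth_on S f \<Longrightarrow> smooth_on S g \<Longrightarrow> smooth_on S (\<lambda>x. f x - g x)"
  using smooth_on_add[of f "\<lambda>x. - g x"] smooth_on_bounded_linear[of uminus g]
  by (simp add: bounded_linear_minus)

lemma smooth_on_Pair: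
  assumes "smooth_on S f" "smooth_on S g"
  shows "smooth_on S (\<lambda>x. (f x, g x))"
proof -
  have "bounded_linear (\<lambda>x::'b. (x, 0::'c))" "bounded_linear (\<lambda>x::'c. (0::'b, x))"
    by (intro bounded_linear_Pair bounded_linear_ident bounded_linear_zero)+
  from smooth_on_add[OF smooth_on_bounded_linear[OF this(1) assms(1)]
      smooth_on_bounded_linear[OF this(2) assms(2)]]
  show ?thesis by simp
qed

lemma smooth_on_compose:
  fixes f :: "'a \<Rightarrow> 'b::real_normed_vector"
  assumes "finite_dimensional TYPE('b)" "smooth_on T g" "smooth_on S f" "open T"
    "\<And>x. x \<in> S \<Longrightarrow> f x \<in> T"
  shows "smooth_on S (\<lambda>x. g (f x))"
  using Ck_on_compose[OF assms(1) S assms(4), of f, OF assms(5)] assms(2,3) unfolding smooth_on_def by blast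

text \<open>As in the chain rule, the moving direction \<open>v x\<close> is expanded in the
  basis.\<close>

lemma smooth_on_directional:
  assumes fin: "finite_dimensional TYPE('a)" and g: "smooth_on S g" and v: "smooth_on S v"
  shows "smooth_on S (\<lambda>x. frechet_derivative g (at x) (v x))"
proof (rule smooth_on_cong[OF S])
  show "smooth_on S (\<lambda>x. \<Sum>b\<in>fin_basis. coord b (v x) *\<^sub>R frechet_derivative g (at x) b)"
    by (intro smooth_on_sum smooth_on_scaleR smooth_on_bounded_linear[OF bounded_linear_coord[OF fin]]
        v smooth_on_frechet_derivative g)
  show "(\<Sum>b\<in>fin_basis. coord b (v x) *\<^sub>R frechet_derivative g (at x) b)
      = frechet_derivative g (at x) (v x)" if "x \<in> S" for x
    by (rule linear_coord_sum[OF fin has_derivative_linear[OF smooth_on_has_derivative[OF g that]],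
          symmetric])
qed

end

section \<open>Flat functions and bump functions on the model space\<close>

lemma finite_dimensional_euclidean: "finite_dimensional TYPE('a::euclidean_space)"
  unfolding finite_dimensional_def using finite_Basis span_Basis by blast

text \<open>The function \<open>exp(-1/t)\<close> that is flat at 0, with a polynomial factor in
  \<open>1/t\<close> so that the family is closed under differentiation. Cut-offs are built from
  \<open>p = 1\<close>.\<close>

definition flat_exp :: "real poly \<Rightarrow> real \<Rightarrow> real" where
  "flat_exp p t = (if t > 0 then poly p (inverse t) * exp (- inverse t) else 0)"

lemma tendsto_poly_exp_minus: "((\<lambda>y::real. poly p y * exp (- y)) \<longlongrightarrow> 0) at_top"
proof -
  have "((\<lambda>y::real. \<Sum>i\<le>degree p. coeff p i * (y ^ i / exp y)) \<longlongrightarrow> 0) at_top"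
    by (intro tendsto_null_sum tendsto_mult_right_zero tendsto_power_div_exp_0)
  then show ?thesis
    by (simp add: poly_altdef sum_distrib_right exp_minus divide_inverse mult.assoc)
qed

text \<open>With \<open>u = 1/t\<close>, the derivative of \<open>p(u) exp(-u)\<close> in
  \<open>t\<close> is \<open>u^2 (p(u) - p'(u)) exp(-u)\<close>, and \<open>[:0, 0, 1:]\<close> is
  the polynomial \<open>u^2\<close>. At 0 the right-hand difference quotient is again a polynomial
  in \<open>u\<close> times \<open>exp(-u)\<close> and tends to 0.\<close>

lemma has_derivative_flat_exp:
  "(flat_exp p has_real_derivative flat_exp ([:0, 0, 1:] * (p - pderiv p)) t) (at t)"
proof -
  consider "t > 0" | "t < 0" | "t = 0" by linarith
  then show ?thesis
  proof cases
    case 1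
    have "((\<lambda>t. poly p (inverse t) * exp (- inverse t)) has_real_derivative
        flat_exp ([:0, 0, 1:] * (p - pderiv p)) t) (at t)"
      using 1 unfolding flat_exp_def
      by (auto intro!: derivative_eq_intros poly_DERIV[THEN DERIV_chain2]
          simp: field_simps power2_eq_square)
    then show ?thesis
      by (rule has_field_derivative_transform_within_open[where S = "{0<..}"])
        (use 1 in \<open>auto simp: flat_exp_def\<close>)
  next
    case 2
    have "((\<lambda>t. 0) has_real_derivative flat_exp ([:0, 0, 1:] * (p - pderiv p)) t) (at t)"
      using 2 by (simp add: flat_exp_def)
    then show ?thesis
      by (rule has_field_derivative_transform_within_open[where S = "{..<0}"])
        (use 2 in \<open>auto simp: flat_exp_def\<close>)
  next
    case 3
    have "((\<lambda>h. flat_exp p h / h) \<longlongrightarrow> 0) (at 0)"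
      unfolding filterlim_at_split
    proof
      have "\<forall>\<^sub>F h in at_left (0::real). 0 = flat_exp p h / h"
        unfolding eventually_at_filter by (auto simp: flat_exp_def)
      then show "((\<lambda>h. flat_exp p h / h) \<longlongrightarrow> 0) (at_left 0)"
        by (rule tendsto_eventually[OF eventually_mono]) simp
      \<comment> \<open>Division by \<open>inverse y\<close> multiplies by \<open>y\<close>, and
        \<open>pCons 0 p\<close> is the polynomial \<open>y p(y)\<close>.\<close>
      have "((\<lambda>y. flat_exp p (inverse y) / inverse y) \<longlongrightarrow> 0) at_top"
      proof (rule Lim_transform_eventually[OF tendsto_poly_exp_minus[of "pCons 0 p"]])
        show "\<forall>\<^sub>F y in at_top. poly (pCons 0 p) y * exp (- y) = flat_exp p (inverse y) / inverse y"
          using eventually_gt_at_top[of 0] by eventually_elim (simp add: flat_exp_def field_simps)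
      qed
      then show "((\<lambda>h. flat_exp p h / h) \<longlongrightarrow> 0) (at_right 0)"
        by (simp add: filterlim_at_right_to_top)
    qed
    then show ?thesis using 3 by (simp add: has_field_derivative_iff flat_exp_def)
  qed
qed

lemma smooth_on_flat_exp: "smooth_on UNIV (flat_exp p)"
proof -
  have "Ck_on k UNIV (flat_exp p)" for k
  proof (induction k arbitrary: p)
    case 0
    have "continuous_on UNIV (flat_exp p)"
      using has_derivative_flat_exp DERIV_isCont by (blast intro: continuous_at_imp_continuous_on)
    then show ?case by simp
  next
    case (Suc k)
    show ?case
    proof (rule Ck_on_SucI)
      show "(flat_exp p has_derivative (\<lambda>v. flat_exp ([:0, 0, 1:] * (p - pderiv p)) x * v)) (at x)" for x
        using has_derivative_flat_exp by (simp add: has_field_derivative_def)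
      show "Ck_on k UNIV (\<lambda>x. flat_exp ([:0, 0, 1:] * (p - pderiv p)) x * v)" for v
        by (intro Ck_on_bounded_linear[OF bounded_linear_mult_left] Suc) auto
    qed auto
  qed
  then show ?thesis by (simp add: smooth_on_def)
qed

lemma smooth_plateau:
  obtains h :: "real \<Rightarrow> real" where "smooth_on UNIV h"
    "\<And>t. t \<le> 1/2 \<Longrightarrow> h t = 1" "\<And>t. t \<ge> 1 \<Longrightarrow> h t = 0"
proof
  let ?g = "flat_exp 1"
  \<comment> \<open>For \<open>t \<le> 1/2\<close> the outer \<open>?g\<close> has a nonpositive
    argument and vanishes; for \<open>t \<ge> 1\<close> the inner \<open>?g (1 - t)\<close> vanishes
    and the outer value is \<open>?g (?g (1/2))\<close>, the normalising constant. Nesting replaces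
    the usual quotient of two such functions, so that only a constant is inverted.\<close>
  let ?h = "\<lambda>t. 1 - ?g (?g (1/2) - ?g (1 - t)) * inverse (?g (?g (1/2)))"
  note fin = finite_dimensional_euclidean[where 'a = real]
  have pos: "?g t > 0 \<longleftrightarrow> t > 0" for t by (simp add: flat_exp_def)
  have "smooth_on UNIV (\<lambda>t::real. 1 - t)"
    by (intro smooth_on_minus smooth_on_const smooth_on_id open_UNIV)
  then have "smooth_on UNIV (\<lambda>t. ?g (1 - t))"
    by (rule smooth_on_compose[OF open_UNIV fin smooth_on_flat_exp]) auto
  then have "smooth_on UNIV (\<lambda>t. ?g (1/2) - ?g (1 - t))"
    by (intro smooth_on_minus smooth_on_const open_UNIV)
  then have "smooth_on UNIV (\<lambda>t. ?g (?g (1/2) - ?g (1 - t)))"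
    by (rule smooth_on_compose[OF open_UNIV fin smooth_on_flat_exp]) auto
  then show "smooth_on UNIV ?h"
    by (intro smooth_on_minus smooth_on_const smooth_on_mult open_UNIV)
  show "?h t = 1" if "t \<le> 1/2" for t
  proof -
    have "?g (1/2) \<le> ?g (1 - t)"
      using that by (simp add: flat_exp_def field_simps)
    then show ?thesis by (simp add: flat_exp_def[of _ "_ - _"])
  qed
  show "?h t = 0" if "t \<ge> 1" for t
  proof -
    have "?g (1 - t) = 0" using that by (simp add: flat_exp_def)
    moreover have "?g (?g (1/2)) \<noteq> 0" using pos[of "1/2"] pos[of "?g (1/2)"] by simp
    ultimately show ?thesis by simp
  qed
qed

text \<open>The plateau function is composed with the coordinate quadratic form at \<open>x\<close>,
  scaled by \<open>r\<^sup>2\<close>: off \<open>K\<close> the scaled form exceeds 1, and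
  \<open>N\<close> is where it is below 1/2.\<close>

lemma smooth_bump:
  fixes x :: "'a::real_normed_vector"
  assumes fin: "finite_dimensional TYPE('a)" and "open S" "x \<in> S"
  obtains \<beta> K N where "smooth_on UNIV (\<beta> :: 'a \<Rightarrow> real)" "compact K" "K \<subseteq> S"
    "\<And>y. y \<notin> K \<Longrightarrow> \<beta> y = 0" "open N" "x \<in> N" "\<And>y. y \<in> N \<Longrightarrow> \<beta> y = 1"
proof -
  obtain r K where rK: "r > 0" "compact K" "K \<subseteq> S"
    "\<And>y. (\<Sum>b\<in>fin_basis. (coord b (y - x))\<^sup>2) \<le> r\<^sup>2 \<Longrightarrow> y \<in> K"
    using finite_dimensional_compact_neighbourhood[OF assms] by blast
  obtain h :: "real \<Rightarrow> real" where h: "smooth_on UNIV h"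
    "\<And>t. t \<le> 1/2 \<Longrightarrow> h t = 1" "\<And>t. t \<ge> 1 \<Longrightarrow> h t = 0"
    using smooth_plateau by blast
  define Q where "Q = (\<lambda>y. (\<Sum>b\<in>fin_basis. coord b (y - x) * coord b (y - x)) * inverse (r\<^sup>2))"
  note finr = finite_dimensional_euclidean[where 'a = real]
  have Q: "smooth_on UNIV Q"
    unfolding Q_def
    by (intro smooth_on_sum smooth_on_mult smooth_on_bounded_linear[OF _ bounded_linear_coord[OF fin]]
        smooth_on_minus smooth_on_id smooth_on_const open_UNIV)
  have "smooth_on UNIV (\<lambda>y. h (Q y))"
    by (rule smooth_on_compose[OF _ finr h(1) Q]) auto
  moreover have "h (Q y) = 0" if "y \<notin> K" for y
  proof (rule h)
    have "\<not> (\<Sum>b\<in>fin_basis. (coord b (y - x))\<^sup>2) \<le> r\<^sup>2" using that rK by blast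
    then show "1 \<le> Q y" using rK(1) by (simp add: Q_def field_simps power2_eq_square)
  qed
  moreover have "open {y. Q y < 1/2}"
    using smooth_onD[OF Q, of 0] by (intro open_Collect_less) auto
  moreover have "x \<in> {y. Q y < 1/2}"
    using linear_0[OF linear_coord[OF fin]] by (simp add: Q_def)
  moreover have "h (Q y) = 1" if "y \<in> {y. Q y < 1/2}" for y
    using h(2)[of "Q y"] that by simp
  ultimately show thesis using rK(2,3) that[of "\<lambda>y. h (Q y)" K "{y. Q y < 1/2}"] by blast
qed

section \<open>Smooth functions on a manifold\<close>

text \<open>The local, vector-valued notion of smoothness to which elements of \<open>Cinf\<close>
  and sections of every bundle are reduced, by \<open>Cinf_iff\<close> and
  \<open>sections_iff\<close>.\<close>

definition smooth_fun :: "('m, 'e::real_normed_vector) atlas \<Rightarrow> 'm set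
    \<Rightarrow> ('m \<Rightarrow> 'b::real_normed_vector) \<Rightarrow> bool" where
  "smooth_fun \<A> S f \<longleftrightarrow> (\<forall>c\<in>\<A>. smooth_on (snd c ` (fst c \<inter> S)) (f \<circ> inv_into (fst c) (snd c)))"

locale manifold =
  fixes \<A> :: "('m::{t2_space,second_countable_topology}, 'e::real_normed_vector) atlas"
  assumes smooth_manifold: "smooth_manifold \<A>"
begin

lemma finite_dimensional_model: "finite_dimensional TYPE('e)"
  using smooth_manifold unfolding smooth_manifold_def by blast

lemma chart_at:
  obtains c where "c \<in> \<A>" "m \<in> fst c"
proof -
  have "m \<in> (\<Union>(U, \<phi>) \<in> \<A>. U)"
    using smooth_manifold unfolding smooth_manifold_def by simp
  then show thesis using that by force
qed

lemma chart_homeomorphism: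
  "c \<in> \<A> \<Longrightarrow> homeomorphism (fst c) (snd c ` fst c) (snd c) (inv_into (fst c) (snd c))"
  and open_chart: "c \<in> \<A> \<Longrightarrow> open (fst c)"
  and open_chart_range: "c \<in> \<A> \<Longrightarrow> open (snd c ` fst c)"
  using smooth_manifold unfolding smooth_manifold_def by auto

lemma chart_inv: "c \<in> \<A> \<Longrightarrow> m \<in> fst c \<Longrightarrow> inv_into (fst c) (snd c) (snd c m) = m"
  using chart_homeomorphism[of c] by (simp add: homeomorphism_def)

lemma open_chart_image:
  assumes "c \<in> \<A>" "open S" "S \<subseteq> fst c"
  shows "open (snd c ` S)"
proof -
  have "openin (top_of_set (fst c)) S"
    using assms by (auto intro: open_subset)
  then have "openin (top_of_set (snd c ` fst c)) (snd c ` S)"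
    using homeomorphism_imp_open_map[OF chart_homeomorphism[OF assms(1)]] by blast
  then show ?thesis
    using open_chart_range[OF assms(1)] openin_open_trans by blast
qed

lemma open_chart_image_Int: "c \<in> \<A> \<Longrightarrow> open S \<Longrightarrow> open (snd c ` (fst c \<inter> S))"
  by (intro open_chart_image open_Int open_chart) auto

lemma smooth_funD:
  assumes "smooth_fun \<A> S f" "c \<in> \<A>" "S \<subseteq> fst c"
  shows "smooth_on (snd c ` S) (f \<circ> inv_into (fst c) (snd c))"
  using assms unfolding smooth_fun_def by (metis Int_absorb1)

lemma smooth_chart_change:
  assumes "c \<in> \<A>" "c' \<in> \<A>"
  shows "smooth_on (snd c ` (fst c \<inter> fst c')) (snd c' \<circ> inv_into (fst c) (snd c))"
proof -
  have "smooth_map \<A> \<A> (\<lambda>m. m)"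
    using smooth_manifold unfolding smooth_manifold_def by blast
  then show ?thesis
    using assms unfolding smooth_map_def by (force simp: comp_def)
qed

lemma smooth_fun_chart: "c \<in> \<A> \<Longrightarrow> smooth_fun \<A> (fst c) (snd c)"
  unfolding smooth_fun_def using smooth_chart_change by blast

text \<open>Coordinate changes are smooth, so a single chart containing \<open>S\<close> decides
  smoothness in all charts.\<close>

lemma smooth_funI_chart:
  assumes "c \<in> \<A>" "open S" "S \<subseteq> fst c"
    and f: "smooth_on (snd c ` S) (f \<circ> inv_into (fst c) (snd c))"
  shows "smooth_fun \<A> S f"
  unfolding smooth_fun_def
proof
  fix c' assume c': "c' \<in> \<A>"
  let ?T = "snd c' ` (fst c' \<inter> S)"
  have T: "open ?T" using c' assms(2) by (rule open_chart_image_Int)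
  have "?T \<subseteq> snd c' ` (fst c' \<inter> fst c)" using assms(3) by blast
  then have "smooth_on ?T (snd c \<circ> inv_into (fst c') (snd c'))"
    by (rule smooth_on_subset[OF smooth_chart_change[OF c' assms(1)]])
  moreover have "(snd c \<circ> inv_into (fst c') (snd c')) y \<in> snd c ` S" if "y \<in> ?T" for y
    using that chart_inv[OF c'] by auto
  ultimately have "smooth_on ?T
      (\<lambda>y. (f \<circ> inv_into (fst c) (snd c)) ((snd c \<circ> inv_into (fst c') (snd c')) y))"
    by (rule smooth_on_compose[OF T finite_dimensional_model f _ open_chart_image[OF assms(1-3)]])
  then show "smooth_on ?T (f \<circ> inv_into (fst c') (snd c'))"
    by (rule smooth_on_cong[OF T])
      (use chart_inv[OF c'] chart_inv[OF assms(1)] assms(3) in auto)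
qed

lemma smooth_fun_local:
  assumes "\<And>m. m \<in> S \<Longrightarrow> \<exists>T. open T \<and> m \<in> T \<and> smooth_fun \<A> T f"
  shows "smooth_fun \<A> S f"
  unfolding smooth_fun_def
proof (intro ballI smooth_on_local)
  fix c y assume c: "c \<in> \<A>" and "y \<in> snd c ` (fst c \<inter> S)"
  then obtain m where m: "m \<in> fst c" "m \<in> S" "y = snd c m" by blast
  obtain T where T: "open T" "m \<in> T" "smooth_fun \<A> T f" using assms[OF m(2)] by blast
  then show "\<exists>T. open T \<and> y \<in> T \<and> smooth_on T (f \<circ> inv_into (fst c) (snd c))"
    using c m open_chart_image_Int[OF c T(1)]
    by (intro exI[of _ "snd c ` (fst c \<inter> T)"]) (auto simp: smooth_fun_def)
qed

lemma smooth_fun_subset: "smooth_fun \<A> S f \<Longrightarrow> T \<subseteq> S \<Longrightarrow> smooth_fun \<A> T f"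
  unfolding smooth_fun_def by (meson Int_mono image_mono smooth_on_subset subset_refl)

lemma smooth_fun_cong:
  assumes "open S" "smooth_fun \<A> S f" "\<And>m. m \<in> S \<Longrightarrow> f m = g m"
  shows "smooth_fun \<A> S g"
  unfolding smooth_fun_def
proof
  fix c assume c: "c \<in> \<A>"
  have "smooth_on (snd c ` (fst c \<inter> S)) (f \<circ> inv_into (fst c) (snd c))"
    using c assms(2) unfolding smooth_fun_def by blast
  then show "smooth_on (snd c ` (fst c \<inter> S)) (g \<circ> inv_into (fst c) (snd c))"
    by (rule smooth_on_cong[OF open_chart_image_Int[OF c assms(1)]])
      (use c assms(3) chart_inv[OF c] in auto)
qed

lemma smooth_fun_compose:
  fixes f :: "'m \<Rightarrow> 'b::real_normed_vector"
  assumes "open S" "finite_dimensional TYPE('b)" "smooth_on T g" "open T"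
    and "smooth_fun \<A> S f" "\<And>m. m \<in> S \<Longrightarrow> f m \<in> T"
  shows "smooth_fun \<A> S (\<lambda>m. g (f m))"
  unfolding smooth_fun_def
proof
  fix c assume c: "c \<in> \<A>"
  have "smooth_on (snd c ` (fst c \<inter> S)) (f \<circ> inv_into (fst c) (snd c))"
    using c assms(5) unfolding smooth_fun_def by blast
  then have "smooth_on (snd c ` (fst c \<inter> S)) (\<lambda>y. g ((f \<circ> inv_into (fst c) (snd c)) y))"
    by (rule smooth_on_compose[OF open_chart_image_Int[OF c assms(1)] assms(2,3) _ assms(4)])
      (use assms(6) chart_inv[OF c] in auto)
  then show "smooth_on (snd c ` (fst c \<inter> S)) ((\<lambda>m. g (f m)) \<circ> inv_into (fst c) (snd c))"
    by (simp add: comp_def)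
qed

context
  fixes S :: "'m set"
  assumes S: "open S"
begin

lemma smooth_fun_const: "smooth_fun \<A> S (\<lambda>m. k)"
  and smooth_fun_add: "smooth_fun \<A> S f \<Longrightarrow> smooth_fun \<A> S g \<Longrightarrow> smooth_fun \<A> S (\<lambda>m. f m + g m)"
  and smooth_fun_sum: "(\<And>i. i \<in> I \<Longrightarrow> smooth_fun \<A> S (h i)) \<Longrightarrow> smooth_fun \<A> S (\<lambda>m. \<Sum>i\<in>I. h i m)"
  and smooth_fun_Pair: "smooth_fun \<A> S f' \<Longrightarrow> smooth_fun \<A> S g' \<Longrightarrow> smooth_fun \<A> S (\<lambda>m. (f' m, g' m))"
  by (simp_all add: smooth_fun_def comp_def open_chart_image_Int S smooth_on_const smooth_on_add
      smooth_on_sum smooth_on_Pair)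

lemma smooth_fun_bounded_linear:
  assumes "bounded_linear L" "smooth_fun \<A> S f"
  shows "smooth_fun \<A> S (\<lambda>m. L (f m))"
  using smooth_on_bounded_linear[OF open_chart_image_Int[OF _ S] assms(1)] assms(2)
  unfolding smooth_fun_def comp_def by blast

lemma smooth_fun_bilinear:
  assumes "bounded_bilinear p" "smooth_fun \<A> S f" "smooth_fun \<A> S g"
  shows "smooth_fun \<A> S (\<lambda>m. p (f m) (g m))"
  using smooth_on_bilinear[OF open_chart_image_Int[OF _ S] assms(1)] assms(2,3)
  unfolding smooth_fun_def comp_def by blast

lemmas smooth_fun_scaleR = smooth_fun_bilinear[OF bounded_bilinear_scaleR]
lemmas smooth_fun_mult = smooth_fun_bilinear[OF bounded_bilinear_mult]

end

lemma Cinf_iff: "f \<in> Cinf \<A> \<longleftrightarrow> smooth_fun \<A> UNIV f"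
  unfolding Cinf_def smooth_map_def smooth_fun_def
  using open_chart_range by (auto simp: comp_def)

lemma Cinf_const: "(\<lambda>_. k) \<in> Cinf \<A>"
  and Cinf_add: "f \<in> Cinf \<A> \<Longrightarrow> g \<in> Cinf \<A> \<Longrightarrow> (\<lambda>m. f m + g m) \<in> Cinf \<A>"
  and Cinf_mult: "f \<in> Cinf \<A> \<Longrightarrow> g \<in> Cinf \<A> \<Longrightarrow> (\<lambda>m. f m * g m) \<in> Cinf \<A>"
  by (simp_all add: Cinf_iff smooth_fun_const smooth_fun_add smooth_fun_mult)

lemma Cinf_sum: "(\<And>i. i \<in> I \<Longrightarrow> f i \<in> Cinf \<A>) \<Longrightarrow> (\<lambda>x. \<Sum>i\<in>I. f i x) \<in> Cinf \<A>"
  by (simp add: Cinf_iff smooth_fun_sum)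

lemma Cinf_smooth_fun: "f \<in> Cinf \<A> \<Longrightarrow> smooth_fun \<A> S f"
  using smooth_fun_subset Cinf_iff by blast

section \<open>Derivatives of functions on the manifold with respect to a chart\<close>

lemma smooth_fun_chart_deriv:
  assumes "open S" "c \<in> \<A>" "S \<subseteq> fst c" "smooth_fun \<A> S f" "smooth_fun \<A> S v"
  shows "smooth_fun \<A> S (\<lambda>m. chart_deriv c m (v m) f)"
proof (rule smooth_funI_chart[OF assms(2,1,3)])
  let ?i = "inv_into (fst c) (snd c)"
  have S': "open (snd c ` S)" using assms by (intro open_chart_image)
  show "smooth_on (snd c ` S) ((\<lambda>m. chart_deriv c m (v m) f) \<circ> ?i)"
  proof (rule smooth_on_cong[OF S'])
    show "smooth_on (snd c ` S) (\<lambda>y. frechet_derivative (f \<circ> ?i) (at y) ((v \<circ> ?i) y))"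
      using assms by (intro smooth_on_directional[OF S' finite_dimensional_model] smooth_funD)
    show "frechet_derivative (f \<circ> ?i) (at y) ((v \<circ> ?i) y) = ((\<lambda>m. chart_deriv c m (v m) f) \<circ> ?i) y"
      if "y \<in> snd c ` S" for y
      using that assms(3) chart_inv[OF assms(2)] by (auto simp: chart_deriv_def)
  qed
qed

lemma chart_deriv_has_derivative:
  assumes "c \<in> \<A>" "m \<in> fst c" "m \<in> S" "open S" "smooth_fun \<A> S f"
  shows "(f \<circ> inv_into (fst c) (snd c) has_derivative (\<lambda>v. chart_deriv c m v f)) (at (snd c m))"
  unfolding chart_deriv_def
  using assms by (intro smooth_on_has_derivative[where S = "snd c ` (fst c \<inter> S)"]) (auto simp: smooth_fun_def)

lemma chart_deriv_eqI:
  "(f \<circ> inv_into (fst c) (snd c) has_derivative D) (at (snd c m)) \<Longrightarrow> chart_deriv c m v f = D v"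
  unfolding chart_deriv_def by (simp flip: frechet_derivative_at)

lemma chart_deriv_cong:
  assumes "c \<in> \<A>" "m \<in> fst c" "m \<in> S" "open S" "smooth_fun \<A> S f" "\<And>x. x \<in> S \<Longrightarrow> f x = g x"
  shows "chart_deriv c m v f = chart_deriv c m v g"
proof -
  have "(g \<circ> inv_into (fst c) (snd c) has_derivative (\<lambda>v. chart_deriv c m v f)) (at (snd c m))"
    by (rule has_derivative_transform_within_open[OF chart_deriv_has_derivative[OF assms(1-5)]
          open_chart_image_Int[OF assms(1,4)]]) (use assms chart_inv[OF assms(1)] in auto)
  then show ?thesis by (rule chart_deriv_eqI[symmetric])
qed

lemma chart_deriv_const: "chart_deriv c m v (\<lambda>_. k) = 0"
  by (rule chart_deriv_eqI[where D = "\<lambda>_. 0"]) (simp add: comp_def)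

context
  fixes c m S
  assumes c: "c \<in> \<A>" and m: "m \<in> fst c" "m \<in> S" and S: "open S"
begin

lemma chart_deriv_linear: "smooth_fun \<A> S f \<Longrightarrow> linear (\<lambda>v. chart_deriv c m v f)"
  using chart_deriv_has_derivative[OF c m S] has_derivative_linear by blast

lemma chart_deriv_plus:
  "smooth_fun \<A> S f \<Longrightarrow> smooth_fun \<A> S g \<Longrightarrow>
    chart_deriv c m v (\<lambda>x. f x + g x) = chart_deriv c m v f + chart_deriv c m v g"
  using has_derivative_add[OF chart_deriv_has_derivative[OF c m S, of f] chart_deriv_has_derivative[OF c m S, of g]]
  by (intro chart_deriv_eqI) (simp add: comp_def)

lemma chart_deriv_bilinear:
  assumes "bounded_bilinear p" "smooth_fun \<A> S f" "smooth_fun \<A> S g"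
  shows "chart_deriv c m v (\<lambda>x. p (f x) (g x)) = p (f m) (chart_deriv c m v g) + p (chart_deriv c m v f) (g m)"
  using bounded_bilinear.FDERIV[OF assms(1) chart_deriv_has_derivative[OF c m S assms(2)]
      chart_deriv_has_derivative[OF c m S assms(3)]]
  by (intro chart_deriv_eqI) (simp add: comp_def chart_inv[OF c m(1)])

lemma chart_deriv_bounded_linear:
  assumes "bounded_linear L" "smooth_fun \<A> S f"
  shows "chart_deriv c m v (\<lambda>x. L (f x)) = L (chart_deriv c m v f)"
  using bounded_linear.has_derivative[OF assms(1) chart_deriv_has_derivative[OF c m S assms(2)]]
  by (intro chart_deriv_eqI) (simp add: comp_def)

text \<open>The chain rule, with \<open>f\<close> factored through the coordinates of
  \<open>c'\<close>. The derivative of the coordinate map \<open>snd c'\<close> is the coordinate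
  vector in the new chart.\<close>

lemma chart_deriv_change:
  assumes "c' \<in> \<A>" "m \<in> fst c'" "smooth_fun \<A> S f"
  shows "chart_deriv c m v f = chart_deriv c' m (chart_deriv c m v (snd c')) f"
proof -
  let ?i = "inv_into (fst c) (snd c)" and ?i' = "inv_into (fst c') (snd c')"
  have "(snd c' \<circ> ?i has_derivative (\<lambda>v. chart_deriv c m v (snd c'))) (at (snd c m))"
    by (rule chart_deriv_has_derivative[OF c m(1) assms(2) open_chart smooth_fun_chart])
      (rule assms(1))+
  moreover have "(f \<circ> ?i' has_derivative (\<lambda>v. chart_deriv c' m v f)) (at ((snd c' \<circ> ?i) (snd c m)))"
    using chart_deriv_has_derivative[OF assms(1,2) m(2) S assms(3)] chart_inv[OF c m(1)] by simp
  ultimately have "((f \<circ> ?i') \<circ> (snd c' \<circ> ?i) has_derivative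
      (\<lambda>v. chart_deriv c' m v f) \<circ> (\<lambda>v. chart_deriv c m v (snd c'))) (at (snd c m))"
    by (rule diff_chain_at)
  then have "(f \<circ> ?i has_derivative
      (\<lambda>v. chart_deriv c' m v f) \<circ> (\<lambda>v. chart_deriv c m v (snd c'))) (at (snd c m))"
  proof (rule has_derivative_transform_within_open)
    show "open (snd c ` (fst c \<inter> fst c'))"
      using c open_chart[OF assms(1)] by (rule open_chart_image_Int)
  qed (use m c assms chart_inv in auto)
  from chart_deriv_eqI[OF this] show ?thesis by simp
qed

end

text \<open>A bump function of the model space, read in a chart and extended by 0.\<close>

lemma smooth_bump_fun:
  assumes "open S" "m \<in> S"
  obtains \<beta> :: "'m \<Rightarrow> real" and K N where "\<beta> \<in> Cinf \<A>" "closed K" "K \<subseteq> S"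
    "\<And>x. x \<notin> K \<Longrightarrow> \<beta> x = 0" "open N" "m \<in> N" "N \<subseteq> S" "\<And>x. x \<in> N \<Longrightarrow> \<beta> x = 1"
proof -
  obtain c where c: "c \<in> \<A>" "m \<in> fst c" using chart_at by blast
  let ?i = "inv_into (fst c) (snd c)"
  obtain b K N where b: "smooth_on UNIV (b :: 'e \<Rightarrow> real)" "compact K" "K \<subseteq> snd c ` (fst c \<inter> S)"
    "\<And>y. y \<notin> K \<Longrightarrow> b y = 0" "open N" "snd c m \<in> N" "\<And>y. y \<in> N \<Longrightarrow> b y = 1"
    using smooth_bump[OF finite_dimensional_model open_chart_image_Int[OF c(1) assms(1)], of "snd c m"] c assms
    by blast
  define \<beta> where "\<beta> = (\<lambda>x. if x \<in> fst c then b (snd c x) else 0)"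
  have K: "?i ` K \<subseteq> fst c \<inter> S"
    using b(3) chart_inv[OF c(1)] by force
  have "continuous_on (snd c ` fst c) ?i"
    using chart_homeomorphism[OF c(1)] by (simp add: homeomorphism_def)
  moreover have "K \<subseteq> snd c ` fst c" using b(3) by blast
  ultimately have "compact (?i ` K)"
    using b(2) by (blast intro: compact_continuous_image continuous_on_subset)
  \<comment> \<open>The Hausdorff property enters here: the compact set is closed in the whole
    manifold, so its complement is open and the extension by 0 is smooth there.\<close>
  then have "closed (?i ` K)" by (rule compact_imp_closed)
  have off: "\<beta> x = 0" if "x \<notin> ?i ` K" for x
  proof (cases "x \<in> fst c")
    case True
    then have "snd c x \<notin> K" using that chart_inv[OF c(1) True] by force
    then show ?thesis by (simp add: \<beta>_def b(4))
  qed (simp add: \<beta>_def)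
  have "smooth_fun \<A> (fst c) (\<lambda>x. b (snd c x))"
    by (rule smooth_fun_compose[OF open_chart finite_dimensional_model b(1) open_UNIV smooth_fun_chart])
      (use c in auto)
  then have 1: "smooth_fun \<A> (fst c) \<beta>"
    by (rule smooth_fun_cong[OF open_chart[OF c(1)]]) (simp add: \<beta>_def)
  have 2: "smooth_fun \<A> (- ?i ` K) \<beta>"
    using \<open>closed (?i ` K)\<close> off by (intro smooth_fun_cong[OF _ smooth_fun_const]) (auto simp: open_Compl)
  have "smooth_fun \<A> UNIV \<beta>"
    using 1 2 K open_chart[OF c(1)] open_Compl[OF \<open>closed (?i ` K)\<close>]
    by (intro smooth_fun_local) (metis Int_iff ComplI subsetD)
  moreover have "open (?i ` (snd c ` (fst c \<inter> S) \<inter> N))"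
  proof -
    have "openin (top_of_set (snd c ` fst c)) (snd c ` (fst c \<inter> S) \<inter> N)"
      by (intro open_subset open_Int open_chart_image_Int c assms b) auto
    then have "openin (top_of_set (fst c)) (?i ` (snd c ` (fst c \<inter> S) \<inter> N))"
      by (rule homeomorphism_imp_open_map[OF homeomorphism_symD[OF chart_homeomorphism[OF c(1)]]])
    then show ?thesis using open_chart[OF c(1)] openin_open_trans by blast
  qed
  moreover have "m \<in> ?i ` (snd c ` (fst c \<inter> S) \<inter> N)"
    using c assms b chart_inv[OF c] by (intro image_eqI[of _ _ "snd c m"]) auto
  moreover have "?i ` (snd c ` (fst c \<inter> S) \<inter> N) \<subseteq> S"
    using chart_inv[OF c(1)] by auto
  moreover have "\<beta> x = 1" if "x \<in> ?i ` (snd c ` (fst c \<inter> S) \<inter> N)" for x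
    using that chart_inv[OF c(1)] b(7) by (auto simp: \<beta>_def)
  ultimately show thesis
    using that[of \<beta> "?i ` K" "?i ` (snd c ` (fst c \<inter> S) \<inter> N)"] \<open>closed (?i ` K)\<close> off K
    by (auto simp: Cinf_iff)
qed

text \<open>The open sets \<open>S\<close> and \<open>- K\<close> cover the manifold; on the first
  the function is a smooth product, on the second it is 0.\<close>

lemma smooth_fun_extend_zero:
  assumes S: "open S" and f: "smooth_fun \<A> S f"
    and K: "closed K" "K \<subseteq> S" "\<And>x. x \<notin> K \<Longrightarrow> \<beta> x = 0" and \<beta>: "\<beta> \<in> Cinf \<A>"
  shows "smooth_fun \<A> UNIV (\<lambda>x. if x \<in> S then \<beta> x *\<^sub>R f x else 0)"
proof (rule smooth_fun_local)
  fix x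
  let ?f = "\<lambda>x. if x \<in> S then \<beta> x *\<^sub>R f x else 0"
  have "smooth_fun \<A> S ?f"
    by (rule smooth_fun_cong[OF S smooth_fun_scaleR[OF S Cinf_smooth_fun[OF \<beta>] f]]) simp
  moreover have "smooth_fun \<A> (- K) ?f"
    using K by (intro smooth_fun_cong[OF _ smooth_fun_const]) (auto simp: open_Compl)
  ultimately show "\<exists>T. open T \<and> x \<in> T \<and> smooth_fun \<A> T ?f"
    using S K by (metis ComplI open_Compl subsetD)
qed

section \<open>Tangent vectors\<close>

lemma coord_vector_apply: "f \<in> Cinf \<A> \<Longrightarrow> coord_vector \<A> c m v f = chart_deriv c m v f"
  by (simp add: coord_vector_def)

text \<open>Tangent operators see global functions only, so the coordinate functions are cut off by
  a bump function that is 1 near \<open>m\<close>; their derivatives are the coordinates of the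
  vector. This makes the description in \<open>coords\<close> definite.\<close>

lemma coord_vector_eqD:
  assumes "c \<in> \<A>" "m \<in> fst c" "coord_vector \<A> c m v = coord_vector \<A> c m w"
  shows "v = w"
proof -
  obtain \<beta> :: "'m \<Rightarrow> real" and K N where \<beta>: "\<beta> \<in> Cinf \<A>" "closed K" "K \<subseteq> fst c"
    "\<And>x. x \<notin> K \<Longrightarrow> \<beta> x = 0" "open N" "m \<in> N" "N \<subseteq> fst c" "\<And>x. x \<in> N \<Longrightarrow> \<beta> x = 1"
    by (rule smooth_bump_fun[OF open_chart[OF assms(1)] assms(2)]) (rule that)
  have "coord b v = coord b w" for b
  proof -
    let ?l = "\<lambda>x. coord b (snd c x)"
    let ?f = "\<lambda>x. if x \<in> fst c then \<beta> x *\<^sub>R ?l x else 0"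
    have l: "smooth_fun \<A> (fst c) ?l"
      by (rule smooth_fun_bounded_linear[OF open_chart bounded_linear_coord[OF finite_dimensional_model]
            smooth_fun_chart]) (fact assms)+
    have f: "?f \<in> Cinf \<A>"
      unfolding Cinf_iff by (rule smooth_fun_extend_zero[OF open_chart l \<beta>(2-4,1)]) (fact assms)
    have "chart_deriv c m u ?f = coord b u" for u
    proof -
      have "(snd c \<circ> inv_into (fst c) (snd c) has_derivative (\<lambda>v. v)) (at (snd c m))"
        by (rule has_derivative_transform_within_open[OF has_derivative_ident
              open_chart_range[OF assms(1)]]) (use assms chart_inv in auto)
      then have id: "chart_deriv c m u (snd c) = u" by (rule chart_deriv_eqI)
      have "chart_deriv c m u ?f = chart_deriv c m u ?l"
        by (rule chart_deriv_cong[OF assms(1,2) \<beta>(6,5) Cinf_smooth_fun[OF f]]) (use \<beta> in auto)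
      also have "\<dots> = coord b (chart_deriv c m u (snd c))"
        by (rule chart_deriv_bounded_linear[OF assms(1,2,2) open_chart bounded_linear_coord[OF finite_dimensional_model] smooth_fun_chart])
          (fact assms)+
      finally show ?thesis by (simp add: id)
    qed
    then show ?thesis
      using fun_cong[OF assms(3), of ?f] f by (simp add: coord_vector_apply)
  qed
  then have "(\<Sum>b\<in>fin_basis. coord b v *\<^sub>R b) = (\<Sum>b\<in>fin_basis. coord b w *\<^sub>R b)"
    by simp
  then show ?thesis
    by (simp add: coord_sum[OF finite_dimensional_model])
qed

lemma coords_coord_vector:
  "c \<in> \<A> \<Longrightarrow> m \<in> fst c \<Longrightarrow> coords \<A> c (m, coord_vector \<A> c m v) = v"
  unfolding coords_def
proof (rule the_equality)
  show "w = v" if "c \<in> \<A>" "m \<in> fst c" "snd (m, coord_vector \<A> c m v)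
      = coord_vector \<A> c (fst (m, coord_vector \<A> c m v)) w" for w
    using coord_vector_eqD[OF that(1,2)] that(3) by simp
qed simp

lemma coord_vector_change:
  assumes "c \<in> \<A>" "m \<in> fst c" "c' \<in> \<A>" "m \<in> fst c'"
  shows "coord_vector \<A> c m v = coord_vector \<A> c' m (chart_deriv c m v (snd c'))"
  unfolding coord_vector_def
proof (rule restrict_ext)
  show "chart_deriv c m v f = chart_deriv c' m (chart_deriv c m v (snd c')) f" if "f \<in> Cinf \<A>" for f
    using chart_deriv_change[OF assms(1,2) UNIV_I open_UNIV assms(3,4)] that
    unfolding Cinf_iff by blast
qed

abbreviation "TM \<equiv> tangent_bundle \<A>"

text \<open>A tangent vector comes with some chart; the change of coordinates rewrites it in any
  chart around \<open>m\<close>.\<close>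

lemma tangent_eq_coord_vector:
  assumes "(m, X) \<in> total TM" "c \<in> \<A>" "m \<in> fst c"
  shows "X = coord_vector \<A> c m (coords \<A> c (m, X))"
proof -
  obtain c' v where c': "c' \<in> \<A>" "m \<in> fst c'" "X = coord_vector \<A> c' m v"
    using assms(1) by (auto simp: tangent_bundle_def)
  then have "X = coord_vector \<A> c m (chart_deriv c' m v (snd c))"
    using coord_vector_change assms by blast
  then show ?thesis using coords_coord_vector assms by simp
qed

lemma tangent_apply:
  assumes "(m, X) \<in> total TM" "c \<in> \<A>" "m \<in> fst c" "f \<in> Cinf \<A>"
  shows "X f = chart_deriv c m (coords \<A> c (m, X)) f"
  using tangent_eq_coord_vector[OF assms(1-3)] coord_vector_apply[OF assms(4)] by metis

lemma tangent_extensional: "(m, X) \<in> total TM \<Longrightarrow> X \<in> extensional (Cinf \<A>)"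
  by (auto simp: tangent_bundle_def coord_vector_def)

context
  fixes m :: 'm and X
  assumes X: "(m, X) \<in> total TM"
begin

lemma tangent_plus: "f \<in> Cinf \<A> \<Longrightarrow> g \<in> Cinf \<A> \<Longrightarrow> X (\<lambda>x. f x + g x) = X f + X g"
  and tangent_mult: "f \<in> Cinf \<A> \<Longrightarrow> g \<in> Cinf \<A> \<Longrightarrow> X (\<lambda>x. f x * g x) = f m * X g + X f * g m"
  and tangent_const: "X (\<lambda>_. k) = 0"
proof -
  obtain c where c: "c \<in> \<A>" "m \<in> fst c" using chart_at by blast
  note d = tangent_apply[OF X c]
  show "X (\<lambda>_. k) = 0" by (simp add: d Cinf_const chart_deriv_const)
  assume fg: "f \<in> Cinf \<A>" "g \<in> Cinf \<A>"
  then show "X (\<lambda>x. f x + g x) = X f + X g"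
    by (simp add: d Cinf_add chart_deriv_plus[OF c UNIV_I open_UNIV] Cinf_smooth_fun)
  from fg show "X (\<lambda>x. f x * g x) = f m * X g + X f * g m"
    by (simp add: d Cinf_mult chart_deriv_bilinear[OF c UNIV_I open_UNIV bounded_bilinear_mult] Cinf_smooth_fun)
qed

lemma tangent_cmult: "f \<in> Cinf \<A> \<Longrightarrow> X (\<lambda>x. k * f x) = k * X f"
  by (simp add: tangent_mult tangent_const Cinf_const)

lemma tangent_sum:
  "(\<And>i. i \<in> I \<Longrightarrow> f i \<in> Cinf \<A>) \<Longrightarrow> X (\<lambda>x. \<Sum>i\<in>I. f i x) = (\<Sum>i\<in>I. X (f i))"
  by (induction I rule: infinite_finite_induct)
    (simp_all add: tangent_const tangent_plus Cinf_sum)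

end

section \<open>Sections\<close>

text \<open>Separates charts of the base from trivialisations, so that \<open>smooth_map\<close> for
  total spaces unfolds to one condition per chart and trivialisation.\<close>

lemma ball_total_atlas:
  "(\<forall>d \<in> total_atlas \<A> E. P d) \<longleftrightarrow> (\<forall>c' \<in> \<A>. \<forall>t \<in> trivs E.
     P ({e \<in> total E. proj E e \<in> fst c' \<inter> fst t}, \<lambda>e. (snd c' (proj E e), snd t e)))"
  (is "?L \<longleftrightarrow> ?R")
proof (intro iffI ballI)
  fix c' t assume ?L and c': "c' \<in> \<A>" "t \<in> trivs E"
  have "({e \<in> total E. proj E e \<in> fst c' \<inter> fst t}, \<lambda>e. (snd c' (proj E e), snd t e)) \<in> total_atlas \<A> E"
    unfolding total_atlas_def mem_Collect_eq using c'
    by (intro exI[of _ "fst c'"] exI[of _ "snd c'"] exI[of _ "fst t"] exI[of _ "snd t"]) simp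
  then show "P ({e \<in> total E. proj E e \<in> fst c' \<inter> fst t}, \<lambda>e. (snd c' (proj E e), snd t e))"
    by (rule bspec[OF \<open>?L\<close>])
next
  fix d assume R: ?R and "d \<in> total_atlas \<A> E"
  then obtain U \<phi> W \<psi> where d: "(U, \<phi>) \<in> \<A>" "(W, \<psi>) \<in> trivs E"
    "d = ({e \<in> total E. proj E e \<in> U \<inter> W}, \<lambda>e. (\<phi> (proj E e), \<psi> e))"
    unfolding total_atlas_def mem_Collect_eq by (elim exE conjE) (rule that)
  show "P d"
    using R[THEN bspec, OF d(1), THEN bspec, OF d(2)] by (simp only: d(3) fst_conv snd_conv)
qed

text \<open>The base component of a section in coordinates is a coordinate change, hence smooth; the
  fibre component carries the whole condition. Only openness of the trivialising sets is assumed, so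
  the criterion serves \<open>TM\<close> and \<open>G\<close> as well as \<open>E\<close>.\<close>

lemma sections_iff:
  assumes "\<And>W \<psi>. (W, \<psi>) \<in> trivs E \<Longrightarrow> open W"
  shows "s \<in> sections \<A> E \<longleftrightarrow>
    (\<forall>m. s m \<in> fibre E m) \<and> (\<forall>(W, \<psi>) \<in> trivs E. smooth_fun \<A> W (\<lambda>m. \<psi> (s m)))"
proof (cases "\<forall>m. s m \<in> fibre E m")
  case True
  then have s: "proj E (s m) = m" "s m \<in> total E" for m
    unfolding fibre_def by blast+
  have vimage: "s -` {e \<in> total E. proj E e \<in> U \<inter> W} = U \<inter> W" for U W
    using s by auto
  have "smooth_map \<A> (total_atlas \<A> E) s \<longleftrightarrow>
    (\<forall>c \<in> \<A>. \<forall>c' \<in> \<A>. \<forall>(W, \<psi>) \<in> trivs E. open (snd c ` (fst c \<inter> (fst c' \<inter> W))) \<and>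
      smooth_on (snd c ` (fst c \<inter> (fst c' \<inter> W)))
        (\<lambda>y. ((snd c' \<circ> inv_into (fst c) (snd c)) y, ((\<lambda>m. \<psi> (s m)) \<circ> inv_into (fst c) (snd c)) y)))"
    (is "_ \<longleftrightarrow> ?R")
    unfolding smooth_map_def ball_total_atlas split_beta fst_conv snd_conv vimage comp_def s ..
  also have "?R \<longleftrightarrow> (\<forall>(W, \<psi>) \<in> trivs E. smooth_fun \<A> W (\<lambda>m. \<psi> (s m)))"
  proof (intro iffI)
    assume R: ?R
    show "\<forall>(W, \<psi>) \<in> trivs E. smooth_fun \<A> W (\<lambda>m. \<psi> (s m))"
      unfolding smooth_fun_def
    proof (safe)
      fix W \<psi> U \<phi> assume W: "(W, \<psi>) \<in> trivs E" and c: "(U, \<phi>) \<in> \<A>"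
      \<comment> \<open>With the target chart equal to the source chart the set becomes
        \<open>U \<inter> W\<close>, as \<open>smooth_fun\<close> requires.\<close>
      have "smooth_on (\<phi> ` (U \<inter> (U \<inter> W)))
        (\<lambda>y. ((\<phi> \<circ> inv_into U \<phi>) y, ((\<lambda>m. \<psi> (s m)) \<circ> inv_into U \<phi>) y))"
        using R[THEN bspec, OF c, THEN bspec, OF c, THEN bspec, OF W] by simp
      moreover have "open (\<phi> ` (U \<inter> (U \<inter> W)))"
        using open_chart_image_Int[OF c assms[OF W]] by simp
      ultimately have "smooth_on (\<phi> ` (U \<inter> (U \<inter> W)))
        (\<lambda>y. snd ((\<phi> \<circ> inv_into U \<phi>) y, ((\<lambda>m. \<psi> (s m)) \<circ> inv_into U \<phi>) y))"
        by (intro smooth_on_bounded_linear[OF _ bounded_linear_snd])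
      then show "smooth_on (snd (U, \<phi>) ` (fst (U, \<phi>) \<inter> W))
          ((\<lambda>m. \<psi> (s m)) \<circ> inv_into (fst (U, \<phi>)) (snd (U, \<phi>)))"
        by (simp add: comp_def)
    qed
  next
    assume sm: "\<forall>(W, \<psi>) \<in> trivs E. smooth_fun \<A> W (\<lambda>m. \<psi> (s m))"
    show ?R
    proof (intro ballI, clarify)
      fix c c' W \<psi>
      assume c: "c \<in> \<A>" "c' \<in> \<A>" and W: "(W, \<psi>) \<in> trivs E"
      let ?S = "snd c ` (fst c \<inter> (fst c' \<inter> W))"
      have "open ?S"
        using c assms[OF W] open_chart by (intro open_chart_image_Int open_Int) auto
      moreover have "smooth_on ?S (snd c' \<circ> inv_into (fst c) (snd c))"
        by (rule smooth_on_subset[OF smooth_chart_change[OF c]]) auto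
      moreover have "smooth_on ?S ((\<lambda>m. \<psi> (s m)) \<circ> inv_into (fst c) (snd c))"
      proof (rule smooth_on_subset)
        show "smooth_on (snd c ` (fst c \<inter> W)) ((\<lambda>m. \<psi> (s m)) \<circ> inv_into (fst c) (snd c))"
          using bspec[OF sm W] c(1) by (simp add: smooth_fun_def)
      qed auto
      ultimately show "open ?S \<and> smooth_on ?S (\<lambda>y. ((snd c' \<circ> inv_into (fst c) (snd c)) y,
          ((\<lambda>m. \<psi> (s m)) \<circ> inv_into (fst c) (snd c)) y))"
        by (intro conjI smooth_on_Pair)
    qed
  qed
  finally show ?thesis using True by (simp add: sections_def)
qed (auto simp: sections_def)

end

section \<open>Vector bundles\<close>

definition triv_inv :: "('m, 'v, 'f, 'z) vbundle_scheme \<Rightarrow> ('v \<Rightarrow> 'f) \<Rightarrow> 'm \<Rightarrow> 'f \<Rightarrow> 'v" where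
  "triv_inv E \<psi> m = inv_into (fibre E m) \<psi>"

text \<open>The record has no field for the zero vectors; they are recovered as 0 times an arbitrary
  element of the fibre.\<close>

definition zero_sec :: "('m, 'v, 'f, 'z) vbundle_scheme \<Rightarrow> 'm \<Rightarrow> 'v" where
  "zero_sec E m = vscale E 0 (SOME e. e \<in> fibre E m)"

text \<open>The section that is constantly \<open>w\<close> in a trivialisation, cut off by
  \<open>\<beta>\<close> and extended by zero. For \<open>w\<close> in a basis of the typical fibre
  these form the cut-off frame.\<close>

definition frame_sec :: "('m, 'v, 'f::real_vector, 'z) vbundle_scheme \<Rightarrow> 'm set \<Rightarrow> ('v \<Rightarrow> 'f)
    \<Rightarrow> ('m \<Rightarrow> real) \<Rightarrow> 'f \<Rightarrow> 'm \<Rightarrow> 'v" where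
  "frame_sec E W \<psi> \<beta> w m = (if m \<in> W then triv_inv E \<psi> m (\<beta> m *\<^sub>R w) else zero_sec E m)"

locale smooth_bundle = manifold \<A>
  for \<A> :: "('m::{t2_space,second_countable_topology}, 'e::real_normed_vector) atlas" +
  fixes E :: "('m, 'v, 'f::real_normed_vector, 'z) vbundle_scheme"
  assumes vector_bundle: "vector_bundle \<A> E"
begin

lemma finite_dimensional_fibre: "finite_dimensional TYPE('f)"
  using vector_bundle unfolding vector_bundle_def by blast

lemma triv_at:
  obtains W \<psi> where "(W, \<psi>) \<in> trivs E" "m \<in> W"
proof -
  have "m \<in> (\<Union>(W, \<psi>) \<in> trivs E. W)"
    using vector_bundle unfolding vector_bundle_def by simp
  then show thesis using that by force
qed

lemma open_triv: "(W, \<psi>) \<in> trivs E \<Longrightarrow> open W"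
  using vector_bundle unfolding vector_bundle_def by fast

lemma triv_fibre:
  assumes "(W, \<psi>) \<in> trivs E" "m \<in> W"
  shows "bij_betw \<psi> (fibre E m) UNIV"
    "\<forall>x \<in> fibre E m. \<forall>y \<in> fibre E m. vadd E x y \<in> fibre E m \<and> \<psi> (vadd E x y) = \<psi> x + \<psi> y"
    "\<forall>c. \<forall>x \<in> fibre E m. vscale E c x \<in> fibre E m \<and> \<psi> (vscale E c x) = c *\<^sub>R \<psi> x"
proof -
  have "\<forall>(W, \<psi>) \<in> trivs E. open W \<and> (\<forall>m \<in> W.
        bij_betw \<psi> (fibre E m) UNIV \<and>
        (\<forall>x \<in> fibre E m. \<forall>y \<in> fibre E m.
           vadd E x y \<in> fibre E m \<and> \<psi> (vadd E x y) = \<psi> x + \<psi> y) \<and>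
        (\<forall>c. \<forall>x \<in> fibre E m.
           vscale E c x \<in> fibre E m \<and> \<psi> (vscale E c x) = c *\<^sub>R \<psi> x))"
    using vector_bundle unfolding vector_bundle_def by (elim conjE)
  from bspec[OF this assms(1)] assms(2) show "bij_betw \<psi> (fibre E m) UNIV"
    "\<forall>x \<in> fibre E m. \<forall>y \<in> fibre E m. vadd E x y \<in> fibre E m \<and> \<psi> (vadd E x y) = \<psi> x + \<psi> y"
    "\<forall>c. \<forall>x \<in> fibre E m. vscale E c x \<in> fibre E m \<and> \<psi> (vscale E c x) = c *\<^sub>R \<psi> x"
    by simp_all
qed

lemma vadd_fibre: "x \<in> fibre E m \<Longrightarrow> y \<in> fibre E m \<Longrightarrow> vadd E x y \<in> fibre E m"
  and vscale_fibre: "x \<in> fibre E m \<Longrightarrow> vscale E k x \<in> fibre E m"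
  using triv_at[of m] triv_fibre(2,3)[of _ _ m] by metis+

lemma fibre_nonempty: "\<exists>e. e \<in> fibre E m"
  using triv_at[of m] triv_fibre(1)[of _ _ m] by (metis UNIV_I bij_betw_imp_surj_on imageE)

lemma zero_sec_fibre: "zero_sec E m \<in> fibre E m"
  unfolding zero_sec_def by (rule vscale_fibre[OF someI_ex[OF fibre_nonempty]])

context
  fixes W \<psi> m
  assumes W: "(W, \<psi>) \<in> trivs E" "m \<in> W"
begin

lemma triv_add: "x \<in> fibre E m \<Longrightarrow> y \<in> fibre E m \<Longrightarrow> \<psi> (vadd E x y) = \<psi> x + \<psi> y"
  and triv_scale: "x \<in> fibre E m \<Longrightarrow> \<psi> (vscale E k x) = k *\<^sub>R \<psi> x"
  using triv_fibre[OF W] by auto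

lemma triv_inj: "x \<in> fibre E m \<Longrightarrow> y \<in> fibre E m \<Longrightarrow> \<psi> x = \<psi> y \<Longrightarrow> x = y"
  using triv_fibre(1)[OF W] by (auto simp: bij_betw_def dest: inj_onD)

lemma triv_diff:
  "x \<in> fibre E m \<Longrightarrow> y \<in> fibre E m \<Longrightarrow> \<psi> (vadd E x (vscale E (- 1) y)) = \<psi> x - \<psi> y"
  by (simp add: triv_add triv_scale vscale_fibre)

lemma triv_inv_fibre: "triv_inv E \<psi> m w \<in> fibre E m"
  and triv_triv_inv: "\<psi> (triv_inv E \<psi> m w) = w"
  using triv_fibre(1)[OF W] unfolding triv_inv_def
  by (metis UNIV_I bij_betw_imp_surj_on inv_into_into, metis UNIV_I bij_betw_inv_into_right)

lemma triv_inv_triv: "x \<in> fibre E m \<Longrightarrow> triv_inv E \<psi> m (\<psi> x) = x"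
  by (intro triv_inj triv_inv_fibre triv_triv_inv)

lemma triv_zero_sec: "\<psi> (zero_sec E m) = 0"
  unfolding zero_sec_def using someI_ex[OF fibre_nonempty] by (simp add: triv_scale)

text \<open>Transitions are linear on a fibre, so a linear relation seen in one trivialisation is
  seen in all. The empty sum transfers the vanishing of a vector.\<close>

lemma triv_sum_transfer:
  assumes W': "(W', \<psi>') \<in> trivs E" "m \<in> W'"
    and x: "x \<in> fibre E m" and y: "\<And>i. i \<in> I \<Longrightarrow> y i \<in> fibre E m"
    and eq: "\<psi> x = (\<Sum>i\<in>I. a i *\<^sub>R \<psi> (y i))"
  shows "\<psi>' x = (\<Sum>i\<in>I. a i *\<^sub>R \<psi>' (y i))"
proof -
  
  have lin: "linear (\<lambda>w. \<psi>' (triv_inv E \<psi> m w))"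
  proof (rule linearI)
    fix u w k
    have "triv_inv E \<psi> m (u + w) = vadd E (triv_inv E \<psi> m u) (triv_inv E \<psi> m w)"
      by (rule triv_inj) (simp_all add: triv_inv_fibre vadd_fibre triv_triv_inv triv_add)
    then show "\<psi>' (triv_inv E \<psi> m (u + w)) = \<psi>' (triv_inv E \<psi> m u) + \<psi>' (triv_inv E \<psi> m w)"
      using triv_fibre(2)[OF W'] by (simp add: triv_inv_fibre)
    have "triv_inv E \<psi> m (k *\<^sub>R w) = vscale E k (triv_inv E \<psi> m w)"
      by (rule triv_inj) (simp_all add: triv_inv_fibre vscale_fibre triv_triv_inv triv_scale)
    then show "\<psi>' (triv_inv E \<psi> m (k *\<^sub>R w)) = k *\<^sub>R \<psi>' (triv_inv E \<psi> m w)"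
      using triv_fibre(3)[OF W'] by (simp add: triv_inv_fibre)
  qed
  have "\<psi>' x = \<psi>' (triv_inv E \<psi> m (\<Sum>i\<in>I. a i *\<^sub>R \<psi> (y i)))"
    by (simp flip: eq add: triv_inv_triv[OF x])
  also have "\<dots> = (\<Sum>i\<in>I. a i *\<^sub>R \<psi>' (triv_inv E \<psi> m (\<psi> (y i))))"
    by (simp add: linear_sum[OF lin] linear_cmul[OF lin])
  finally show ?thesis using y by (simp add: triv_inv_triv)
qed

end

text \<open>The smoothness axiom of the bundle concerns the total space: in coordinates it makes the
  transition \<open>?G\<close> jointly smooth in base point and fibre vector. Composition with the
  graph of \<open>w\<close> gives the claim.\<close>

lemma smooth_fun_transition:
  assumes W: "(W, \<psi>) \<in> trivs E" "(W', \<psi>') \<in> trivs E"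
    and S: "open S" "S \<subseteq> W \<inter> W'" and w: "smooth_fun \<A> S w"
  shows "smooth_fun \<A> S (\<lambda>m. \<psi>' (triv_inv E \<psi> m (w m)))"
proof (rule smooth_fun_local)
  fix m assume "m \<in> S"
  obtain c where c: "c \<in> \<A>" "m \<in> fst c" using chart_at .
  let ?S = "fst c \<inter> S" and ?i = "inv_into (fst c) (snd c)"
  let ?D = "\<lambda>W. {e \<in> total E. proj E e \<in> fst c \<inter> W}"
  let ?T = "\<lambda>\<psi> e. (snd c (proj E e), \<psi> e)"
  let ?R = "?T \<psi> ` (?D W \<inter> (\<lambda>e. e) -` ?D W')"
  let ?G = "?T \<psi>' \<circ> (\<lambda>e. e) \<circ> inv_into (?D W) (?T \<psi>)"
  have "smooth_map (total_atlas \<A> E) (total_atlas \<A> E) (\<lambda>e. e)"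
    using vector_bundle unfolding vector_bundle_def by blast
  then have G: "open ?R" "smooth_on ?R ?G"
    unfolding smooth_map_def ball_total_atlas split_beta fst_conv snd_conv
    using c(1) W by fastforce+
  have fib: "triv_inv E \<psi> x u \<in> fibre E x" if "x \<in> W" for x u
    using triv_inv_fibre W that by blast
  have inR: "(snd c x, u) \<in> ?R" if "x \<in> ?S" for x u
    using that subsetD[OF S(2), of x] fib[of x u] triv_triv_inv[OF W(1), of x u]
    by (intro image_eqI[of _ _ "triv_inv E \<psi> x u"]) (auto simp: fibre_def)
  have inj: "inj_on (?T \<psi>) (?D W)"
  proof (rule inj_onI)
    fix e e' assume e: "e \<in> ?D W" "e' \<in> ?D W" "?T \<psi> e = ?T \<psi> e'"
    then have "proj E e = proj E e'"
      using chart_inv[OF c(1)] by (metis (no_types, lifting) IntD1 mem_Collect_eq prod.inject)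
    then show "e = e'"
      using e triv_inj[OF W(1), of "proj E e" e e'] by (auto simp: fibre_def)
  qed
  have val: "snd (?G (snd c x, u)) = \<psi>' (triv_inv E \<psi> x u)" if "x \<in> ?S" for x u
  proof -
    have "inv_into (?D W) (?T \<psi>) (snd c x, u) = triv_inv E \<psi> x u"
      using that subsetD[OF S(2), of x] fib[of x u] triv_triv_inv[OF W(1), of x u]
      by (intro inv_into_f_eq[OF inj]) (auto simp: fibre_def)
    then show ?thesis by simp
  qed
  have S': "open ?S" using S(1) open_chart[OF c(1)] by blast
  have im: "open (snd c ` ?S)" using open_chart_image_Int[OF c(1) S(1)] .
  have "smooth_on (snd c ` ?S) (\<lambda>y. (y, (w \<circ> ?i) y))"
    using w c(1) by (intro smooth_on_Pair[OF im] smooth_on_id[OF im]) (simp add: smooth_fun_def comp_def)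
  then have "smooth_on (snd c ` ?S) (\<lambda>y. ?G (y, (w \<circ> ?i) y))"
    by (rule smooth_on_compose[OF im finite_dimensional_prod[OF finite_dimensional_model finite_dimensional_fibre] G(2) _ G(1)])
      (elim imageE, simp only: inR)
  then have "smooth_on (snd c ` ?S) (\<lambda>y. snd (?G (y, (w \<circ> ?i) y)))"
    by (rule smooth_on_bounded_linear[OF im bounded_linear_snd])
  then have "smooth_on (snd c ` ?S) ((\<lambda>m. \<psi>' (triv_inv E \<psi> m (w m))) \<circ> ?i)"
  proof (rule smooth_on_cong[OF im])
    fix y assume "y \<in> snd c ` ?S"
    then obtain x where x: "x \<in> ?S" "y = snd c x" by blast
    then have "?i y = x" using chart_inv[OF c(1)] by blast
    then show "snd (?G (y, (w \<circ> ?i) y)) = ((\<lambda>m. \<psi>' (triv_inv E \<psi> m (w m))) \<circ> ?i) y"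
      using val[OF x(1), of "w x"] x(2) by simp
  qed
  then have "smooth_fun \<A> ?S (\<lambda>m. \<psi>' (triv_inv E \<psi> m (w m)))"
    by (intro smooth_funI_chart[OF c(1) S']) auto
  then show "\<exists>T. open T \<and> m \<in> T \<and> smooth_fun \<A> T (\<lambda>m. \<psi>' (triv_inv E \<psi> m (w m)))"
    using S' c(2) \<open>m \<in> S\<close> by blast
qed

section \<open>The module of smooth sections\<close>

lemma section_iff: "s \<in> sections \<A> E \<longleftrightarrow>
    (\<forall>m. s m \<in> fibre E m) \<and> (\<forall>(W, \<psi>) \<in> trivs E. smooth_fun \<A> W (\<lambda>m. \<psi> (s m)))"
  by (rule sections_iff) (rule open_triv)

lemma sectionI:
  assumes "\<And>m. s m \<in> fibre E m"
    and "\<And>W \<psi>. (W, \<psi>) \<in> trivs E \<Longrightarrow> smooth_fun \<A> W (\<lambda>m. \<psi> (s m))"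
  shows "s \<in> sections \<A> E"
  unfolding section_iff using assms by (auto split: prod.split)

lemma section_fibre: "s \<in> sections \<A> E \<Longrightarrow> s m \<in> fibre E m"
  by (simp add: sections_def)

lemma section_smooth: "s \<in> sections \<A> E \<Longrightarrow> (W, \<psi>) \<in> trivs E \<Longrightarrow> smooth_fun \<A> W (\<lambda>m. \<psi> (s m))"
  using section_iff[of s] by fastforce

lemma section_eqI:
  assumes "\<And>m. s m \<in> fibre E m" "\<And>m. t m \<in> fibre E m"
    and "\<And>m. \<exists>W \<psi>. (W, \<psi>) \<in> trivs E \<and> m \<in> W \<and> \<psi> (s m) = \<psi> (t m)"
  shows "s = t"
proof
  fix m
  obtain W \<psi> where "(W, \<psi>) \<in> trivs E" "m \<in> W" "\<psi> (s m) = \<psi> (t m)" using assms(3)[of m] by blast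
  then show "s m = t m" by (intro triv_inj[of W \<psi> m] assms(1,2))
qed

lemma sec_add_section:
  assumes "s \<in> sections \<A> E" "t \<in> sections \<A> E"
  shows "sec_add E s t \<in> sections \<A> E"
proof (rule sectionI)
  show "sec_add E s t m \<in> fibre E m" for m
    using assms by (simp add: sec_add_def vadd_fibre section_fibre)
  fix W \<psi> assume W: "(W, \<psi>) \<in> trivs E"
  have "smooth_fun \<A> W (\<lambda>m. \<psi> (s m) + \<psi> (t m))"
    using assms W by (intro smooth_fun_add[OF open_triv] section_smooth)
  then show "smooth_fun \<A> W (\<lambda>m. \<psi> (sec_add E s t m))"
    by (rule smooth_fun_cong[OF open_triv[OF W]])
      (use assms in \<open>simp add: sec_add_def triv_add[OF W] section_fibre\<close>)
qed

lemma sec_scale_section: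
  assumes "f \<in> Cinf \<A>" "s \<in> sections \<A> E"
  shows "sec_scale E f s \<in> sections \<A> E"
proof (rule sectionI)
  show "sec_scale E f s m \<in> fibre E m" for m
    using assms by (simp add: sec_scale_def vscale_fibre section_fibre)
  fix W \<psi> assume W: "(W, \<psi>) \<in> trivs E"
  have "smooth_fun \<A> W (\<lambda>m. f m *\<^sub>R \<psi> (s m))"
    using assms W by (intro smooth_fun_scaleR[OF open_triv] section_smooth Cinf_smooth_fun)
  then show "smooth_fun \<A> W (\<lambda>m. \<psi> (sec_scale E f s m))"
    by (rule smooth_fun_cong[OF open_triv[OF W]])
      (use assms in \<open>simp add: sec_scale_def triv_scale[OF W] section_fibre\<close>)
qed

lemma zero_sec_section: "zero_sec E \<in> sections \<A> E"
proof (rule sectionI)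
  fix W \<psi> assume W: "(W, \<psi>) \<in> trivs E"
  show "smooth_fun \<A> W (\<lambda>m. \<psi> (zero_sec E m))"
    by (rule smooth_fun_cong[OF open_triv[OF W] smooth_fun_const[OF open_triv[OF W], of 0]])
      (simp add: triv_zero_sec[OF W])
qed (rule zero_sec_fibre)

section \<open>Cut-off frames\<close>

context
  fixes W \<psi> \<beta> K
  assumes W: "(W, \<psi>) \<in> trivs E"
    and \<beta>: "\<beta> \<in> Cinf \<A>" and K: "closed K" "K \<subseteq> W" "\<And>x. x \<notin> K \<Longrightarrow> \<beta> x = 0"
begin

lemma triv_frame_sec: "m \<in> W \<Longrightarrow> \<psi> (frame_sec E W \<psi> \<beta> w m) = \<beta> m *\<^sub>R w"
  by (simp add: frame_sec_def triv_triv_inv[OF W])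

lemma frame_sec_fibre: "frame_sec E W \<psi> \<beta> w m \<in> fibre E m"
  by (simp add: frame_sec_def zero_sec_fibre triv_inv_fibre[OF W])

text \<open>In another trivialisation over \<open>W'\<close> the section is smooth on
  \<open>W' \<inter> W\<close> as a transition of a smooth function, and zero on
  \<open>W' - K\<close>; these two open sets cover \<open>W'\<close>.\<close>

lemma frame_sec_section: "frame_sec E W \<psi> \<beta> w \<in> sections \<A> E"
proof (rule sectionI[OF frame_sec_fibre])
  let ?s = "frame_sec E W \<psi> \<beta> w"
  fix W' \<psi>' assume W': "(W', \<psi>') \<in> trivs E"
  show "smooth_fun \<A> W' (\<lambda>m. \<psi>' (?s m))"
  proof (rule smooth_fun_local)
    fix m assume m: "m \<in> W'"
    have o: "open (W' \<inter> W)" "open (W' \<inter> - K)"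
      using open_triv[OF W] open_triv[OF W'] K(1) by auto
    have "smooth_fun \<A> (W' \<inter> W) (\<lambda>m. \<psi>' (triv_inv E \<psi> m (\<beta> m *\<^sub>R w)))"
      using Cinf_smooth_fun[OF \<beta>]
      by (intro smooth_fun_transition[OF W W' o(1)] smooth_fun_scaleR[OF o(1)] smooth_fun_const[OF o(1)]) auto
    then have 1: "smooth_fun \<A> (W' \<inter> W) (\<lambda>m. \<psi>' (?s m))"
      by (rule smooth_fun_cong[OF o(1)]) (simp add: frame_sec_def)
    have "\<psi>' (?s x) = 0" if "x \<in> W' \<inter> - K" for x
    proof (cases "x \<in> W")
      case True
      then have "\<psi> (?s x) = (\<Sum>i\<in>{}. 0 *\<^sub>R \<psi> (?s x))" using that K(3) by (simp add: triv_frame_sec)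
      then show ?thesis
        using triv_sum_transfer[OF W True W', of "?s x" "{}"] that frame_sec_fibre by simp
    next
      case False
      then show ?thesis using that by (simp add: frame_sec_def triv_zero_sec[OF W'])
    qed
    then have 2: "smooth_fun \<A> (W' \<inter> - K) (\<lambda>m. \<psi>' (?s m))"
      by (intro smooth_fun_cong[OF o(2) smooth_fun_const[OF o(2), of 0]]) simp
    show "\<exists>T. open T \<and> m \<in> T \<and> smooth_fun \<A> T (\<lambda>m. \<psi>' (?s m))"
    proof (cases "m \<in> W")
      case True
      then show ?thesis using o(1) 1 m by blast
    next
      case False
      then have "m \<in> W' \<inter> - K" using K(2) m by blast
      then show ?thesis using o(2) 2 by blast
    qed
  qed
qed

end

section \<open>Vector fields\<close>

lemma tangent_bundle_trivs: "trivs TM = {(fst c, coords \<A> c) | c. c \<in> \<A>}"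
  by (simp add: tangent_bundle_def)

lemma fibre_tangent: "t \<in> fibre TM m \<longleftrightarrow> fst t = m \<and> t \<in> total TM"
  by (auto simp: fibre_def tangent_bundle_def)

lemma fibre_tangentD: "t \<in> fibre TM m \<Longrightarrow> t = (m, snd t)" "t \<in> fibre TM m \<Longrightarrow> (m, snd t) \<in> total TM"
  unfolding fibre_tangent by (metis prod.collapse)+

lemma vector_field_iff:
  "X \<in> sections \<A> TM \<longleftrightarrow>
    (\<forall>m. X m \<in> fibre TM m) \<and> (\<forall>c\<in>\<A>. smooth_fun \<A> (fst c) (\<lambda>m. coords \<A> c (X m)))"
proof -
  have "open W" if W: "(W, \<psi>) \<in> trivs TM" for W \<psi>
  proof -
    obtain c where "c \<in> \<A>" "W = fst c"
      using W unfolding tangent_bundle_trivs mem_Collect_eq prod.inject by blast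
    then show ?thesis using open_chart by simp
  qed
  then have "X \<in> sections \<A> TM \<longleftrightarrow>
      (\<forall>m. X m \<in> fibre TM m) \<and> (\<forall>(W, \<psi>) \<in> trivs TM. smooth_fun \<A> W (\<lambda>m. \<psi> (X m)))"
    by (rule sections_iff)
  then show ?thesis
    unfolding tangent_bundle_trivs Setcompr_eq_image by simp
qed

lemma vf_app_chart_deriv:
  assumes "X \<in> sections \<A> TM" "c \<in> \<A>" "m \<in> fst c" "f \<in> Cinf \<A>"
  shows "vf_app X f m = chart_deriv c m (coords \<A> c (X m)) f"
proof -
  have "X m \<in> fibre TM m" using assms(1) vector_field_iff by blast
  note X = fibre_tangentD[OF this]
  show ?thesis
    using tangent_apply[OF X(2) assms(2-4)] X(1) unfolding vf_app_def by simp
qed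

lemma vf_app_Cinf:
  assumes X: "X \<in> sections \<A> TM" and f: "f \<in> Cinf \<A>"
  shows "vf_app X f \<in> Cinf \<A>"
  unfolding Cinf_iff
proof (rule smooth_fun_local)
  fix m
  obtain c where c: "c \<in> \<A>" "m \<in> fst c" using chart_at .
  have "smooth_fun \<A> (fst c) (\<lambda>m. coords \<A> c (X m))"
    using X c(1) unfolding vector_field_iff by blast
  then have "smooth_fun \<A> (fst c) (\<lambda>m. chart_deriv c m (coords \<A> c (X m)) f)"
    by (rule smooth_fun_chart_deriv[OF open_chart[OF c(1)] c(1) subset_refl Cinf_smooth_fun[OF f]])
  then have "smooth_fun \<A> (fst c) (vf_app X f)"
    by (rule smooth_fun_cong[OF open_chart[OF c(1)]])
      (rule vf_app_chart_deriv[OF X c(1) _ f, symmetric])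
  then show "\<exists>T. open T \<and> m \<in> T \<and> smooth_fun \<A> T (vf_app X f)"
    using c open_chart by blast
qed

lemma coord_vector_add:
  assumes "c \<in> \<A>" "m \<in> fst c"
  shows "coord_vector \<A> c m (v + w) = (\<lambda>f\<in>Cinf \<A>. coord_vector \<A> c m v f + coord_vector \<A> c m w f)"
  unfolding coord_vector_def
  using linear_add[OF chart_deriv_linear[OF assms UNIV_I open_UNIV Cinf_smooth_fun]]
  by (intro restrict_ext) simp

lemma coord_vector_scale:
  assumes "c \<in> \<A>" "m \<in> fst c"
  shows "coord_vector \<A> c m (r *\<^sub>R v) = (\<lambda>f\<in>Cinf \<A>. r * coord_vector \<A> c m v f)"
  unfolding coord_vector_def
  using linear_cmul[OF chart_deriv_linear[OF assms UNIV_I open_UNIV Cinf_smooth_fun]]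
  by (intro restrict_ext) simp

lemma tangent_coordsE:
  assumes "c \<in> \<A>" "m \<in> fst c" "t \<in> fibre TM m"
  obtains v where "t = (m, coord_vector \<A> c m v)" "coords \<A> c t = v"
proof
  note t = fibre_tangentD[OF assms(3)]
  have "snd t = coord_vector \<A> c m (coords \<A> c (m, snd t))"
    by (rule tangent_eq_coord_vector[OF t(2) assms(1,2)])
  then show "t = (m, coord_vector \<A> c m (coords \<A> c t))"
    using t(1) by metis
qed simp

lemma coords_vadd:
  assumes c: "c \<in> \<A>" "m \<in> fst c" and t: "t \<in> fibre TM m" "t' \<in> fibre TM m"
  shows "coords \<A> c (vadd TM t t') = coords \<A> c t + coords \<A> c t'"
proof -
  obtain v where v: "t = (m, coord_vector \<A> c m v)" "coords \<A> c t = v"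
    using tangent_coordsE[OF c t(1)] .
  obtain v' where v': "t' = (m, coord_vector \<A> c m v')" "coords \<A> c t' = v'"
    using tangent_coordsE[OF c t(2)] .
  have "vadd TM t t' = (m, coord_vector \<A> c m (v + v'))"
    unfolding coord_vector_add[OF c] v(1) v'(1) by (simp add: tangent_bundle_def)
  then show ?thesis by (simp add: coords_coord_vector[OF c] v(2) v'(2))
qed

lemma coords_vscale:
  assumes c: "c \<in> \<A>" "m \<in> fst c" and t: "t \<in> fibre TM m"
  shows "coords \<A> c (vscale TM r t) = r *\<^sub>R coords \<A> c t"
proof -
  obtain v where v: "t = (m, coord_vector \<A> c m v)" "coords \<A> c t = v"
    using tangent_coordsE[OF c t] .
  have "vscale TM r t = (m, coord_vector \<A> c m (r *\<^sub>R v))"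
    unfolding coord_vector_scale[OF c] v(1) by (simp add: tangent_bundle_def)
  then show ?thesis by (simp add: coords_coord_vector[OF c] v(2))
qed

end

context smooth_bundle
begin

section \<open>Local form of derivative endomorphisms\<close>

context
  fixes m :: 'm and d :: "('m \<Rightarrow> 'v) \<Rightarrow> 'v" and X :: "('m \<Rightarrow> real) \<Rightarrow> real"
  assumes \<delta>: "is_deriv_vec \<A> E (m, d, X)"
begin

lemma deriv_vec_tangent: "(m, X) \<in> total TM"
  and deriv_vec_fibre: "s \<in> sections \<A> E \<Longrightarrow> d s \<in> fibre E m"
  and deriv_vec_extensional: "d \<in> extensional (sections \<A> E)"
  using \<delta> unfolding is_deriv_vec_def by (auto simp: PiE_def)

lemma deriv_vec_add:
  assumes "(W, \<psi>) \<in> trivs E" "m \<in> W" "s \<in> sections \<A> E" "t \<in> sections \<A> E"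
  shows "\<psi> (d (sec_add E s t)) = \<psi> (d s) + \<psi> (d t)"
proof -
  have "d (sec_add E s t) = vadd E (d s) (d t)"
    using \<delta> assms(3,4) unfolding is_deriv_vec_def by simp
  then show ?thesis using triv_add[OF assms(1,2)] deriv_vec_fibre assms(3,4) by simp
qed

lemma deriv_vec_leibniz:
  assumes "(W, \<psi>) \<in> trivs E" "m \<in> W" "f \<in> Cinf \<A>" "s \<in> sections \<A> E"
  shows "\<psi> (d (sec_scale E f s)) = f m *\<^sub>R \<psi> (d s) + X f *\<^sub>R \<psi> (s m)"
proof -
  have "d (sec_scale E f s) = vadd E (vscale E (f m) (d s)) (vscale E (X f) (s m))"
    using \<delta> assms(3,4) unfolding is_deriv_vec_def by simp
  then show ?thesis
    using triv_add[OF assms(1,2)] triv_scale[OF assms(1,2)] deriv_vec_fibre assms(4)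
    by (simp add: vscale_fibre section_fibre)
qed

text \<open>The combination is built as an honest global section by iterated \<open>sec_add\<close>,
  on which additivity and the Leibniz rule act, and is then identified with \<open>t\<close> fibre
  by fibre. For that comparison one trivialisation at each point is enough.\<close>

lemma deriv_vec_sum:
  assumes "finite I" and f: "\<And>i. i \<in> I \<Longrightarrow> f i \<in> Cinf \<A>" and s: "\<And>i. i \<in> I \<Longrightarrow> s i \<in> sections \<A> E"
    and t: "t \<in> sections \<A> E"
    and eq: "\<And>x. \<exists>W \<psi>. (W, \<psi>) \<in> trivs E \<and> x \<in> W \<and> \<psi> (t x) = (\<Sum>i\<in>I. f i x *\<^sub>R \<psi> (s i x))"
    and W: "(W, \<psi>) \<in> trivs E" "m \<in> W"
  shows "\<psi> (d t) = (\<Sum>i\<in>I. f i m *\<^sub>R \<psi> (d (s i)) + X (f i) *\<^sub>R \<psi> (s i m))"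
proof -
  \<comment> \<open>The values of \<open>t'\<close> are tracked in all trivialisations, since
    \<open>t\<close> is described in an unspecified one at each point.\<close>
  have "\<exists>t'\<in>sections \<A> E.
      (\<forall>W \<psi> x. (W, \<psi>) \<in> trivs E \<longrightarrow> x \<in> W \<longrightarrow> \<psi> (t' x) = (\<Sum>i\<in>I. f i x *\<^sub>R \<psi> (s i x))) \<and>
      \<psi> (d t') = (\<Sum>i\<in>I. f i m *\<^sub>R \<psi> (d (s i)) + X (f i) *\<^sub>R \<psi> (s i m))"
    using assms(1) f s
  proof (induction I)
    case empty
    \<comment> \<open>Written as a multiple of a section, so that the Leibniz rule computes its
      image under \<open>d\<close>.\<close>
    let ?z = "sec_scale E (\<lambda>_. 0) (zero_sec E)"
    have "?z \<in> sections \<A> E" by (intro sec_scale_section Cinf_const zero_sec_section)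
    moreover have "\<psi>' (?z x) = 0" if "(W', \<psi>') \<in> trivs E" "x \<in> W'" for W' \<psi>' x
      using that by (simp add: sec_scale_def triv_scale zero_sec_fibre)
    moreover have "\<psi> (d ?z) = 0"
      using deriv_vec_leibniz[OF W Cinf_const zero_sec_section, of 0] triv_zero_sec[OF W] by simp
    ultimately show ?case by auto
  next
    case (insert j I)
    have "\<exists>t'\<in>sections \<A> E.
      (\<forall>W \<psi> x. (W, \<psi>) \<in> trivs E \<longrightarrow> x \<in> W \<longrightarrow> \<psi> (t' x) = (\<Sum>i\<in>I. f i x *\<^sub>R \<psi> (s i x))) \<and>
      \<psi> (d t') = (\<Sum>i\<in>I. f i m *\<^sub>R \<psi> (d (s i)) + X (f i) *\<^sub>R \<psi> (s i m))"
      by (rule insert.IH) (simp_all add: insert.prems)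
    then obtain t' where t': "t' \<in> sections \<A> E"
      "\<And>W \<psi> x. (W, \<psi>) \<in> trivs E \<Longrightarrow> x \<in> W \<Longrightarrow> \<psi> (t' x) = (\<Sum>i\<in>I. f i x *\<^sub>R \<psi> (s i x))"
      "\<psi> (d t') = (\<Sum>i\<in>I. f i m *\<^sub>R \<psi> (d (s i)) + X (f i) *\<^sub>R \<psi> (s i m))"
      by blast
    have j: "f j \<in> Cinf \<A>" "s j \<in> sections \<A> E" using insert.prems by auto
    let ?u = "sec_scale E (f j) (s j)"
    have u: "?u \<in> sections \<A> E" using j by (rule sec_scale_section)
    have "\<psi>' (sec_add E ?u t' x) = (\<Sum>i\<in>insert j I. f i x *\<^sub>R \<psi>' (s i x))"
      if "(W', \<psi>') \<in> trivs E" "x \<in> W'" for W' \<psi>' x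
      using that insert.hyps t' j u
      by (simp add: sec_add_def sec_scale_def triv_add triv_scale section_fibre vscale_fibre)
    moreover have "\<psi> (d (sec_add E ?u t'))
        = (\<Sum>i\<in>insert j I. f i m *\<^sub>R \<psi> (d (s i)) + X (f i) *\<^sub>R \<psi> (s i m))"
      using insert.hyps by (simp add: deriv_vec_add[OF W u t'(1)] deriv_vec_leibniz[OF W j] t'(3))
    ultimately show ?case using sec_add_section[OF u t'(1)] by blast
  qed
  then obtain t' where t': "t' \<in> sections \<A> E"
    "\<And>W \<psi> x. (W, \<psi>) \<in> trivs E \<Longrightarrow> x \<in> W \<Longrightarrow> \<psi> (t' x) = (\<Sum>i\<in>I. f i x *\<^sub>R \<psi> (s i x))"
    "\<psi> (d t') = (\<Sum>i\<in>I. f i m *\<^sub>R \<psi> (d (s i)) + X (f i) *\<^sub>R \<psi> (s i m))"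
    by blast
  have "t = t'"
  proof (rule section_eqI)
    fix x
    obtain W' \<psi>' where W': "(W', \<psi>') \<in> trivs E" "x \<in> W'"
      "\<psi>' (t x) = (\<Sum>i\<in>I. f i x *\<^sub>R \<psi>' (s i x))"
      using eq[of x] by (elim exE conjE) (rule that)
    show "\<exists>W \<psi>. (W, \<psi>) \<in> trivs E \<and> x \<in> W \<and> \<psi> (t x) = \<psi> (t' x)"
      by (rule exI[of _ W'], rule exI[of _ \<psi>']) (simp add: W' t'(2)[OF W'(1,2)])
  qed (use t t'(1) section_fibre in auto)
  then show ?thesis using t'(3) by simp
qed

text \<open>Multiplying \<open>s\<close> by the square of a bump function \<open>\<beta>\<close> makes it a global combination of the
  cut-off frame, with coefficients that contain the other factor \<open>\<beta>\<close>.\<close>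

lemma deriv_vec_frame:
  assumes c: "c \<in> \<A>" "m \<in> fst c" and W: "(W, \<psi>) \<in> trivs E" "m \<in> W"
    and \<beta>: "\<beta> \<in> Cinf \<A>" and K: "closed K" "K \<subseteq> W" "\<And>x. x \<notin> K \<Longrightarrow> \<beta> x = 0"
    and N: "open N" "m \<in> N" "N \<subseteq> W" "\<And>x. x \<in> N \<Longrightarrow> \<beta> x = 1" and s: "s \<in> sections \<A> E"
  shows "\<psi> (d s) = chart_deriv c m (coords \<A> c (m, X)) (\<psi> \<circ> s)
    + (\<Sum>b\<in>fin_basis. coord b (\<psi> (s m)) *\<^sub>R \<psi> (d (frame_sec E W \<psi> \<beta> b)))"
proof -
  define v where "v = coords \<A> c (m, X)"
  note Xf = tangent_apply[OF deriv_vec_tangent c, folded v_def]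
  note fin = finite_dimensional_fibre
  let ?e = "frame_sec E W \<psi> \<beta>"
  let ?t = "sec_scale E (\<lambda>x. \<beta> x * \<beta> x) s"
  define f where "f = (\<lambda>b x. if x \<in> W then \<beta> x *\<^sub>R coord b (\<psi> (s x)) else 0)"
  have e: "?e b \<in> sections \<A> E" for b by (rule frame_sec_section[OF W(1) \<beta> K])
  have \<beta>2: "(\<lambda>x. \<beta> x * \<beta> x) \<in> Cinf \<A>" using \<beta> by (rule Cinf_mult[OF \<beta>])
  have cs: "smooth_fun \<A> W (\<lambda>x. coord b (\<psi> (s x)))" for b
    by (rule smooth_fun_bounded_linear[OF open_triv[OF W(1)] bounded_linear_coord[OF fin]
          section_smooth[OF s W(1)]])
  have f: "f b \<in> Cinf \<A>" for b
    unfolding f_def Cinf_iff by (rule smooth_fun_extend_zero[OF open_triv[OF W(1)] cs K \<beta>])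
  have "\<psi> (d ?t) = (\<Sum>b\<in>fin_basis. f b m *\<^sub>R \<psi> (d (?e b)) + X (f b) *\<^sub>R \<psi> (?e b m))"
  proof (rule deriv_vec_sum[OF finite_fin_basis[OF fin] f e sec_scale_section[OF \<beta>2 s] _ W])
    fix x
    show "\<exists>W' \<psi>'. (W', \<psi>') \<in> trivs E \<and> x \<in> W' \<and>
        \<psi>' (?t x) = (\<Sum>b\<in>fin_basis. f b x *\<^sub>R \<psi>' (?e b x))"
    proof (cases "x \<in> W")
      case True
      have "(\<Sum>b\<in>fin_basis. f b x *\<^sub>R \<psi> (?e b x))
          = (\<beta> x * \<beta> x) *\<^sub>R (\<Sum>b\<in>fin_basis. coord b (\<psi> (s x)) *\<^sub>R b)"
        unfolding scaleR_sum_right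
        by (rule sum.cong) (simp_all add: f_def True triv_frame_sec[OF W(1) \<beta> K True] mult_ac)
      also have "\<dots> = \<psi> (?t x)"
        by (simp add: coord_sum[OF fin] sec_scale_def triv_scale[OF W(1) True] section_fibre[OF s])
      finally show ?thesis using W(1) True by metis
    next
      case False
      then have "\<beta> x = 0" using K by blast
      obtain W' \<psi>' where "(W', \<psi>') \<in> trivs E" "x \<in> W'" using triv_at .
      moreover from this have "\<psi>' (?t x) = 0"
        using \<open>\<beta> x = 0\<close> by (simp add: sec_scale_def triv_scale section_fibre[OF s])
      ultimately show ?thesis using False by (auto simp: f_def)
    qed
  qed
  also have "\<dots> = (\<Sum>b\<in>fin_basis. coord b (\<psi> (s m)) *\<^sub>R \<psi> (d (?e b)))
      + (\<Sum>b\<in>fin_basis. coord b (chart_deriv c m v (\<psi> \<circ> s)) *\<^sub>R b)"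
  proof -
    have "f b m = coord b (\<psi> (s m))" "\<psi> (?e b m) = b" for b
      using N by (simp_all add: f_def W triv_frame_sec[OF W(1) \<beta> K W(2)])
    moreover have "X (f b) = coord b (chart_deriv c m v (\<psi> \<circ> s))" for b
    proof -
      have "X (f b) = chart_deriv c m v (f b)" by (rule Xf[OF f])
      also have "\<dots> = chart_deriv c m v (\<lambda>x. coord b (\<psi> (s x)))"
        by (rule chart_deriv_cong[OF c N(2,1) Cinf_smooth_fun[OF f]]) (use N in \<open>auto simp: f_def\<close>)
      also have "\<dots> = coord b (chart_deriv c m v (\<lambda>x. \<psi> (s x)))"
        by (rule chart_deriv_bounded_linear[OF c W(2) open_triv[OF W(1)] bounded_linear_coord[OF fin]
              section_smooth[OF s W(1)]])
      finally show ?thesis by (simp add: comp_def)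
    qed
    ultimately show ?thesis by (simp add: sum.distrib)
  qed
  also have "(\<Sum>b\<in>fin_basis. coord b (chart_deriv c m v (\<psi> \<circ> s)) *\<^sub>R b) = chart_deriv c m v (\<psi> \<circ> s)"
    by (rule coord_sum[OF fin])
  \<comment> \<open>The square of \<open>\<beta>\<close> is 1 near \<open>m\<close>, so its
    derivative at \<open>m\<close> vanishes and the Leibniz rule leaves \<open>d s\<close>
    alone.\<close>
  also have "\<psi> (d ?t) = \<psi> (d s)"
  proof -
    have "X (\<lambda>x. \<beta> x * \<beta> x) = chart_deriv c m v (\<lambda>x. \<beta> x * \<beta> x)" by (rule Xf[OF \<beta>2])
    also have "\<dots> = chart_deriv c m v (\<lambda>_. 1)"
      by (rule chart_deriv_cong[OF c N(2,1) Cinf_smooth_fun[OF \<beta>2]]) (simp add: N(4))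
    finally have "X (\<lambda>x. \<beta> x * \<beta> x) = 0" by (simp add: chart_deriv_const)
    then show ?thesis using N(2,4) by (simp add: deriv_vec_leibniz[OF W \<beta>2 s])
  qed
  finally show ?thesis by (simp only: v_def add.commute)
qed

context
  fixes c W \<psi>
  assumes c: "c \<in> \<A>" "m \<in> fst c" and W: "(W, \<psi>) \<in> trivs E" "m \<in> W"
begin

text \<open>Every vector \<open>w\<close> of the typical fibre is the value at \<open>m\<close> of a
  global section, a cut-off constant one. The formula on sections therefore determines the
  endomorphism and makes the description in \<open>deriv_coords\<close> definite.\<close>

lemma deriv_coords_unique:
  assumes "\<And>s. s \<in> sections \<A> E \<Longrightarrow>
    \<psi> (d s) = chart_deriv c m (coords \<A> c (m, X)) (\<psi> \<circ> s) + blinfun_apply A (\<psi> (s m))"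
  shows "deriv_coords \<A> E c \<psi> (m, d, X) = (coords \<A> c (m, X), A)"
proof -
  have "A' = A" if A': "\<forall>s \<in> sections \<A> E. \<psi> (d s) =
      chart_deriv c m (coords \<A> c (m, X)) (\<psi> \<circ> s) + blinfun_apply A' (\<psi> (s m))" for A'
  proof (rule blinfun_eqI)
    fix w
    obtain \<beta> :: "'m \<Rightarrow> real" and K N where \<beta>: "\<beta> \<in> Cinf \<A>" "closed K" "K \<subseteq> W"
      "\<And>x. x \<notin> K \<Longrightarrow> \<beta> x = 0" "open N" "m \<in> N" "N \<subseteq> W" "\<And>x. x \<in> N \<Longrightarrow> \<beta> x = 1"
      by (rule smooth_bump_fun[OF open_triv[OF W(1)] W(2)]) (rule that)
    let ?s = "frame_sec E W \<psi> \<beta> w"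
    have s: "?s \<in> sections \<A> E" by (rule frame_sec_section[OF W(1) \<beta>(1-4)])
    have "\<psi> (?s m) = w" using \<beta>(6,8) by (simp add: triv_frame_sec[OF W(1) \<beta>(1-4) W(2)])
    then show "blinfun_apply A' w = blinfun_apply A w"
      using bspec[OF A' s] assms[OF s] by simp
  qed
  then show ?thesis
    unfolding deriv_coords_def using assms by (auto simp: Let_def intro!: the_equality)
qed

text \<open>The zero-order part is read off the values of \<open>d\<close> on a cut-off frame; by
  uniqueness the choice of cut-off does not affect it.\<close>

lemma deriv_coords_apply:
  obtains A where "deriv_coords \<A> E c \<psi> (m, d, X) = (coords \<A> c (m, X), A)"
    "\<And>s. s \<in> sections \<A> E \<Longrightarrow>
      \<psi> (d s) = chart_deriv c m (coords \<A> c (m, X)) (\<psi> \<circ> s) + blinfun_apply A (\<psi> (s m))"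
proof -
  obtain \<beta> :: "'m \<Rightarrow> real" and K N where \<beta>: "\<beta> \<in> Cinf \<A>" "closed K" "K \<subseteq> W"
    "\<And>x. x \<notin> K \<Longrightarrow> \<beta> x = 0" "open N" "m \<in> N" "N \<subseteq> W" "\<And>x. x \<in> N \<Longrightarrow> \<beta> x = 1"
    by (rule smooth_bump_fun[OF open_triv[OF W(1)] W(2)]) (rule that)
  let ?A = "Blinfun (\<lambda>w. \<Sum>b\<in>fin_basis. coord b w *\<^sub>R \<psi> (d (frame_sec E W \<psi> \<beta> b)))"
  have "bounded_linear (\<lambda>w. \<Sum>b\<in>fin_basis. coord b w *\<^sub>R \<psi> (d (frame_sec E W \<psi> \<beta> b)))"
    by (intro bounded_linear_sum bounded_linear_scaleR_const bounded_linear_coord finite_dimensional_fibre)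
  note A = bounded_linear_Blinfun_apply[OF this]
  have "\<psi> (d s) = chart_deriv c m (coords \<A> c (m, X)) (\<psi> \<circ> s) + blinfun_apply ?A (\<psi> (s m))"
    if "s \<in> sections \<A> E" for s
    unfolding A by (rule deriv_vec_frame[OF c W \<beta> that])
  from deriv_coords_unique[OF this] this show thesis by (rule that)
qed

end

end

text \<open>One cut-off around \<open>m\<close> serves all points of \<open>N\<close>. On
  \<open>S \<inter> N\<close> the coordinates are thus given by a single formula in the values of
  the operators on finitely many fixed global sections, which are smooth by assumption.\<close>

lemma smooth_fun_deriv_coords:
  assumes c: "c \<in> \<A>" and W: "(W, \<psi>) \<in> trivs E" and S: "open S" "S \<subseteq> fst c \<inter> W"
    and \<delta>: "\<And>m. m \<in> S \<Longrightarrow> is_deriv_vec \<A> E (m, d m, X m)"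
    and X: "smooth_fun \<A> S (\<lambda>m. coords \<A> c (m, X m))"
    and d: "\<And>s. s \<in> sections \<A> E \<Longrightarrow> smooth_fun \<A> S (\<lambda>m. \<psi> (d m s))"
  shows "smooth_fun \<A> S (\<lambda>m. deriv_coords \<A> E c \<psi> (m, d m, X m))"
proof (rule smooth_fun_local)
  fix m assume m: "m \<in> S"
  then have "m \<in> W" using S by blast
  obtain \<beta> :: "'m \<Rightarrow> real" and K N where \<beta>: "\<beta> \<in> Cinf \<A>" "closed K" "K \<subseteq> W"
    "\<And>x. x \<notin> K \<Longrightarrow> \<beta> x = 0" "open N" "m \<in> N" "N \<subseteq> W" "\<And>x. x \<in> N \<Longrightarrow> \<beta> x = 1"
    by (rule smooth_bump_fun[OF open_triv[OF W] \<open>m \<in> W\<close>]) (rule that)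
  let ?e = "frame_sec E W \<psi> \<beta>"
  \<comment> \<open>As an element of the space of bounded operators: each summand is the rank-one
    map that sends \<open>w\<close> to \<open>coord b w\<close> times
    \<open>\<psi> (d m (?e b))\<close>.\<close>
  let ?F = "\<lambda>m. \<Sum>b\<in>fin_basis. blinfun_scaleR_left (\<psi> (d m (?e b))) o\<^sub>L Blinfun (coord b)"
  have SN: "open (S \<inter> N)" using S(1) \<beta>(5) by blast
  have e: "?e b \<in> sections \<A> E" for b by (rule frame_sec_section[OF W \<beta>(1-4)])
  have "smooth_fun \<A> (S \<inter> N) (\<lambda>m. blinfun_scaleR_left (\<psi> (d m (?e b))) o\<^sub>L Blinfun (coord b))" for b
    by (rule smooth_fun_bilinear[OF SN bounded_bilinear_blinfun_compose
          smooth_fun_bounded_linear[OF SN bounded_linear_blinfun_scaleR_left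
            smooth_fun_subset[OF d[OF e]]] smooth_fun_const[OF SN]]) simp
  then have "smooth_fun \<A> (S \<inter> N) ?F" by (rule smooth_fun_sum[OF SN])
  moreover have "smooth_fun \<A> (S \<inter> N) (\<lambda>m. coords \<A> c (m, X m))"
    using X by (rule smooth_fun_subset) simp
  ultimately have "smooth_fun \<A> (S \<inter> N) (\<lambda>m. (coords \<A> c (m, X m), ?F m))"
    by (intro smooth_fun_Pair[OF SN])
  then have "smooth_fun \<A> (S \<inter> N) (\<lambda>m. deriv_coords \<A> E c \<psi> (m, d m, X m))"
  proof (rule smooth_fun_cong[OF SN])
    fix x assume x: "x \<in> S \<inter> N"
    have xW: "x \<in> fst c" "x \<in> W" using x S by auto
    have "blinfun_apply (?F x) w = (\<Sum>b\<in>fin_basis. coord b w *\<^sub>R \<psi> (d x (?e b)))" for w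
      by (simp add: blinfun.sum_left bounded_linear_Blinfun_apply[OF bounded_linear_coord[OF finite_dimensional_fibre]])
    then have "\<psi> (d x s) = chart_deriv c x (coords \<A> c (x, X x)) (\<psi> \<circ> s) + blinfun_apply (?F x) (\<psi> (s x))"
      if "s \<in> sections \<A> E" for s
      using deriv_vec_frame[OF \<delta> c xW(1) W xW(2) \<beta>(1-5) _ \<beta>(7,8) that] x by simp
    from deriv_coords_unique[OF \<delta> c xW(1) W xW(2) this] x
    show "(coords \<A> c (x, X x), ?F x) = deriv_coords \<A> E c \<psi> (x, d x, X x)" by simp
  qed
  then show "\<exists>T. open T \<and> m \<in> T \<and> smooth_fun \<A> T (\<lambda>m. deriv_coords \<A> E c \<psi> (m, d m, X m))"
    using SN m \<beta>(6) by blast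
qed

end

section \<open>The action Lie algebroid\<close>

locale bundle_action = smooth_bundle \<A> E
  for \<A> :: "('m::{t2_space,second_countable_topology}, 'e::real_normed_vector) atlas"
    and E :: "('m, 'v, 'f::real_normed_vector) vbundle" +
  fixes br :: "'g::real_normed_vector \<Rightarrow> 'g \<Rightarrow> 'g"
    and act :: "'g \<Rightarrow> 'm \<Rightarrow> 'm tangent"
  assumes lie_algebra: "lie_algebra br"
    and infinitesimal_action: "infinitesimal_action \<A> br act"
begin

abbreviation "G \<equiv> action_algebroid br act"
abbreviation "DE \<equiv> deriv_algebroid \<A> E"

lemma finite_dimensional_lie: "finite_dimensional TYPE('g)"
  using lie_algebra unfolding lie_algebra_def by blast

lemma act_section: "act X \<in> sections \<A> TM"
  and act_add: "act (X + Y) m = vadd TM (act X m) (act Y m)"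
  and act_scale: "act (k *\<^sub>R X) m = vscale TM k (act X m)"
  and act_bracket: "vf_bracket \<A> (act X) (act Y) = act (br X Y)"
  using infinitesimal_action unfolding infinitesimal_action_def sec_add_def sec_scale_def by auto

lemma act_fibre: "act X m \<in> fibre TM m"
  using act_section vector_field_iff by blast

lemmas act_eq = fibre_tangentD(1)[OF act_fibre]
lemmas act_tangent = fibre_tangentD(2)[OF act_fibre]

lemma act_apply_linear:
  assumes "f \<in> Cinf \<A>"
  shows "linear (\<lambda>X. snd (act X m) f)"
proof (rule linearI)
  show "snd (act (X + Y) m) f = snd (act X m) f + snd (act Y m) f" for X Y
    unfolding act_add by (subst (1 2) act_eq) (simp add: tangent_bundle_def assms)
  show "snd (act (k *\<^sub>R X) m) f = k *\<^sub>R snd (act X m) f" for k X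
    unfolding act_scale by (subst (1) act_eq) (simp add: tangent_bundle_def assms)
qed

lemma vf_app_act: "vf_app (act X) f m = snd (act X m) f"
  by (simp add: vf_app_def)

lemma action_sections_iff:
  "V \<in> sections \<A> G \<longleftrightarrow> (\<forall>m. fst (V m) = m) \<and> smooth_fun \<A> UNIV (\<lambda>m. snd (V m))"
  by (subst sections_iff) (auto simp: action_algebroid_def fibre_def)

text \<open>The componentwise derivative \<open>?w\<close> satisfies the defining condition for all
  functionals by expansion in the basis; the coordinate functionals show that it is the only such
  vector. Of \<open>V\<close> only the value at \<open>m\<close> enters.\<close>

lemma lie_deriv_functional:
  assumes V: "V m \<in> fibre TM m" and W: "smooth_fun \<A> UNIV (W :: 'm \<Rightarrow> 'g)" and l: "linear l"
  shows "l (lie_deriv V W m) = snd (V m) (\<lambda>x. l (W x))"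
proof -
  note fin = finite_dimensional_lie
  define X where "X = snd (V m)"
  have X: "(m, X) \<in> total TM" using fibre_tangentD[OF V] by (simp add: X_def)
  let ?w = "\<Sum>b\<in>fin_basis. X (\<lambda>x. coord b (W x)) *\<^sub>R b"
  have C: "(\<lambda>x. l (W x)) \<in> Cinf \<A>" if "linear l" for l :: "'g \<Rightarrow> real"
    unfolding Cinf_iff
    by (intro smooth_fun_bounded_linear[OF open_UNIV _ W] finite_dimensional_linear_bounded fin that)
  have w: "l ?w = X (\<lambda>x. l (W x))" if l: "linear l" for l :: "'g \<Rightarrow> real"
  proof -
    have c: "(\<lambda>x. coord b (W x) * l b) \<in> Cinf \<A>" for b
      using Cinf_mult[OF C[OF linear_coord[OF fin]] Cinf_const] .
    have "X (\<lambda>x. coord b (W x) * l b) = X (\<lambda>x. coord b (W x)) * l b" for b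
      using tangent_mult[OF X C[OF linear_coord[OF fin]] Cinf_const, of b "l b"] by (simp add: tangent_const[OF X])
    then have "l ?w = X (\<lambda>x. \<Sum>b\<in>fin_basis. coord b (W x) * l b)"
      by (simp add: tangent_sum[OF X c] linear_sum[OF l] linear_cmul[OF l])
    also have "(\<lambda>x. \<Sum>b\<in>fin_basis. coord b (W x) * l b) = (\<lambda>x. l (W x))"
      by (rule ext) (rule linear_coord_sum[OF fin l, symmetric, unfolded real_scaleR_def])
    finally show ?thesis .
  qed
  have "lie_deriv V W m = ?w"
    unfolding lie_deriv_def
  proof (rule the_equality)
    show "\<forall>l. linear l \<longrightarrow> l ?w = vf_app V (l \<circ> W) m"
      using w by (simp add: vf_app_def comp_def X_def)
    fix w' assume w': "\<forall>l. linear l \<longrightarrow> l w' = vf_app V (l \<circ> W) m"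
    have "coord b w' = coord b ?w" for b
      using w'[rule_format, OF linear_coord[OF fin], of b] w[OF linear_coord[OF fin], of b]
      by (simp add: vf_app_def comp_def X_def)
    then have "(\<Sum>b\<in>fin_basis. coord b w' *\<^sub>R b) = (\<Sum>b\<in>fin_basis. coord b ?w *\<^sub>R b)"
      by simp
    then show "w' = ?w" by (simp only: coord_sum[OF fin])
  qed
  then show ?thesis using w[OF l] by (simp add: X_def)
qed

lemma lie_deriv_const:
  assumes "V m \<in> fibre TM m"
  shows "lie_deriv V (\<lambda>_. w :: 'g) m = 0"
proof -
  have "coord b (lie_deriv V (\<lambda>_. w) m) = 0" for b
    using lie_deriv_functional[of V m "\<lambda>_. w", OF assms smooth_fun_const[OF open_UNIV, of w] linear_coord[OF finite_dimensional_lie]]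
      tangent_const[OF fibre_tangentD(2)[OF assms]] by simp
  then have "(\<Sum>b\<in>fin_basis. coord b (lie_deriv V (\<lambda>_. w) m) *\<^sub>R b) = 0" by simp
  then show ?thesis by (simp only: coord_sum[OF finite_dimensional_lie])
qed

text \<open>The function is the sum of \<open>coord b (W x)\<close> times \<open>act b\<close>
  applied to \<open>f\<close>. Differentiating the second factors, with coefficients frozen at
  \<open>m\<close>, gives the term of \<open>act (W m)\<close>; differentiating the coefficients
  gives that of the Lie derivative.\<close>

lemma act_derivative:
  assumes V: "V m \<in> fibre TM m" and W: "smooth_fun \<A> UNIV W" and f: "f \<in> Cinf \<A>"
  shows "snd (V m) (\<lambda>x. snd (act (W x) x) f)
    = snd (V m) (vf_app (act (W m)) f) + snd (act (lie_deriv V W m) m) f"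
proof -
  note fin = finite_dimensional_lie
  define X where "X = snd (V m)"
  have X: "(m, X) \<in> total TM" using fibre_tangentD[OF V] by (simp add: X_def)
  have C: "(\<lambda>x. coord b (W x)) \<in> Cinf \<A>" for b
    unfolding Cinf_iff by (intro smooth_fun_bounded_linear[OF open_UNIV _ W] bounded_linear_coord fin)
  have A: "vf_app (act b) f \<in> Cinf \<A>" for b by (rule vf_app_Cinf[OF act_section f])
  note lin = linear_coord_sum[OF fin act_apply_linear[OF f], folded vf_app_act, unfolded real_scaleR_def]
  have "X (\<lambda>x. vf_app (act (W x)) f x)
      = X (\<lambda>x. \<Sum>b\<in>fin_basis. coord b (W x) * vf_app (act b) f x)"
    by (subst lin) (rule refl)
  also have "\<dots> = (\<Sum>b\<in>fin_basis. coord b (W m) * X (vf_app (act b) f))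
      + (\<Sum>b\<in>fin_basis. X (\<lambda>x. coord b (W x)) * vf_app (act b) f m)"
    by (simp add: tangent_sum[OF X Cinf_mult[OF C A]] tangent_mult[OF X C A] sum.distrib)
  also have "(\<Sum>b\<in>fin_basis. coord b (W m) * X (vf_app (act b) f))
      = X (\<lambda>x. \<Sum>b\<in>fin_basis. coord b (W m) * vf_app (act b) f x)"
    by (simp add: tangent_sum[OF X Cinf_mult[OF Cinf_const A]] tangent_cmult[OF X A])
  also have "(\<lambda>x. \<Sum>b\<in>fin_basis. coord b (W m) * vf_app (act b) f x) = vf_app (act (W m)) f"
    using lin[of "W m"] by (intro ext) (rule sym)
  also have "(\<Sum>b\<in>fin_basis. X (\<lambda>x. coord b (W x)) * vf_app (act b) f m)
      = vf_app (act (lie_deriv V W m)) f m"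
    using lie_deriv_functional[of V m W, OF V W linear_coord[OF fin]]
    by (subst lin) (simp add: X_def)
  finally show ?thesis by (simp add: X_def vf_app_def)
qed

text \<open>\<open>G\<close> has the single global trivialisation \<open>snd\<close> and
  \<open>\<Phi>\<close> covers the identity, so in charts the relevant domains are products with the
  whole Lie algebra and the inverse of the source chart is explicit.\<close>

lemma smooth_map_action_iff:
  fixes H :: "('m, 'w, 'h::real_normed_vector, 'y) vbundle_scheme"
  assumes \<Phi>: "\<And>m X. \<Phi> (m, X) \<in> fibre H m"
  shows "smooth_map (total_atlas \<A> G) (total_atlas \<A> H) \<Phi> \<longleftrightarrow>
    (\<forall>c1\<in>\<A>. \<forall>c2\<in>\<A>. \<forall>t\<in>trivs H.
      open (snd c1 ` (fst c1 \<inter> (fst c2 \<inter> fst t)) \<times> (UNIV :: 'g set)) \<and>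
      smooth_on (snd c1 ` (fst c1 \<inter> (fst c2 \<inter> fst t)) \<times> UNIV)
        (\<lambda>z. (snd c2 (inv_into (fst c1) (snd c1) (fst z)),
          snd t (\<Phi> (inv_into (fst c1) (snd c1) (fst z), snd z)))))"
proof -
  have eq: "(open (T ` (D \<inter> \<Phi> -` D')) \<and> smooth_on (T ` (D \<inter> \<Phi> -` D')) (T' \<circ> \<Phi> \<circ> inv_into D T))
    \<longleftrightarrow> (open (snd c1 ` (fst c1 \<inter> (fst c2 \<inter> fst t)) \<times> (UNIV :: 'g set)) \<and>
      smooth_on (snd c1 ` (fst c1 \<inter> (fst c2 \<inter> fst t)) \<times> UNIV)
        (\<lambda>z. (snd c2 (inv_into (fst c1) (snd c1) (fst z)),
          snd t (\<Phi> (inv_into (fst c1) (snd c1) (fst z), snd z)))))"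
    if c: "c1 \<in> \<A>" "c2 \<in> \<A>" "t \<in> trivs H"
      and D: "D = {e \<in> total G. proj G e \<in> fst c1 \<inter> UNIV}"
      and D': "D' = {e \<in> total H. proj H e \<in> fst c2 \<inter> fst t}"
      and T: "T = (\<lambda>e. (snd c1 (proj G e), snd e))"
      and T': "T' = (\<lambda>e. (snd c2 (proj H e), snd t e))"
    for c1 c2 t D D' T T'
  proof -
    have \<Phi>': "\<Phi> (m, X) \<in> total H" "proj H (\<Phi> (m, X)) = m" for m X
      using \<Phi>[of m X] by (simp_all add: fibre_def)
    have D: "D = fst c1 \<times> UNIV" by (auto simp: D action_algebroid_def)
    have T: "T = (\<lambda>e. (snd c1 (fst e), snd e))" by (simp add: T action_algebroid_def)
    have R: "T ` (D \<inter> \<Phi> -` D') = snd c1 ` (fst c1 \<inter> (fst c2 \<inter> fst t)) \<times> UNIV"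
      by (force simp: D T D' \<Phi>')
    have inj: "inj_on T D"
      unfolding D T using chart_inv[OF c(1)] by (intro inj_onI) (metis mem_Times_iff prod.collapse prod.inject)
    have inv: "inv_into D T (snd c1 m, X) = (m, X)" if "m \<in> fst c1" for m X
      by (rule inv_into_f_eq[OF inj]) (use that in \<open>simp_all add: D T\<close>)
    have val: "(T' \<circ> \<Phi> \<circ> inv_into D T) z = (snd c2 (inv_into (fst c1) (snd c1) (fst z)),
        snd t (\<Phi> (inv_into (fst c1) (snd c1) (fst z), snd z)))"
      if z: "z \<in> T ` (D \<inter> \<Phi> -` D')" for z
    proof -
      obtain m X where "m \<in> fst c1" "z = (snd c1 m, X)"
        using z unfolding R by (auto simp: image_iff)
      then show ?thesis by (simp add: inv chart_inv[OF c(1)] T' \<Phi>')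
    qed
    show ?thesis
      using val unfolding R by (intro conj_cong refl smooth_on_cong_iff)
  qed
  have trivs_G: "trivs G = {(UNIV, snd)}" by (simp add: action_algebroid_def)
  show ?thesis
    unfolding smooth_map_def ball_total_atlas split_beta fst_conv snd_conv trivs_G ball_simps simp_thms
    by (intro ball_cong[OF refl] eq refl)
qed

lemma deriv_algebroid_fibre: "\<delta> \<in> fibre DE m \<longleftrightarrow> is_deriv_vec \<A> E \<delta> \<and> fst \<delta> = m"
  by (simp add: fibre_def deriv_algebroid_def)

section \<open>From algebroid representations to derivative representations\<close>

definition rep_to_derivative :: "('m \<times> 'g \<Rightarrow> ('m, 'v) deriv_vec) \<Rightarrow> 'g \<Rightarrow> ('m \<Rightarrow> 'v) \<Rightarrow> 'm \<Rightarrow> 'v" where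
  "rep_to_derivative \<Phi> = (\<lambda>X. \<lambda>s \<in> sections \<A> E. deriv_app (\<lambda>m. \<Phi> (m, X)) s)"

lemma anchor_DE: "anchor DE \<delta> = deriv_anchor \<delta>"
  and anchor_G: "anchor G (m, X) = act X m"
  and vadd_G: "vadd G (m, X) (m, Y) = (m, X + Y)"
  and vscale_G: "vscale G k (m, X) = (m, k *\<^sub>R X)"
  and total_G: "total G = UNIV"
  and fibre_G: "(m, X) \<in> fibre G m"
  by (simp_all add: deriv_algebroid_def action_algebroid_def fibre_def)

lemma trivs_DE: "trivs DE = {(fst c \<inter> W, deriv_coords \<A> E c \<psi>) | c W \<psi>. c \<in> \<A> \<and> (W, \<psi>) \<in> trivs E}"
  by (simp add: deriv_algebroid_def)

lemma deriv_anchor_Pair: "deriv_anchor (m, d, X) = (m, X)"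
  by (simp add: deriv_anchor_def)

context
  fixes \<Phi>
  assumes rep: "algebroid_rep \<A> G E \<Phi>"
begin

lemma rep_fibre: "\<Phi> (m, X) \<in> fibre DE m"
  and rep_vadd: "\<Phi> (m, X + Y) = vadd DE (\<Phi> (m, X)) (\<Phi> (m, Y))"
  and rep_vscale: "\<Phi> (m, k *\<^sub>R X) = vscale DE k (\<Phi> (m, X))"
  and rep_smooth: "smooth_map (total_atlas \<A> G) (total_atlas \<A> DE) \<Phi>"
  and rep_anchor: "deriv_anchor (\<Phi> (m, X)) = act X m"
proof -
  have *: "bundle_morphism \<A> G DE \<Phi>" "\<forall>x \<in> total G. anchor DE (\<Phi> x) = anchor G x"
    using rep unfolding algebroid_rep_def algebroid_morphism_def by blast+
  show "smooth_map (total_atlas \<A> G) (total_atlas \<A> DE) \<Phi>"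
    using *(1) unfolding bundle_morphism_def by blast
  show "\<Phi> (m, X) \<in> fibre DE m"
    using *(1) fibre_G unfolding bundle_morphism_def by blast
  have "\<forall>m. \<forall>x \<in> fibre G m. \<forall>y \<in> fibre G m. \<Phi> (vadd G x y) = vadd DE (\<Phi> x) (\<Phi> y)"
    using *(1) unfolding bundle_morphism_def by blast
  from this[rule_format, OF fibre_G fibre_G]
  show "\<Phi> (m, X + Y) = vadd DE (\<Phi> (m, X)) (\<Phi> (m, Y))" unfolding vadd_G .
  have "\<forall>k. \<forall>x \<in> total G. \<Phi> (vscale G k x) = vscale DE k (\<Phi> x)"
    using *(1) unfolding bundle_morphism_def by blast
  then show "\<Phi> (m, k *\<^sub>R X) = vscale DE k (\<Phi> (m, X))"
    unfolding total_G by (metis UNIV_I vscale_G)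
  show "deriv_anchor (\<Phi> (m, X)) = act X m"
    using bspec[OF *(2), of "(m, X)"] by (simp add: total_G anchor_DE anchor_G)
qed

text \<open>Compatibility with the anchors fixes the base point and the tangent vector, so the
  operator is the only free component of \<open>\<Phi>\<close>.\<close>

lemma rep_eq: "\<Phi> (m, X) = (m, fst (snd (\<Phi> (m, X))), snd (act X m))"
proof -
  obtain m' d Y where \<Phi>: "\<Phi> (m, X) = (m', d, Y)" by (rule prod_cases3)
  have "(m', Y) = act X m" using rep_anchor[of m X] by (simp add: \<Phi> deriv_anchor_Pair)
  then have "(m', Y) = (m, snd (act X m))" using act_eq[of X m] by (rule trans)
  then show ?thesis by (simp add: \<Phi>)
qed

lemma rep_deriv_vec: "is_deriv_vec \<A> E (m, fst (snd (\<Phi> (m, X))), snd (act X m))"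
  using rep_fibre[of m X] rep_eq[of m X] by (simp add: deriv_algebroid_fibre)

lemma rep_to_derivative_apply:
  "s \<in> sections \<A> E \<Longrightarrow> rep_to_derivative \<Phi> X s m = fst (snd (\<Phi> (m, X))) s"
  by (simp add: rep_to_derivative_def deriv_app_def)

text \<open>The restriction of the jointly smooth coordinate expression of \<open>\<Phi>\<close> to
  the slice of constant \<open>X\<close>.\<close>

lemma rep_coords_smooth:
  assumes c: "c \<in> \<A>" and W: "(W, \<psi>) \<in> trivs E"
  shows "smooth_fun \<A> (fst c \<inter> W) (\<lambda>m. deriv_coords \<A> E c \<psi> (\<Phi> (m, X)))"
proof -
  let ?S = "fst c \<inter> W" and ?i = "inv_into (fst c) (snd c)"
  let ?t = "(fst c \<inter> W, deriv_coords \<A> E c \<psi>)"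
  have S: "open ?S" using open_chart[OF c] open_triv[OF W] by blast
  have im: "open (snd c ` ?S)" by (rule open_chart_image[OF c S]) simp
  have t: "?t \<in> trivs DE"
    unfolding trivs_DE mem_Collect_eq
    by (intro exI[of _ c] exI[of _ W] exI[of _ \<psi>] conjI refl c W)
  let ?g = "\<lambda>z. (snd c (?i (fst z)), deriv_coords \<A> E c \<psi> (\<Phi> (?i (fst z), snd z)))"
  have g: "open (snd c ` ?S \<times> (UNIV :: 'g set))" "smooth_on (snd c ` ?S \<times> UNIV) ?g"
    using iffD1[OF smooth_map_action_iff[OF rep_fibre] rep_smooth, THEN bspec, OF c, THEN bspec, OF c, THEN bspec, OF t]
    by simp_all
  have "smooth_on (snd c ` ?S) (\<lambda>y. (y, X))"
    by (intro smooth_on_Pair[OF im] smooth_on_id[OF im] smooth_on_const[OF im])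
  then have "smooth_on (snd c ` ?S) (\<lambda>y. ?g (y, X))"
    by (rule smooth_on_compose[OF im finite_dimensional_prod[OF finite_dimensional_model finite_dimensional_lie] g(2) _ g(1)]) simp
  then have "smooth_on (snd c ` ?S) (\<lambda>y. snd (?g (y, X)))"
    by (rule smooth_on_bounded_linear[OF im bounded_linear_snd])
  then show ?thesis
    by (intro smooth_funI_chart[OF c S]) (simp_all add: comp_def)
qed

text \<open>The local form is used to recover the operator from its coordinates
  \<open>(v, A)\<close>: both the derivative of the section along the smooth field \<open>v\<close>
  and \<open>A\<close> applied to the section are smooth.\<close>

lemma rep_section:
  assumes s: "s \<in> sections \<A> E"
  shows "rep_to_derivative \<Phi> X s \<in> sections \<A> E"
proof (rule sectionI)
  show "rep_to_derivative \<Phi> X s m \<in> fibre E m" for m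
    using deriv_vec_fibre[OF rep_deriv_vec s] by (simp add: rep_to_derivative_apply[OF s])
  fix W \<psi> assume W: "(W, \<psi>) \<in> trivs E"
  show "smooth_fun \<A> W (\<lambda>m. \<psi> (rep_to_derivative \<Phi> X s m))"
  proof (rule smooth_fun_local)
    fix m assume m: "m \<in> W"
    obtain c where c: "c \<in> \<A>" "m \<in> fst c" using chart_at .
    let ?S = "fst c \<inter> W" and ?dc = "\<lambda>m. deriv_coords \<A> E c \<psi> (\<Phi> (m, X))"
    have S: "open ?S" using open_chart[OF c(1)] open_triv[OF W] by blast
    have dc: "smooth_fun \<A> ?S ?dc" by (rule rep_coords_smooth[OF c(1) W])
    have \<psi>s: "smooth_fun \<A> ?S (\<lambda>m. \<psi> (s m))"
      by (rule smooth_fun_subset[OF section_smooth[OF s W]]) simp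
    have "smooth_fun \<A> ?S (\<lambda>m. chart_deriv c m (fst (?dc m)) (\<lambda>m. \<psi> (s m)))"
      by (rule smooth_fun_chart_deriv[OF S c(1) _ \<psi>s smooth_fun_bounded_linear[OF S bounded_linear_fst dc]]) simp
    moreover have "smooth_fun \<A> ?S (\<lambda>m. blinfun_apply (snd (?dc m)) (\<psi> (s m)))"
      by (rule smooth_fun_bilinear[OF S bounded_bilinear_blinfun_apply
            smooth_fun_bounded_linear[OF S bounded_linear_snd dc] \<psi>s])
    ultimately have "smooth_fun \<A> ?S (\<lambda>m. chart_deriv c m (fst (?dc m)) (\<lambda>m. \<psi> (s m))
        + blinfun_apply (snd (?dc m)) (\<psi> (s m)))"
      by (rule smooth_fun_add[OF S])
    then have "smooth_fun \<A> ?S (\<lambda>m. \<psi> (rep_to_derivative \<Phi> X s m))"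
    proof (rule smooth_fun_cong[OF S])
      fix x assume x: "x \<in> ?S"
      then have x': "x \<in> fst c" "x \<in> W" by auto
      obtain A where A: "deriv_coords \<A> E c \<psi> (x, fst (snd (\<Phi> (x, X))), snd (act X x))
          = (coords \<A> c (x, snd (act X x)), A)"
        "\<psi> (fst (snd (\<Phi> (x, X))) s) = chart_deriv c x (coords \<A> c (x, snd (act X x))) (\<psi> \<circ> s)
          + blinfun_apply A (\<psi> (s x))"
        using deriv_coords_apply[OF rep_deriv_vec c(1) x'(1) W x'(2), of X] s by metis
      show "chart_deriv c x (fst (?dc x)) (\<lambda>m. \<psi> (s m)) + blinfun_apply (snd (?dc x)) (\<psi> (s x))
          = \<psi> (rep_to_derivative \<Phi> X s x)"
        unfolding rep_to_derivative_apply[OF s] A(2) rep_eq[of x X, THEN arg_cong[where f = "deriv_coords \<A> E c \<psi>"]] A(1)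
        by (simp add: comp_def)
    qed
    then show "\<exists>T. open T \<and> m \<in> T \<and> smooth_fun \<A> T (\<lambda>m. \<psi> (rep_to_derivative \<Phi> X s m))"
      using S c(2) m by blast
  qed
qed

text \<open>The algebraic clauses for the operator are those of \<open>is_deriv_vec\<close>, read at
  every point.\<close>

lemma rep_derivative_endo_over: "derivative_endo_over \<A> E (rep_to_derivative \<Phi> X) (vf_app (act X))"
proof -
  note dv = rep_deriv_vec[unfolded is_deriv_vec_def prod.case]
  have "rep_to_derivative \<Phi> X (sec_add E s t) = sec_add E (rep_to_derivative \<Phi> X s) (rep_to_derivative \<Phi> X t)"
    if "s \<in> sections \<A> E" "t \<in> sections \<A> E" for s t
    using dv that sec_add_section[OF that]
    by (intro ext) (simp add: rep_to_derivative_apply sec_add_def[of E "rep_to_derivative \<Phi> X s"])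
  moreover have "rep_to_derivative \<Phi> X (sec_scale E (\<lambda>_. k) s) = sec_scale E (\<lambda>_. k) (rep_to_derivative \<Phi> X s)"
    if "s \<in> sections \<A> E" for s k
    using dv that sec_scale_section[OF Cinf_const that]
    by (intro ext) (simp add: rep_to_derivative_apply sec_scale_def[of E _ "rep_to_derivative \<Phi> X s"])
  moreover have "rep_to_derivative \<Phi> X (sec_scale E f s)
      = sec_add E (sec_scale E f (rep_to_derivative \<Phi> X s)) (sec_scale E (vf_app (act X) f) s)"
    if "f \<in> Cinf \<A>" "s \<in> sections \<A> E" for f s
    using dv that sec_scale_section[OF that]
    by (intro ext) (simp add: rep_to_derivative_apply sec_add_def
        sec_scale_def[of E _ "rep_to_derivative \<Phi> X s"] sec_scale_def[of E "vf_app _ _"] vf_app_act)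
  moreover have "rep_to_derivative \<Phi> X \<in> sections \<A> E \<rightarrow>\<^sub>E sections \<A> E"
  proof (rule PiE_I)
    show "rep_to_derivative \<Phi> X s = undefined" if "s \<notin> sections \<A> E" for s
      using that by (simp add: rep_to_derivative_def)
  qed (rule rep_section)
  moreover have "vf_app (act X) (\<lambda>m. f m + g m) = (\<lambda>m. vf_app (act X) f m + vf_app (act X) g m)"
    if "f \<in> Cinf \<A>" "g \<in> Cinf \<A>" for f g
    by (rule ext) (simp add: vf_app_def tangent_plus[OF act_tangent that])
  moreover have "vf_app (act X) (\<lambda>m. k * f m) = (\<lambda>m. k * vf_app (act X) f m)"
    if "f \<in> Cinf \<A>" for f k
    by (rule ext) (simp add: vf_app_def tangent_cmult[OF act_tangent that])
  ultimately show ?thesis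
    unfolding derivative_endo_over_def using vf_app_Cinf[OF act_section] by simp
qed

lemma rep_bracket:
  assumes s: "s \<in> sections \<A> E"
  shows "rep_to_derivative \<Phi> (br X Y) s =
    sec_diff E (rep_to_derivative \<Phi> X (rep_to_derivative \<Phi> Y s)) (rep_to_derivative \<Phi> Y (rep_to_derivative \<Phi> X s))"
proof
  fix m
  let ?c = "\<lambda>X m. (m, X)"
  have c: "?c X \<in> sections \<A> G" for X
    by (simp add: action_sections_iff smooth_fun_const)
  have br: "bracket G (?c X) (?c Y) = ?c (br X Y)"
    using lie_deriv_const[of "\<lambda>m. act X m"] lie_deriv_const[of "\<lambda>m. act Y m"] act_fibre
    by (simp add: action_algebroid_def comp_def Let_def)
  \<comment> \<open>In the commutator this is applied twice; the inner result has to be a section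
    again, which is \<open>rep_section\<close>.\<close>
  have app: "deriv_app (\<Phi> \<circ> ?c X) t = rep_to_derivative \<Phi> X t" if "t \<in> sections \<A> E" for X t
    using that by (simp add: rep_to_derivative_def comp_def)
  have "\<Phi> \<circ> bracket G (?c X) (?c Y) = bracket DE (\<Phi> \<circ> ?c X) (\<Phi> \<circ> ?c Y)"
    using rep c unfolding algebroid_rep_def algebroid_morphism_def by blast
  from fun_cong[OF this, of m]
  have "\<Phi> (m, br X Y) = bracket DE (\<Phi> \<circ> ?c X) (\<Phi> \<circ> ?c Y) m"
    by (simp only: br comp_def)
  then have "fst (snd (\<Phi> (m, br X Y))) s
      = sec_diff E (deriv_app (\<Phi> \<circ> ?c X) (deriv_app (\<Phi> \<circ> ?c Y) s)) (deriv_app (\<Phi> \<circ> ?c Y) (deriv_app (\<Phi> \<circ> ?c X) s)) m"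
    using s by (simp add: deriv_algebroid_def)
  then show "rep_to_derivative \<Phi> (br X Y) s m =
    sec_diff E (rep_to_derivative \<Phi> X (rep_to_derivative \<Phi> Y s)) (rep_to_derivative \<Phi> Y (rep_to_derivative \<Phi> X s)) m"
    by (simp only: rep_to_derivative_apply[OF s] app s rep_section)
qed

lemma rep_derivative_rep: "derivative_rep \<A> E br (rep_to_derivative \<Phi>)"
proof -
  have "fst (snd (\<Phi> (m, X + Y))) s = vadd E (fst (snd (\<Phi> (m, X))) s) (fst (snd (\<Phi> (m, Y))) s)"
    if "s \<in> sections \<A> E" for m X Y s
    unfolding rep_vadd using that
    by (subst (1 2) rep_eq) (simp add: deriv_algebroid_def)
  moreover have "fst (snd (\<Phi> (m, k *\<^sub>R X))) s = vscale E k (fst (snd (\<Phi> (m, X))) s)"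
    if "s \<in> sections \<A> E" for m X k s
    unfolding rep_vscale using that
    by (subst (1) rep_eq) (simp add: deriv_algebroid_def)
  ultimately show ?thesis
    unfolding derivative_rep_def derivative_endo_def
    using rep_derivative_endo_over
    by (intro conjI allI ballI exI[of _ "vf_app (act _)"] rep_bracket)
      (simp_all add: fun_eq_iff sec_add_def sec_scale_def rep_to_derivative_apply)
qed

lemma rep_associated: "associated_to_action \<A> E act (rep_to_derivative \<Phi>)"
  unfolding associated_to_action_def using rep_derivative_endo_over by blast

end

text \<open>By \<open>rep_eq\<close> only the operators have to agree. On sections they are values
  of the derivative representation, and elsewhere they agree by extensionality.\<close>

lemma rep_to_derivative_inj: "inj_on rep_to_derivative {\<Phi>. algebroid_rep \<A> G E \<Phi>}"
proof (rule inj_onI, unfold mem_Collect_eq)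
  fix \<Phi> \<Phi>' assume \<Phi>: "algebroid_rep \<A> G E \<Phi>" "algebroid_rep \<A> G E \<Phi>'"
    and eq: "rep_to_derivative \<Phi> = rep_to_derivative \<Phi>'"
  have "fst (snd (\<Phi> (m, X))) = fst (snd (\<Phi>' (m, X)))" for m X
  proof (rule extensionalityI)
    show "fst (snd (\<Phi> (m, X))) \<in> extensional (sections \<A> E)"
      "fst (snd (\<Phi>' (m, X))) \<in> extensional (sections \<A> E)"
      using deriv_vec_extensional rep_deriv_vec \<Phi> by blast+
    show "fst (snd (\<Phi> (m, X))) s = fst (snd (\<Phi>' (m, X))) s" if "s \<in> sections \<A> E" for s
      using fun_cong[OF fun_cong[OF fun_cong[OF eq]], of X s m] that
      by (simp add: rep_to_derivative_apply[OF \<Phi>(1)] rep_to_derivative_apply[OF \<Phi>(2)])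
  qed
  then have "\<Phi> (m, X) = \<Phi>' (m, X)" for m X
    by (subst rep_eq[OF \<Phi>(1)], subst rep_eq[OF \<Phi>(2)]) simp
  then show "\<Phi> = \<Phi>'" by (intro ext) (metis prod.collapse)
qed

section \<open>From derivative representations to algebroid representations\<close>

definition derivative_to_rep ::
    "('g \<Rightarrow> ('m \<Rightarrow> 'v) \<Rightarrow> 'm \<Rightarrow> 'v) \<Rightarrow> 'm \<times> 'g \<Rightarrow> ('m, 'v) deriv_vec" where
  "derivative_to_rep \<rho> = (\<lambda>(m, X). (m, \<lambda>s \<in> sections \<A> E. \<rho> X s m, snd (act X m)))"

context
  fixes \<rho>
  assumes rep: "derivative_rep \<A> E br \<rho>" and assoc: "associated_to_action \<A> E act \<rho>"
begin

lemma rho_over: "derivative_endo_over \<A> E (\<rho> X) (vf_app (act X))"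
  using assoc unfolding associated_to_action_def by (rule spec)

lemma rho_PiE: "\<rho> X \<in> sections \<A> E \<rightarrow>\<^sub>E sections \<A> E"
  using rho_over unfolding derivative_endo_over_def by (rule conjunct1)

lemma rho_section: "s \<in> sections \<A> E \<Longrightarrow> \<rho> X s \<in> sections \<A> E"
  by (rule PiE_mem[OF rho_PiE])

lemma rho_add: "s \<in> sections \<A> E \<Longrightarrow> \<rho> (X + Y) s m = vadd E (\<rho> X s m) (\<rho> Y s m)"
  and rho_scale: "s \<in> sections \<A> E \<Longrightarrow> \<rho> (k *\<^sub>R X) s m = vscale E k (\<rho> X s m)"
  and rho_bracket: "s \<in> sections \<A> E \<Longrightarrow> \<rho> (br X Y) s = sec_diff E (\<rho> X (\<rho> Y s)) (\<rho> Y (\<rho> X s))"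
  using rep unfolding derivative_rep_def by (simp_all add: sec_add_def sec_scale_def)

lemma rho_linear:
  assumes s: "s \<in> sections \<A> E" and W: "(W, \<psi>) \<in> trivs E" "m \<in> W"
  shows "linear (\<lambda>X. \<psi> (\<rho> X s m))"
  by (rule linearI)
    (simp_all add: rho_add[OF s] rho_scale[OF s] triv_add[OF W] triv_scale[OF W]
      section_fibre[OF rho_section[OF s]])

lemma derivative_to_rep_eq:
  "derivative_to_rep \<rho> (m, X) = (m, \<lambda>s \<in> sections \<A> E. \<rho> X s m, snd (act X m))"
  by (simp add: derivative_to_rep_def)

text \<open>Association to the action names the endomorphism of functions in the Leibniz rule of
  \<open>\<rho> X\<close>; evaluation at \<open>m\<close> then yields the symbol condition with the
  vector \<open>act X m\<close>.\<close>

lemma rho_deriv_vec: "is_deriv_vec \<A> E (m, \<lambda>s \<in> sections \<A> E. \<rho> X s m, snd (act X m))"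
proof -
  note over = rho_over[of X]
  have "\<rho> X (sec_add E s t) m = vadd E (\<rho> X s m) (\<rho> X t m)"
    if "s \<in> sections \<A> E" "t \<in> sections \<A> E" for s t
    using over that unfolding derivative_endo_over_def by (simp add: sec_add_def)
  moreover have "\<rho> X (sec_scale E (\<lambda>_. k) s) m = vscale E k (\<rho> X s m)" if "s \<in> sections \<A> E" for k s
    using over that unfolding derivative_endo_over_def by (simp add: sec_scale_def)
  moreover have "\<rho> X (sec_scale E f s) m = vadd E (vscale E (f m) (\<rho> X s m)) (vscale E (snd (act X m) f) (s m))"
    if "f \<in> Cinf \<A>" "s \<in> sections \<A> E" for f s
  proof -
    have "\<rho> X (sec_scale E f s) = sec_add E (sec_scale E f (\<rho> X s)) (sec_scale E (vf_app (act X) f) s)"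
      using over that unfolding derivative_endo_over_def by blast
    then show ?thesis by (simp add: sec_add_def sec_scale_def vf_app_def)
  qed
  ultimately show ?thesis
    unfolding is_deriv_vec_def prod.case
    by (simp add: act_tangent section_fibre rho_section sec_add_section sec_scale_section Cinf_const)
qed

lemma rho_fibre: "derivative_to_rep \<rho> (m, X) \<in> fibre DE m"
  by (simp add: deriv_algebroid_fibre derivative_to_rep_eq rho_deriv_vec)

text \<open>The first coordinate is linear because the action is. For the second,
  \<open>A X + A Y\<close> and \<open>k *\<^sub>R A X\<close> satisfy the formula that characterises
  \<open>A (X + Y)\<close> and \<open>A (k *\<^sub>R X)\<close>, and uniqueness applies.\<close>

lemma rho_coords_linear:
  assumes c: "c \<in> \<A>" "m \<in> fst c" and W: "(W, \<psi>) \<in> trivs E" "m \<in> W"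
  shows "linear (\<lambda>X. deriv_coords \<A> E c \<psi> (derivative_to_rep \<rho> (m, X)))"
proof -
  have coords: "coords \<A> c (m, snd (act X m)) = coords \<A> c (act X m)" for X
    by (simp flip: act_eq)
  have "\<exists>A. \<forall>X. deriv_coords \<A> E c \<psi> (derivative_to_rep \<rho> (m, X)) = (coords \<A> c (act X m), A X) \<and>
      (\<forall>s \<in> sections \<A> E. \<psi> (\<rho> X s m) = chart_deriv c m (coords \<A> c (act X m)) (\<psi> \<circ> s)
        + blinfun_apply (A X) (\<psi> (s m)))"
  proof (intro choice allI)
    fix X
    obtain A where A: "deriv_coords \<A> E c \<psi> (derivative_to_rep \<rho> (m, X)) = (coords \<A> c (act X m), A)"
      "\<And>s. s \<in> sections \<A> E \<Longrightarrow> \<psi> ((\<lambda>s \<in> sections \<A> E. \<rho> X s m) s)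
        = chart_deriv c m (coords \<A> c (act X m)) (\<psi> \<circ> s) + blinfun_apply A (\<psi> (s m))"
      by (rule deriv_coords_apply[OF rho_deriv_vec c W, of X, unfolded coords, folded derivative_to_rep_eq])
        (rule that)
    show "\<exists>A. deriv_coords \<A> E c \<psi> (derivative_to_rep \<rho> (m, X)) = (coords \<A> c (act X m), A) \<and>
      (\<forall>s \<in> sections \<A> E. \<psi> (\<rho> X s m) = chart_deriv c m (coords \<A> c (act X m)) (\<psi> \<circ> s)
        + blinfun_apply A (\<psi> (s m)))"
      by (rule exI[of _ A]) (simp add: A(1) flip: A(2))
  qed
  then obtain A where A: "\<And>X. deriv_coords \<A> E c \<psi> (derivative_to_rep \<rho> (m, X)) = (coords \<A> c (act X m), A X)"
    "\<And>X s. s \<in> sections \<A> E \<Longrightarrow> \<psi> (\<rho> X s m) = chart_deriv c m (coords \<A> c (act X m)) (\<psi> \<circ> s)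
        + blinfun_apply (A X) (\<psi> (s m))"
    by blast
  have unique: "A X = B"
    if "\<And>s. s \<in> sections \<A> E \<Longrightarrow> \<psi> (\<rho> X s m) = chart_deriv c m (coords \<A> c (act X m)) (\<psi> \<circ> s)
        + blinfun_apply B (\<psi> (s m))" for X B
  proof -
    have "deriv_coords \<A> E c \<psi> (derivative_to_rep \<rho> (m, X)) = (coords \<A> c (act X m), B)"
      unfolding derivative_to_rep_eq coords[symmetric]
      by (rule deriv_coords_unique[OF rho_deriv_vec c W]) (simp add: coords that)
    then show ?thesis using A(1) by simp
  qed
  have cl: "linear (\<lambda>v. chart_deriv c m v (\<psi> \<circ> s))" if "s \<in> sections \<A> E" for s
    unfolding comp_def
    by (rule chart_deriv_linear[OF c W(2) open_triv[OF W(1)] section_smooth[OF that W(1)]])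
  have ca: "coords \<A> c (act (X + Y) m) = coords \<A> c (act X m) + coords \<A> c (act Y m)" for X Y
    by (simp only: act_add coords_vadd[OF c act_fibre act_fibre])
  have cs: "coords \<A> c (act (k *\<^sub>R X) m) = k *\<^sub>R coords \<A> c (act X m)" for k X
    by (simp only: act_scale coords_vscale[OF c act_fibre])
  have "A (X + Y) = A X + A Y" for X Y
  proof (rule unique)
    fix s assume s: "s \<in> sections \<A> E"
    have "\<psi> (\<rho> (X + Y) s m) = \<psi> (\<rho> X s m) + \<psi> (\<rho> Y s m)"
      by (rule linear_add[OF rho_linear[OF s W]])
    then show "\<psi> (\<rho> (X + Y) s m) = chart_deriv c m (coords \<A> c (act (X + Y) m)) (\<psi> \<circ> s)
        + blinfun_apply (A X + A Y) (\<psi> (s m))"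
      by (simp only: A(2)[OF s, of X] A(2)[OF s, of Y] ca linear_add[OF cl[OF s]] blinfun.add_left
          add.assoc add.left_commute)
  qed
  moreover have "A (k *\<^sub>R X) = k *\<^sub>R A X" for k X
  proof (rule unique)
    fix s assume s: "s \<in> sections \<A> E"
    have "\<psi> (\<rho> (k *\<^sub>R X) s m) = k *\<^sub>R \<psi> (\<rho> X s m)"
      by (rule linear_cmul[OF rho_linear[OF s W]])
    then show "\<psi> (\<rho> (k *\<^sub>R X) s m) = chart_deriv c m (coords \<A> c (act (k *\<^sub>R X) m)) (\<psi> \<circ> s)
        + blinfun_apply (k *\<^sub>R A X) (\<psi> (s m))"
      by (simp only: A(2)[OF s, of X] cs linear_cmul[OF cl[OF s]] blinfun.scaleR_left scaleR_add_right)
  qed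
  ultimately show ?thesis
    by (intro linearI) (simp_all add: A(1) ca cs)
qed

lemma rho_coords_smooth:
  assumes c: "c \<in> \<A>" and W: "(W, \<psi>) \<in> trivs E"
  shows "smooth_fun \<A> (fst c \<inter> W) (\<lambda>m. deriv_coords \<A> E c \<psi> (derivative_to_rep \<rho> (m, X)))"
  unfolding derivative_to_rep_eq
proof (rule smooth_fun_deriv_coords[OF c W _ subset_refl rho_deriv_vec])
  show "open (fst c \<inter> W)" using open_chart[OF c] open_triv[OF W] by blast
  have "smooth_fun \<A> (fst c) (\<lambda>m. coords \<A> c (act X m))"
    using act_section[of X] c unfolding vector_field_iff by blast
  then show "smooth_fun \<A> (fst c \<inter> W) (\<lambda>m. coords \<A> c (m, snd (act X m)))"
    unfolding act_eq[symmetric] by (rule smooth_fun_subset) simp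
  show "smooth_fun \<A> (fst c \<inter> W) (\<lambda>m. \<psi> ((\<lambda>s \<in> sections \<A> E. \<rho> X s m) s))"
    if "s \<in> sections \<A> E" for s
    using smooth_fun_subset[OF section_smooth[OF rho_section[OF that] W], of "fst c \<inter> W" X] that
    by simp
qed

text \<open>The coordinates are smooth in \<open>m\<close> for each basis vector of the Lie algebra
  and linear in \<open>X\<close>, so they form a finite sum of products of a smooth function of
  \<open>m\<close> and a coordinate of \<open>X\<close>, which is jointly smooth.\<close>

lemma rho_smooth: "smooth_map (total_atlas \<A> G) (total_atlas \<A> DE) (derivative_to_rep \<rho>)"
  unfolding smooth_map_action_iff[OF rho_fibre]
proof (intro ballI)
  fix c1 c2 t assume c12: "c1 \<in> \<A>" "c2 \<in> \<A>" and "t \<in> trivs DE"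
  then obtain c W \<psi> where t: "t = (fst c \<inter> W, deriv_coords \<A> E c \<psi>)" and c: "c \<in> \<A>" and W: "(W, \<psi>) \<in> trivs E"
    unfolding trivs_DE by blast
  \<comment> \<open>The trivialisation of \<open>DE\<close> carries a chart \<open>c\<close> of its
    own, besides the source chart \<open>c1\<close> and the target chart \<open>c2\<close>.\<close>
  let ?S = "fst c1 \<inter> (fst c2 \<inter> (fst c \<inter> W))" and ?i = "inv_into (fst c1) (snd c1)"
  let ?R = "snd c1 ` ?S \<times> (UNIV :: 'g set)"
  let ?F = "\<lambda>m X. deriv_coords \<A> E c \<psi> (derivative_to_rep \<rho> (m, X))"
  have S: "open ?S" using open_chart c12 c open_triv[OF W] by blast
  have im: "open (snd c1 ` ?S)" by (rule open_chart_image[OF c12(1) S]) simp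
  then have R: "open ?R" by (rule open_Times[OF _ open_UNIV])
  have comp: "smooth_on ?R (\<lambda>z. h (?i (fst z)))" if "smooth_fun \<A> ?S h" for h :: "'m \<Rightarrow> 'x::real_normed_vector"
  proof -
    have "smooth_on (snd c1 ` ?S) (h \<circ> ?i)" by (rule smooth_funD[OF that c12(1)]) simp
    from smooth_on_compose[OF R finite_dimensional_model this smooth_on_bounded_linear[OF R bounded_linear_fst smooth_on_id[OF R]] im]
    show ?thesis by (auto simp: comp_def)
  qed
  have "smooth_on ?R (\<lambda>z. \<Sum>b\<in>fin_basis. coord b (snd z) *\<^sub>R ?F (?i (fst z)) b)"
  proof (intro smooth_on_sum[OF R] smooth_on_scaleR[OF R])
    fix b :: 'g
    show "smooth_on ?R (\<lambda>z. coord b (snd z))"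
      by (rule smooth_on_bounded_linear[OF R bounded_linear_coord[OF finite_dimensional_lie]
            smooth_on_bounded_linear[OF R bounded_linear_snd smooth_on_id[OF R]]])
    show "smooth_on ?R (\<lambda>z. ?F (?i (fst z)) b)"
      by (rule comp[OF smooth_fun_subset[OF rho_coords_smooth[OF c W]]]) auto
  qed
  then have "smooth_on ?R (\<lambda>z. ?F (?i (fst z)) (snd z))"
  proof (rule smooth_on_cong[OF R])
    fix z assume "z \<in> ?R"
    then have "?i (fst z) \<in> fst c" "?i (fst z) \<in> W" using chart_inv[OF c12(1)] by auto
    then show "(\<Sum>b\<in>fin_basis. coord b (snd z) *\<^sub>R ?F (?i (fst z)) b) = ?F (?i (fst z)) (snd z)"
      by (intro linear_coord_sum[OF finite_dimensional_lie rho_coords_linear[OF c _ W], symmetric])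
  qed
  moreover have "smooth_on ?R (\<lambda>z. snd c2 (?i (fst z)))"
    by (rule comp[OF smooth_fun_subset[OF smooth_fun_chart[OF c12(2)]]]) auto
  ultimately show "open (snd c1 ` (fst c1 \<inter> (fst c2 \<inter> fst t)) \<times> (UNIV :: 'g set)) \<and>
      smooth_on (snd c1 ` (fst c1 \<inter> (fst c2 \<inter> fst t)) \<times> UNIV)
        (\<lambda>z. (snd c2 (?i (fst z)), snd t (derivative_to_rep \<rho> (?i (fst z), snd z))))"
    using R by (simp add: t smooth_on_Pair)
qed

lemma rho_bundle_morphism: "bundle_morphism \<A> G DE (derivative_to_rep \<rho>)"
proof -
  have "derivative_to_rep \<rho> (m, X + Y) = vadd DE (derivative_to_rep \<rho> (m, X)) (derivative_to_rep \<rho> (m, Y))" for m X Y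
  proof -
    have "snd (act (X + Y) m) = (\<lambda>f \<in> Cinf \<A>. snd (act X m) f + snd (act Y m) f)"
      unfolding act_add by (subst (1 2) act_eq) (simp add: tangent_bundle_def)
    moreover have "(\<lambda>s \<in> sections \<A> E. \<rho> (X + Y) s m) = (\<lambda>s \<in> sections \<A> E. vadd E (\<rho> X s m) (\<rho> Y s m))"
      by (intro restrict_ext rho_add)
    ultimately show ?thesis
      by (simp add: derivative_to_rep_eq deriv_algebroid_def cong: restrict_cong)
  qed
  moreover have "derivative_to_rep \<rho> (m, k *\<^sub>R X) = vscale DE k (derivative_to_rep \<rho> (m, X))" for m k X
  proof -
    have "snd (act (k *\<^sub>R X) m) = (\<lambda>f \<in> Cinf \<A>. k * snd (act X m) f)"
      unfolding act_scale by (subst (1) act_eq) (simp add: tangent_bundle_def)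
    moreover have "(\<lambda>s \<in> sections \<A> E. \<rho> (k *\<^sub>R X) s m) = (\<lambda>s \<in> sections \<A> E. vscale E k (\<rho> X s m))"
      by (intro restrict_ext rho_scale)
    ultimately show ?thesis
      by (simp add: derivative_to_rep_eq deriv_algebroid_def cong: restrict_cong)
  qed
  moreover have "x \<in> fibre G m \<longleftrightarrow> fst x = m" for x m
    by (simp add: fibre_def action_algebroid_def)
  ultimately show ?thesis
    unfolding bundle_morphism_def using rho_smooth rho_fibre
    by (auto simp: total_G vadd_G vscale_G)
qed

section \<open>Compatibility with the brackets\<close>

lemma rho_section_fun:
  assumes W: "smooth_fun \<A> UNIV W" and s: "s \<in> sections \<A> E"
  shows "(\<lambda>x. \<rho> (W x) s x) \<in> sections \<A> E"
proof (rule sectionI)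
  show "\<rho> (W m) s m \<in> fibre E m" for m by (rule section_fibre[OF rho_section[OF s]])
  fix U \<psi> assume U: "(U, \<psi>) \<in> trivs E"
  have "smooth_fun \<A> U (\<lambda>x. \<Sum>b\<in>fin_basis. coord b (W x) *\<^sub>R \<psi> (\<rho> b s x))"
    using open_triv[OF U] smooth_fun_subset[OF W]
    by (intro smooth_fun_sum smooth_fun_scaleR section_smooth[OF rho_section[OF s] U]
        smooth_fun_bounded_linear[OF _ bounded_linear_coord[OF finite_dimensional_lie]]) auto
  then show "smooth_fun \<A> U (\<lambda>x. \<psi> (\<rho> (W x) s x))"
    by (rule smooth_fun_cong[OF open_triv[OF U]])
      (rule linear_coord_sum[OF finite_dimensional_lie rho_linear[OF s U], symmetric])
qed

text \<open>Both sections \<open>x \<mapsto> \<rho>(W x) s x\<close> and \<open>\<rho>(W m) s\<close> are combinations of the \<open>\<rho> b s\<close>, with coefficients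
  that agree at \<open>m\<close>, so that their images differ only in the derivatives of the coefficients.\<close>

lemma rho_derivative:
  assumes V: "V m \<in> fibre TM m" and d: "is_deriv_vec \<A> E (m, d, snd (V m))"
    and W: "smooth_fun \<A> UNIV W" and s: "s \<in> sections \<A> E" and U: "(U, \<psi>) \<in> trivs E" "m \<in> U"
  shows "\<psi> (d (\<lambda>x. \<rho> (W x) s x)) = \<psi> (d (\<rho> (W m) s)) + \<psi> (\<rho> (lie_deriv V W m) s m)"
proof -
  note fin = finite_dimensional_lie
  define X where "X = snd (V m)"
  have X: "(m, X) \<in> total TM" using fibre_tangentD[OF V] by (simp add: X_def)
  note d = d[folded X_def]
  note lin = linear_coord_sum[OF fin rho_linear[OF s]]
  have C: "(\<lambda>x. coord b (W x)) \<in> Cinf \<A>" for b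
    unfolding Cinf_iff by (intro smooth_fun_bounded_linear[OF open_UNIV _ W] bounded_linear_coord fin)
  have ex: "\<exists>U' \<psi>'. (U', \<psi>') \<in> trivs E \<and> x \<in> U' \<and>
      \<psi>' (\<rho> Z s x) = (\<Sum>b\<in>fin_basis. coord b Z *\<^sub>R \<psi>' (\<rho> b s x))" for x Z
  proof -
    obtain U' \<psi>' where U': "(U', \<psi>') \<in> trivs E" "x \<in> U'" by (rule triv_at)
    show ?thesis by (rule exI[of _ U'], rule exI[of _ \<psi>'], intro conjI U' lin[OF U'])
  qed
  have "\<psi> (d (\<lambda>x. \<rho> (W x) s x)) = (\<Sum>b\<in>fin_basis. coord b (W m) *\<^sub>R \<psi> (d (\<rho> b s))
      + X (\<lambda>x. coord b (W x)) *\<^sub>R \<psi> (\<rho> b s m))"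
    by (rule deriv_vec_sum[OF d finite_fin_basis[OF fin] C rho_section[OF s] rho_section_fun[OF W s] ex U])
  moreover have "\<psi> (d (\<rho> (W m) s)) = (\<Sum>b\<in>fin_basis. coord b (W m) *\<^sub>R \<psi> (d (\<rho> b s))
      + X (\<lambda>_. coord b (W m)) *\<^sub>R \<psi> (\<rho> b s m))"
    by (rule deriv_vec_sum[OF d finite_fin_basis[OF fin] Cinf_const rho_section[OF s] rho_section[OF s] ex U])
  moreover have "\<psi> (\<rho> (lie_deriv V W m) s m) = (\<Sum>b\<in>fin_basis. X (\<lambda>x. coord b (W x)) *\<^sub>R \<psi> (\<rho> b s m))"
    using lie_deriv_functional[of V m W, OF V W linear_coord[OF fin]]
    by (subst lin[OF U]) (simp add: X_def)
  ultimately show ?thesis by (simp add: tangent_const[OF X] sum.distrib)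
qed

text \<open>Operator and tangent vector are compared separately, the former by
  \<open>rho_derivative\<close> and \<open>rho_bracket\<close>, the latter by the parallel facts
  \<open>act_derivative\<close> and \<open>act_bracket\<close>.\<close>

lemma rho_algebroid_bracket:
  assumes V: "V \<in> sections \<A> G" and W: "W \<in> sections \<A> G"
  shows "derivative_to_rep \<rho> \<circ> bracket G V W = bracket DE (derivative_to_rep \<rho> \<circ> V) (derivative_to_rep \<rho> \<circ> W)"
proof
  fix m
  define v w where "v = (\<lambda>m. snd (V m))" and "w = (\<lambda>m. snd (W m))"
  have Veq: "V x = (x, v x)" and Weq: "W x = (x, w x)" for x
    using V W unfolding action_sections_iff v_def w_def by (metis prod.collapse)+
  have v: "smooth_fun \<A> UNIV v" and w: "smooth_fun \<A> UNIV w"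
    using V W unfolding action_sections_iff v_def w_def by blast+
  define VM WM where "VM = (\<lambda>m. act (v m) m)" and "WM = (\<lambda>m. act (w m) m)"
  have dv: "is_deriv_vec \<A> E (m, \<lambda>s \<in> sections \<A> E. \<rho> (v m) s m, snd (VM m))"
    "is_deriv_vec \<A> E (m, \<lambda>s \<in> sections \<A> E. \<rho> (w m) s m, snd (WM m))"
    unfolding VM_def WM_def by (rule rho_deriv_vec)+
  have VM: "VM m \<in> fibre TM m" and WM: "WM m \<in> fibre TM m" for m
    unfolding VM_def WM_def by (rule act_fibre)+
  define Z where "Z = lie_deriv VM w m - lie_deriv WM v m + br (v m) (w m)"
  have lhs: "(derivative_to_rep \<rho> \<circ> bracket G V W) m
      = (m, \<lambda>s \<in> sections \<A> E. \<rho> Z s m, snd (act Z m))"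
    by (simp add: action_algebroid_def Let_def comp_def derivative_to_rep_eq Z_def VM_def WM_def v_def w_def)
  have app: "deriv_app (derivative_to_rep \<rho> \<circ> V) s = (\<lambda>x. \<rho> (v x) s x)"
    "deriv_app (derivative_to_rep \<rho> \<circ> W) s = (\<lambda>x. \<rho> (w x) s x)" if "s \<in> sections \<A> E" for s
    using that by (simp_all add: deriv_app_def Veq Weq derivative_to_rep_eq)
  have anc: "deriv_anchor \<circ> (derivative_to_rep \<rho> \<circ> V) = VM" "deriv_anchor \<circ> (derivative_to_rep \<rho> \<circ> W) = WM"
    by (simp_all add: fun_eq_iff Veq Weq derivative_to_rep_eq deriv_anchor_Pair VM_def WM_def flip: act_eq)
  have rhs: "bracket DE (derivative_to_rep \<rho> \<circ> V) (derivative_to_rep \<rho> \<circ> W) m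
      = (m, \<lambda>s \<in> sections \<A> E. sec_diff E (\<lambda>x. \<rho> (v x) (\<lambda>x. \<rho> (w x) s x) x)
          (\<lambda>x. \<rho> (w x) (\<lambda>x. \<rho> (v x) s x) x) m, snd (vf_bracket \<A> VM WM m))"
    by (simp add: deriv_algebroid_def anc app rho_section_fun v w cong: restrict_cong)
  have "\<rho> Z s m = sec_diff E (\<lambda>x. \<rho> (v x) (\<lambda>x. \<rho> (w x) s x) x) (\<lambda>x. \<rho> (w x) (\<lambda>x. \<rho> (v x) s x) x) m"
    if s: "s \<in> sections \<A> E" for s
  proof -
    obtain U \<psi> where U: "(U, \<psi>) \<in> trivs E" "m \<in> U" by (rule triv_at)
    note sec = rho_section_fun[OF v s] rho_section_fun[OF w s] rho_section[OF s]
    note fib = section_fibre[OF rho_section[OF sec(1)]] section_fibre[OF rho_section[OF sec(2)]]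
      section_fibre[OF rho_section[OF sec(3)]] section_fibre[OF sec(3)]
    note lin = rho_linear[OF s U]
    \<comment> \<open>The outer section enters only through its value at \<open>m\<close>: the
      operator \<open>\<rho> (v m)\<close> is frozen while the inner section \<open>w\<close>
      varies.\<close>
    have dV: "\<psi> (\<rho> (v m) (\<lambda>x. \<rho> (w x) s x) m) = \<psi> (\<rho> (v m) (\<rho> (w m) s) m) + \<psi> (\<rho> (lie_deriv VM w m) s m)"
      using rho_derivative[of VM m, OF VM dv(1) w s U] sec by simp
    have dW: "\<psi> (\<rho> (w m) (\<lambda>x. \<rho> (v x) s x) m) = \<psi> (\<rho> (w m) (\<rho> (v m) s) m) + \<psi> (\<rho> (lie_deriv WM v m) s m)"
      using rho_derivative[of WM m, OF WM dv(2) v s U] sec by simp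
    have dB: "\<psi> (\<rho> (br (v m) (w m)) s m) = \<psi> (\<rho> (v m) (\<rho> (w m) s) m) - \<psi> (\<rho> (w m) (\<rho> (v m) s) m)"
      by (simp add: rho_bracket[OF s] sec_diff_def triv_diff[OF U] fib)
    have "\<psi> (\<rho> Z s m) = \<psi> (\<rho> (lie_deriv VM w m) s m) - \<psi> (\<rho> (lie_deriv WM v m) s m) + \<psi> (\<rho> (br (v m) (w m)) s m)"
      unfolding Z_def by (simp only: linear_add[OF lin] linear_diff[OF lin])
    also have "\<dots> = \<psi> (\<rho> (v m) (\<lambda>x. \<rho> (w x) s x) m) - \<psi> (\<rho> (w m) (\<lambda>x. \<rho> (v x) s x) m)"
      unfolding dV dW dB by simp
    also have "\<dots> = \<psi> (sec_diff E (\<lambda>x. \<rho> (v x) (\<lambda>x. \<rho> (w x) s x) x) (\<lambda>x. \<rho> (w x) (\<lambda>x. \<rho> (v x) s x) x) m)"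
      by (simp add: sec_diff_def triv_diff[OF U] fib)
    finally show ?thesis
      by (rule triv_inj[OF U fib(4), rotated]) (simp add: sec_diff_def vadd_fibre vscale_fibre fib)
  qed
  moreover have "snd (act Z m) = snd (vf_bracket \<A> VM WM m)"
  proof (rule extensionalityI)
    show "snd (act Z m) \<in> extensional (Cinf \<A>)" by (rule tangent_extensional[OF act_tangent])
    show "snd (vf_bracket \<A> VM WM m) \<in> extensional (Cinf \<A>)" by (simp add: vf_bracket_def)
    fix f assume f: "f \<in> Cinf \<A>"
    have "snd (act (br (v m) (w m)) m) f = snd (vf_bracket \<A> (act (v m)) (act (w m)) m) f"
      by (simp only: act_bracket)
    also have "\<dots> = snd (VM m) (vf_app (act (w m)) f) - snd (WM m) (vf_app (act (v m)) f)"
      using f by (simp add: vf_bracket_def vf_app_act VM_def WM_def)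
    finally have "snd (act Z m) f = snd (VM m) (\<lambda>x. snd (act (w x) x) f) - snd (WM m) (\<lambda>x. snd (act (v x) x) f)"
      unfolding Z_def act_derivative[of VM m, OF VM w f] act_derivative[of WM m, OF WM v f]
        linear_add[OF act_apply_linear[OF f]] linear_diff[OF act_apply_linear[OF f]]
      by simp
    then show "snd (act Z m) f = snd (vf_bracket \<A> VM WM m) f"
      using f by (simp add: vf_bracket_def vf_app_def VM_def WM_def)
  qed
  ultimately show "(derivative_to_rep \<rho> \<circ> bracket G V W) m
      = bracket DE (derivative_to_rep \<rho> \<circ> V) (derivative_to_rep \<rho> \<circ> W) m"
    unfolding lhs rhs by (simp cong: restrict_cong)
qed

lemma rho_algebroid_rep: "algebroid_rep \<A> G E (derivative_to_rep \<rho>)"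
proof -
  have "anchor DE (derivative_to_rep \<rho> x) = anchor G x" for x
    by (cases x) (simp add: anchor_DE anchor_G derivative_to_rep_eq deriv_anchor_Pair flip: act_eq)
  then show ?thesis
    unfolding algebroid_rep_def algebroid_morphism_def
    using rho_bundle_morphism rho_algebroid_bracket by blast
qed

text \<open>Outside the smooth sections both sides are \<open>undefined\<close>, by extensionality
  of \<open>\<rho> X\<close>.\<close>

lemma rep_to_derivative_to_rep: "rep_to_derivative (derivative_to_rep \<rho>) = \<rho>"
proof (intro ext)
  fix X s m
  show "rep_to_derivative (derivative_to_rep \<rho>) X s m = \<rho> X s m"
    using PiE_arb[OF rho_PiE, of s X]
    by (cases "s \<in> sections \<A> E")
      (simp_all add: rep_to_derivative_def deriv_app_def derivative_to_rep_eq)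
qed

end

lemma rep_to_derivative_bij:
  "bij_betw rep_to_derivative {\<Phi>. algebroid_rep \<A> G E \<Phi>}
    {\<rho>. derivative_rep \<A> E br \<rho> \<and> associated_to_action \<A> E act \<rho>}"
  unfolding bij_betw_def
proof (intro conjI rep_to_derivative_inj equalityI subsetI)
  show "\<rho> \<in> {\<rho>. derivative_rep \<A> E br \<rho> \<and> associated_to_action \<A> E act \<rho>}"
    if "\<rho> \<in> rep_to_derivative ` {\<Phi>. algebroid_rep \<A> G E \<Phi>}" for \<rho>
    using that rep_derivative_rep rep_associated by auto
  show "\<rho> \<in> rep_to_derivative ` {\<Phi>. algebroid_rep \<A> G E \<Phi>}"
    if "\<rho> \<in> {\<rho>. derivative_rep \<A> E br \<rho> \<and> associated_to_action \<A> E act \<rho>}" for \<rho>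
    using that rho_algebroid_rep rep_to_derivative_to_rep
    by (intro image_eqI[of _ _ "derivative_to_rep \<rho>"]) auto
qed

end

theorem theorem2p4:
  fixes \<A> :: "('m::{t2_space,second_countable_topology}, 'e::real_normed_vector) atlas"
    and E :: "('m, 'v, 'f::real_normed_vector) vbundle"
    and br :: "'g::real_normed_vector \<Rightarrow> 'g \<Rightarrow> 'g"
    and act :: "'g \<Rightarrow> 'm \<Rightarrow> 'm tangent"
  assumes "smooth_manifold \<A>"
    and "vector_bundle \<A> E"
    and "lie_algebra br"
    and "infinitesimal_action \<A> br act"
  shows "bij_betw
           (\<lambda>\<Phi>. \<lambda>X. \<lambda>s \<in> sections \<A> E. deriv_app (\<lambda>m. \<Phi> (m, X)) s)
           {\<Phi>. algebroid_rep \<A> (action_algebroid br act) E \<Phi>}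
           {\<rho>. derivative_rep \<A> E br \<rho> \<and> associated_to_action \<A> E act \<rho>}"
proof -
  interpret bundle_action \<A> E br act
    by unfold_locales (fact assms)+
  show ?thesis
    using rep_to_derivative_bij unfolding rep_to_derivative_def .
qed

end
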